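(* Let $g$ be a totally positive function of finite type $m\ge 2$. Let $M\in\mathbb{N}$, $\alpha=M$, $\beta=1/M$, and let $K\in\mathbb{N}$ with $K/M\in\mathbb{N}$. (i) If $K/M$ is odd, then $\mathcal{G}(P_Kg,\alpha,\beta)$ is a Gabor frame for $L^2(\mathbb{T}_K)$. (ii) If $K/M$ is odd, then $\mathcal{G}(P_KSg,\alpha,\beta)$ is a Gabor frame for $\mathbb{C}^K$. Assume in addition that $g$ is even. Then: (iii) If $M$ is odd, then $\mathcal{G}(Sg,\alpha,\beta)$ is a Gabor frame for $\ell^2(\mathbb{Z})$. (iv) If $M$ is odd, then $\mathcal{G}(P_KSg,\alpha,\beta)$ is a Gabor frame for $\mathbb{C}^K$.
   Context: $j$ is the imaginary unit, $\hat g(\xi)=\int g(x)e^{-2\pi jx\xi}dx$. $g\in L^1(\mathbb{R})$ is totally positive of finite type $m$ if $\hat g(\xi)=C\prod_{k=1}^m(1+2\pi j\delta_k\xi)^{-1}$ with $C>0$ and nonzero real $\delta_k$. $Sg=(g(k))_{k\in\mathbb{Z}}$; $P_Kg(x)=\sum_{k\in\mathbb{Z}}g(x-kK)$ for $x\in[0,K]$; $P_KSg=(\sum_{k}g(n-kK))_{n=0}^{K-1}\in\mathbb{C}^K$. Time-frequency shifts: on $\ell^2(\mathbb{Z})$, $M_\xi T_kf(l)=f(l-k)e^{2\pi j\xi l}$; on $L^2(\mathbb{T}_K)$ ($\mathbb{T}_K=[0,K]$ periodic), $M_\xi T_xf(t)=f((t-x)\bmod K)e^{2\pi j\xi t}$;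 on $\mathbb{C}^K$, $M_\xi T_kf(n)=f((n-k)\bmod K)e^{2\pi j\xi n}$. Gabor families: $\mathcal{G}(Sg,M,1/M)=\{M_{l/M}T_{kM}Sg:k\in\mathbb{Z},l=0,\ldots,M-1\}$; $\mathcal{G}(P_Kg,M,1/M)=\{M_{l/M}T_{kM}P_Kg:k=0,\ldots,K/M-1,l\in\mathbb{Z}\}$; $\mathcal{G}(P_KSg,M,1/M)=\{M_{l/M}T_{kM}P_KSg:k=0,\ldots,K/M-1,l=0,\ldots,M-1\}$. A family $(e_i)$ is a frame for $H$ if $A\|f\|^2\le\sum|\langle f,e_i\rangle|^2\le B\|f\|^2$ for all $f\in H$ with constants $A,B>0$. *)

theory Defs
  imports "HOL-Analysis.Analysis"
begin

definition fourier :: "(real \<Rightarrow> complex) \<Rightarrow> real \<Rightarrow> complex" where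
  "fourier g \<xi> = (LINT x|lborel. g x * cis (- 2 * pi * x * \<xi>))"

definition TP_finite_type :: "(real \<Rightarrow> complex) \<Rightarrow> nat \<Rightarrow> bool" where
  "TP_finite_type g m \<longleftrightarrow> integrable lborel g \<and>
     (\<exists>C::real. C > 0 \<and> (\<exists>\<delta>::nat \<Rightarrow> real. (\<forall>k<m. \<delta> k \<noteq> 0) \<and>
        (\<forall>\<xi>. fourier g \<xi> =
              complex_of_real C / (\<Prod>k<m. 1 + \<i> * complex_of_real (2 * pi * \<delta> k * \<xi>)))))"

definition even_fun :: "(real \<Rightarrow> complex) \<Rightarrow> bool" where
  "even_fun g \<longleftrightarrow> (\<forall>x. g (- x) = g x)"

definition samp :: "(real \<Rightarrow> complex) \<Rightarrow> int \<Rightarrow> complex" where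
  "samp g k = g (of_int k)"

definition periodize :: "(real \<Rightarrow> complex) \<Rightarrow> real \<Rightarrow> real \<Rightarrow> complex" where
  "periodize g K x = (\<Sum>\<^sub>\<infinity>k::int. g (x - of_int k * K))"

definition PKS :: "(real \<Rightarrow> complex) \<Rightarrow> nat \<Rightarrow> int \<Rightarrow> complex" where
  "PKS g K n = (\<Sum>\<^sub>\<infinity>k::int. g (of_int n - of_int k * of_nat K))"

definition realmod :: "real \<Rightarrow> real \<Rightarrow> real" where
  "realmod a p = a - p * of_int \<lfloor>a / p\<rfloor>"

definition l2Z :: "(int \<Rightarrow> complex) \<Rightarrow> bool" where
  "l2Z f \<longleftrightarrow> (\<lambda>n. (cmod (f n))\<^sup>2) summable_on UNIV"

definition l2Z_inner :: "(int \<Rightarrow> complex) \<Rightarrow> (int \<Rightarrow> complex) \<Rightarrow> complex" where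
  "l2Z_inner f h = (\<Sum>\<^sub>\<infinity>n. f n * cnj (h n))"

definition l2Z_frame :: "'i set \<Rightarrow> ('i \<Rightarrow> int \<Rightarrow> complex) \<Rightarrow> bool" where
  "l2Z_frame I e \<longleftrightarrow> (\<forall>i\<in>I. l2Z (e i)) \<and>
     (\<exists>A B. 0 < A \<and> 0 < B \<and> (\<forall>f. l2Z f \<longrightarrow>
        (\<lambda>i. (cmod (l2Z_inner f (e i)))\<^sup>2) summable_on I \<and>
        A * (\<Sum>\<^sub>\<infinity>n. (cmod (f n))\<^sup>2) \<le> (\<Sum>\<^sub>\<infinity>i\<in>I. (cmod (l2Z_inner f (e i)))\<^sup>2) \<and>
        (\<Sum>\<^sub>\<infinity>i\<in>I. (cmod (l2Z_inner f (e i)))\<^sup>2) \<le> B * (\<Sum>\<^sub>\<infinity>n. (cmod (f n))\<^sup>2)))"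

definition CK_inner :: "nat \<Rightarrow> (nat \<Rightarrow> complex) \<Rightarrow> (nat \<Rightarrow> complex) \<Rightarrow> complex" where
  "CK_inner K f h = (\<Sum>n<K. f n * cnj (h n))"

definition CK_frame :: "nat \<Rightarrow> 'i set \<Rightarrow> ('i \<Rightarrow> nat \<Rightarrow> complex) \<Rightarrow> bool" where
  "CK_frame K I e \<longleftrightarrow> finite I \<and>
     (\<exists>A B. 0 < A \<and> 0 < B \<and> (\<forall>f.
        A * (\<Sum>n<K. (cmod (f n))\<^sup>2) \<le> (\<Sum>i\<in>I. (cmod (CK_inner K f (e i)))\<^sup>2) \<and>
        (\<Sum>i\<in>I. (cmod (CK_inner K f (e i)))\<^sup>2) \<le> B * (\<Sum>n<K. (cmod (f n))\<^sup>2)))"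

subsection \<open>L2(T_K), functions on [0,K] (extended K-periodically)\<close>

definition L2TK :: "nat \<Rightarrow> (real \<Rightarrow> complex) \<Rightarrow> bool" where
  "L2TK K f \<longleftrightarrow> f \<in> borel_measurable (lebesgue_on {0..real K}) \<and>
     integrable (lebesgue_on {0..real K}) (\<lambda>t. (cmod (f t))\<^sup>2)"

definition L2TK_inner :: "nat \<Rightarrow> (real \<Rightarrow> complex) \<Rightarrow> (real \<Rightarrow> complex) \<Rightarrow> complex" where
  "L2TK_inner K f h = (LINT t|lebesgue_on {0..real K}. f t * cnj (h t))"

definition L2TK_norm2 :: "nat \<Rightarrow> (real \<Rightarrow> complex) \<Rightarrow> real" where
  "L2TK_norm2 K f = (LINT t|lebesgue_on {0..real K}. (cmod (f t))\<^sup>2)"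

definition L2TK_frame :: "nat \<Rightarrow> 'i set \<Rightarrow> ('i \<Rightarrow> real \<Rightarrow> complex) \<Rightarrow> bool" where
  "L2TK_frame K I e \<longleftrightarrow> (\<forall>i\<in>I. L2TK K (e i)) \<and>
     (\<exists>A B. 0 < A \<and> 0 < B \<and> (\<forall>f. L2TK K f \<longrightarrow>
        (\<lambda>i. (cmod (L2TK_inner K f (e i)))\<^sup>2) summable_on I \<and>
        A * L2TK_norm2 K f \<le> (\<Sum>\<^sub>\<infinity>i\<in>I. (cmod (L2TK_inner K f (e i)))\<^sup>2) \<and>
        (\<Sum>\<^sub>\<infinity>i\<in>I. (cmod (L2TK_inner K f (e i)))\<^sup>2) \<le> B * L2TK_norm2 K f))"

text \<open>G(Sg, M, 1/M): (k,l) with k in Z, l = 0..M-1;  M_{l/M} T_{kM} Sg (n) = Sg(n - kM) e^{2 pi j l n / M}\<close>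
definition gabor_Sg :: "(real \<Rightarrow> complex) \<Rightarrow> nat \<Rightarrow> int \<times> nat \<Rightarrow> int \<Rightarrow> complex" where
  "gabor_Sg g M = (\<lambda>(k, l) n. samp g (n - k * int M) * cis (2 * pi * (real l / real M) * of_int n))"

text \<open>G(P_K g, M, 1/M): (k,l) with k = 0..K/M-1, l in Z;
  M_{l/M} T_{kM} P_K g (t) = P_K g ((t - kM) mod K) e^{2 pi j l t / M}\<close>
definition gabor_PKg :: "(real \<Rightarrow> complex) \<Rightarrow> nat \<Rightarrow> nat \<Rightarrow> nat \<times> int \<Rightarrow> real \<Rightarrow> complex" where
  "gabor_PKg g K M = (\<lambda>(k, l) t. periodize g (real K) (realmod (t - real (k * M)) (real K))
       * cis (2 * pi * (of_int l / real M) * t))"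

text \<open>G(P_K S g, M, 1/M): (k,l) with k = 0..K/M-1, l = 0..M-1;
  M_{l/M} T_{kM} P_K S g (n) = P_K S g ((n - kM) mod K) e^{2 pi j l n / M}\<close>
definition gabor_PKSg :: "(real \<Rightarrow> complex) \<Rightarrow> nat \<Rightarrow> nat \<Rightarrow> nat \<times> nat \<Rightarrow> nat \<Rightarrow> complex" where
  "gabor_PKSg g K M = (\<lambda>(k, l) n. PKS g K ((int n - int (k * M)) mod int K)
       * cis (2 * pi * (real l / real M) * real n))"

end

theory Submission
  imports Defs "HOL-Probability.Probability"
begin

text \<open>
  Up to a positive factor \<open>g\<close> is a convolution of one-sided exponentials \<open>E\<^sub>d\<close>. For the Zak transform
  \<open>Z(x,\<theta>) = \<Sum>\<^sub>k g(x + kM) e\<^sup>i\<^sup>k\<^sup>\<theta>\<close> and a constant \<open>c\<close>, convolution with \<open>E\<^sub>d\<close> turns \<open>v = Re (c Z)\<close>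
  into a solution \<open>w\<close> of \<open>w + d w' = v\<close>, and by Rolle's argument \<open>w\<close> has at most one sign change more
  than \<open>v\<close> on any interval. For a single exponential \<open>v\<close> equals \<open>cos (\<phi> - n\<theta>)\<close> on \<open>[nM, (n+1)M)\<close> up
  to a factor of constant sign, so it changes sign about \<open>\<theta>/\<pi>\<close> times per length \<open>M\<close>. As the zeros of
  \<open>Z(\<cdot>,\<theta>)\<close> are \<open>M\<close>-periodic, there is none if \<open>0 \<le> \<theta> < \<pi>\<close> and at most one modulo \<open>M\<close> if \<open>\<theta> = \<pi>\<close>;
  for even \<open>g\<close> the latter lies at \<open>M/2\<close>.

  At critical density the frame operators are unitarily equivalent to multiplication by \<open>|Z|\<^sup>2\<close>,
  sampled at \<open>\<theta> \<in> (2\<pi>M/K) \<int>\<close> for the families on \<open>\<complex>\<^sup>K\<close> and \<open>L\<^sup>2(T\<^sub>K)\<close> and at integers \<open>x\<close> for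
  those on \<open>\<complex>\<^sup>K\<close> and \<open>l\<^sup>2(\<int>)\<close>. If \<open>K/M\<close> is odd, then \<open>\<theta> = \<pi>\<close> is never sampled; if \<open>M\<close> is odd,
  then \<open>x = M/2\<close> is never sampled.
\<close>

section \<open>Sign changes of solutions of w + d w' = v\<close>

text \<open>The count of sign changes is sharp only asymptotically: each convolution may cost one,
  so on a fixed interval the comparison proves nothing. Zeros are therefore counted on intervals of
  length \<open>n * M\<close> with \<open>n\<close> large, where a loss that depends only on the
  number of kernels is negligible against the linear growth; periodicity of the zero set supplies
  the zeros. A zero of \<open>Z\<close> need not be a sign change of \<open>Re (c Z)\<close>. The
  last convolution is thus treated by Rolle's argument for zeros instead of signs, which requires
  that the function before it vanish on no interval. This is where the freedom in \<open>c\<close>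
  enters: a zero of \<open>Z\<close> annihilates \<open>Re (c Z)\<close> for every \<open>c\<close>,
  so \<open>c\<close> may be chosen to clear the denominator of the closed form for a single
  exponential and to give it a generic phase, for which no cosine factor vanishes. Continuity of
  \<open>g\<close> is assumed in the theorem because the Fourier transform fixes \<open>g\<close>
  only up to null sets, while the Gabor families use its values at points. With at least two factors
  the convolution is itself continuous, so it is the same representative.\<close>

definition alternates :: "(real \<Rightarrow> real) \<Rightarrow> nat \<Rightarrow> real \<Rightarrow> real \<Rightarrow> bool" where
  "alternates v N a b \<longleftrightarrow> (\<exists>s t. \<bar>s\<bar> = 1 \<and> (\<forall>i<N. t i \<le> t (Suc i)) \<and> a \<le> t 0 \<and> t N \<le> b \<and>
     (\<forall>i\<le>N. s * (-1)^i * v (t i) > 0))"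

text \<open>The equation \<open>w + d w' = v\<close> in integrated form, which makes sense for discontinuous \<open>v\<close>.\<close>

definition exp_primitive :: "real \<Rightarrow> (real \<Rightarrow> real) \<Rightarrow> (real \<Rightarrow> real) \<Rightarrow> bool" where
  "exp_primitive d v w \<longleftrightarrow> (\<forall>p q. p \<le> q \<longrightarrow>
     ((\<lambda>t. exp (t / d) / d * v t) has_integral (exp (q / d) * w q - exp (p / d) * w p)) {p..q})"

text \<open>Rules out that \<open>v\<close> vanishes on an interval, so that two zeros of \<open>w\<close> force both strict signs of \<open>v\<close>
  between them.\<close>

definition signed_somewhere :: "(real \<Rightarrow> real) \<Rightarrow> bool" where
  "signed_somewhere v \<longleftrightarrow> (\<forall>a b. a < b \<longrightarrow> (\<exists>c d s. a \<le> c \<and> c < d \<and> d \<le> b \<and> \<bar>s\<bar> = 1 \<and>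
     continuous_on {c..d} v \<and> (\<forall>t\<in>{c..d}. s * v t > 0)))"

text \<open>\<open>exp (t / d) * w t\<close> is a primitive of \<open>exp (t / d) / d * v t\<close>,
  so it is monotone wherever \<open>v\<close> keeps a sign; \<open>sgn d\<close> records the
  direction.\<close>

lemma exp_primitive_const_sign:
  assumes E: "exp_primitive d v w" and d: "d \<noteq> 0" and pq: "p \<le> q"
    and le: "\<And>t. t \<in> {p..q} \<Longrightarrow> s * v t \<le> 0"
  shows "s * sgn d * (exp (q / d) * w q - exp (p / d) * w p) \<le> 0"
proof -
  have "((\<lambda>t. s * sgn d * (exp (t / d) / d * v t)) has_integral
      s * sgn d * (exp (q / d) * w q - exp (p / d) * w p)) {p..q}"
    using E pq unfolding exp_primitive_def by (intro has_integral_mult_right) auto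
  moreover have "s * sgn d * (exp (t / d) / d * v t) \<le> 0" if "t \<in> {p..q}" for t
  proof -
    have "s * sgn d * (exp (t / d) / d * v t) = exp (t / d) / \<bar>d\<bar> * (s * v t)"
      using d by (simp add: sgn_if field_simps)
    also have "\<dots> \<le> 0"
      using le[OF that] by (intro mult_nonneg_nonpos[of "exp (t / d) / \<bar>d\<bar>" "s * v t"]) simp_all
    finally show ?thesis .
  qed
  ultimately show ?thesis
    using has_integral_le[OF _ has_integral_0] by blast
qed

text \<open>Where \<open>w\<close> changes sign, \<open>exp (t / d) * w t\<close> has a strict
  increment, so \<open>v\<close> must take the corresponding strict sign somewhere in that gap. The
  increments alternate, and \<open>N + 2\<close> points have \<open>N + 1\<close> gaps. Neighbouring
  gaps share an end point, so only the weak order of the new points is immediate.\<close>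

lemma alternates_step:
  assumes E: "exp_primitive d v w" and d: "d \<noteq> 0" and A: "alternates w (Suc N) a b"
  shows "alternates v N a b"
proof -
  obtain s t where s: "\<bar>s\<bar> = 1" and mono: "\<And>i. i < Suc N \<Longrightarrow> t i \<le> t (Suc i)"
    and ab: "a \<le> t 0" "t (Suc N) \<le> b" and pos: "\<And>i. i \<le> Suc N \<Longrightarrow> s * (-1)^i * w (t i) > 0"
    using A unfolding alternates_def by blast
  \<comment> \<open>The sign of \<open>v\<close> in the first gap: \<open>w\<close> passes from sign
    \<open>s\<close> to sign \<open>- s\<close>, and the integrand has the sign of \<open>v\<close>
    times that of \<open>d\<close>.\<close>
  define r where "r = - s * sgn d"
  have "\<exists>u. u \<in> {t i..t (Suc i)} \<and> r * (-1)^i * v u > 0" if i: "i \<le> N" for i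
  proof (rule ccontr)
    assume "\<not> ?thesis"
    hence "r * (-1)^i * v u \<le> 0" if "u \<in> {t i..t (Suc i)}" for u
      using that by force
    hence "r * (-1)^i * sgn d * (exp (t (Suc i) / d) * w (t (Suc i)) - exp (t i / d) * w (t i)) \<le> 0"
      using i by (intro exp_primitive_const_sign[OF E d]) (auto intro: mono)
    moreover have "r * (-1)^i * sgn d * (exp (t (Suc i) / d) * w (t (Suc i)) - exp (t i / d) * w (t i))
        = exp (t (Suc i) / d) * (s * (-1)^Suc i * w (t (Suc i))) + exp (t i / d) * (s * (-1)^i * w (t i))"
      using d by (simp add: r_def sgn_if algebra_simps)
    moreover have "\<dots> > 0"
      using i by (intro add_pos_pos mult_pos_pos pos) auto
    ultimately show False by simp
  qed
  then obtain u where u: "\<And>i. i \<le> N \<Longrightarrow> u i \<in> {t i..t (Suc i)} \<and> r * (-1)^i * v (u i) > 0"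
    by metis
  show ?thesis
    unfolding alternates_def
  proof (intro exI conjI allI impI)
    show "\<bar>r\<bar> = 1" using s d by (simp add: r_def abs_mult abs_sgn_eq)
    show "u i \<le> u (Suc i)" if "i < N" for i
      using u[of i] u[of "Suc i"] that by auto
    show "a \<le> u 0" using u[of 0] ab by auto
    show "u N \<le> b" using u[of N] ab by auto
    show "r * (-1)^i * v (u i) > 0" if "i \<le> N" for i
      using u[OF that] by auto
  qed
qed

lemma has_integral_pos:
  fixes f :: "real \<Rightarrow> real"
  assumes "(f has_integral I) {c..d}" "c < d" "continuous_on {c..d} f" "\<And>t. t \<in> {c..d} \<Longrightarrow> f t > 0"
  shows "I > 0"
proof -
  obtain x where x: "x \<in> {c..d}" "\<And>y. y \<in> {c..d} \<Longrightarrow> f x \<le> f y"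
    using continuous_attains_inf[OF _ _ assms(3)] assms(2) by auto
  have "((\<lambda>_. f x) has_integral (d - c) * f x) {c..d}"
    using has_integral_const_real[of "f x" c d] assms(2) by simp
  hence "(d - c) * f x \<le> I"
    using has_integral_le[OF _ assms(1)] x by blast
  moreover have "(d - c) * f x > 0" using assms x by auto
  ultimately show ?thesis by linarith
qed

text \<open>Weak monotonicity becomes strict because \<open>signed_somewhere\<close> yields a
  subinterval on which the integrand is continuous and strictly signed; the remainder of the
  interval cannot cancel its contribution.\<close>

lemma exp_primitive_strict:
  assumes E: "exp_primitive d v w" and d: "d \<noteq> 0" and pq: "p < q" and S: "signed_somewhere v"
    and ge: "\<And>t. t \<in> {p..q} \<Longrightarrow> s * v t \<ge> 0" and s: "\<bar>s\<bar> = 1"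
  shows "s * sgn d * (exp (q / d) * w q - exp (p / d) * w p) > 0"
proof -
  define f where "f = (\<lambda>t. s * sgn d * (exp (t / d) / d * v t))"
  obtain c e r where ce: "p \<le> c" "c < e" "e \<le> q" "\<bar>r\<bar> = 1" "continuous_on {c..e} v"
    and pos: "\<And>t. t \<in> {c..e} \<Longrightarrow> r * v t > 0"
    using S pq unfolding signed_somewhere_def by blast
  have f_eq: "f t = exp (t / d) / \<bar>d\<bar> * (s * v t)" for t
    using d by (simp add: f_def sgn_if field_simps)
  have "r * v c > 0" "s * v c \<ge> 0" using pos[of c] ge[of c] ce by auto
  \<comment> \<open>At \<open>c\<close> the strict sign of the subinterval meets the weak sign valid
    on all of \<open>{p..q}\<close>, so the two agree.\<close>
  hence rs: "r = s" using ce(4) s by (auto simp: abs_if split: if_splits)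
  have int: "(f has_integral s * sgn d * (exp (y / d) * w y - exp (x / d) * w x)) {x..y}" if "x \<le> y" for x y
    using E that unfolding exp_primitive_def f_def by (intro has_integral_mult_right) auto
  have "s * sgn d * (exp (e / d) * w e - exp (c / d) * w c) > 0"
  proof (rule has_integral_pos[OF int])
    show "continuous_on {c..e} f"
      unfolding f_def using d ce by (intro continuous_intros) auto
    show "f t > 0" if "t \<in> {c..e}" for t
      unfolding f_eq using pos[OF that] d rs
      by (intro mult_pos_pos[of "exp (t / d) / \<bar>d\<bar>" "s * v t"]) simp_all
  qed (use ce in auto)
  also have "\<dots> \<le> s * sgn d * (exp (q / d) * w q - exp (p / d) * w p)"
  proof (rule has_integral_subset_le[OF _ int int])
    show "\<forall>t\<in>{p..q}. 0 \<le> f t"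
      unfolding f_eq using ge
      by (intro ballI mult_nonneg_nonneg[of "exp (t / d) / \<bar>d\<bar>" "s * v t" for t]) simp_all
  qed (use ce pq in auto)
  finally show ?thesis .
qed

text \<open>If \<open>w\<close> vanished on an interval, its increments there would be zero, against
  the strict increment that \<open>v\<close> produces. One nonzero value is then spread to an
  interval by continuity.\<close>

lemma signed_somewhere_step:
  assumes E: "exp_primitive d v w" and d: "d \<noteq> 0" and S: "signed_somewhere v"
    and c: "continuous_on UNIV w"
  shows "signed_somewhere w"
  unfolding signed_somewhere_def
proof (intro allI impI)
  fix a b :: real assume ab: "a < b"
  have "\<exists>x\<in>{a<..<b}. w x \<noteq> 0"
  proof (rule ccontr)
    assume "\<not> ?thesis"
    hence z: "w x = 0" if "a < x" "x < b" for x using that by auto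
    \<comment> \<open>The vanishing of \<open>w\<close> is assumed only inside the open interval, so
      the subinterval found by \<open>signed_somewhere\<close> must stay away from \<open>a\<close>
      and \<open>b\<close>.\<close>
    obtain a' b' where ab': "a < a'" "a' < b'" "b' < b"
      using dense[OF ab] dense by meson
    obtain c e r where ce: "a' \<le> c" "c < e" "e \<le> b'" "\<bar>r\<bar> = 1"
      and pos: "\<And>t. t \<in> {c..e} \<Longrightarrow> r * v t > 0"
      using S ab' unfolding signed_somewhere_def by meson
    have "r * sgn d * (exp (e / d) * w e - exp (c / d) * w c) > 0"
      using pos by (intro exp_primitive_strict[OF E d ce(2) S _ ce(4)]) force
    thus False using z[of c] z[of e] ce ab' by simp
  qed
  then obtain x where x: "a < x" "x < b" "w x \<noteq> 0" by auto
  define s where "s = sgn (w x)"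
  have "open {y. s * w y > 0}"
    using c by (intro open_Collect_less continuous_intros)
  moreover have "x \<in> {y. s * w y > 0}" using x by (simp add: s_def sgn_if)
  ultimately obtain e where e: "e > 0" "ball x e \<subseteq> {y. s * w y > 0}"
    using open_contains_ball by blast
  define h where "h = Min {e / 2, (b - x) / 2}"
  have h: "h > 0" "h < e" "x + h \<le> b" using e x by (auto simp: h_def min_def field_simps)
  show "\<exists>c d s. a \<le> c \<and> c < d \<and> d \<le> b \<and> \<bar>s\<bar> = 1 \<and> continuous_on {c..d} w \<and> (\<forall>t\<in>{c..d}. 0 < s * w t)"
  proof (intro exI conjI ballI)
    show "\<bar>s\<bar> = 1" using x by (simp add: s_def abs_sgn_eq)
    show "continuous_on {x..x + h} w" using c continuous_on_subset by blast
    show "0 < s * w t" if "t \<in> {x..x + h}" for t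
    proof -
      have "t \<in> ball x e" using that h by (auto simp: dist_real_def)
      thus ?thesis using e by auto
    qed
  qed (use x h in auto)
qed

text \<open>Rolle's argument for zeros: between two of them \<open>exp (t / d) * w t\<close> has
  increment zero, so \<open>v\<close> cannot keep even a weak sign. Both strict signs occur in every
  gap, hence an alternating selection is possible.\<close>

lemma alternates_of_zeros:
  assumes E: "exp_primitive d v w" and d: "d \<noteq> 0" and S: "signed_somewhere v"
    and y: "\<And>i. i \<le> N \<Longrightarrow> y i < y (Suc i)" and z: "\<And>i. i \<le> Suc N \<Longrightarrow> w (y i) = 0"
  shows "alternates v N (y 0) (y (Suc N))"
proof -
  have "\<exists>u. u \<in> {y i..y (Suc i)} \<and> (-1)^i * v u > 0" if i: "i \<le> N" for i
  proof (rule ccontr)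
    assume "\<not> ?thesis"
    hence le: "(-1)^i * v u \<le> 0" if "u \<in> {y i..y (Suc i)}" for u
      using that by force
    have "- ((-1)^i) * sgn d * (exp (y (Suc i) / d) * w (y (Suc i)) - exp (y i / d) * w (y i)) > 0"
      using le by (intro exp_primitive_strict[OF E d y[OF i] S]) auto
    thus False using z[of i] z[of "Suc i"] i by simp
  qed
  then obtain u where u: "\<And>i. i \<le> N \<Longrightarrow> u i \<in> {y i..y (Suc i)} \<and> (-1)^i * v (u i) > 0"
    by metis
  show ?thesis
    unfolding alternates_def
  proof (intro exI conjI allI impI)
    show "\<bar>1::real\<bar> = 1" by simp
    show "u i \<le> u (Suc i)" if "i < N" for i
      using u[of i] u[of "Suc i"] that by auto
    show "y 0 \<le> u 0" using u[of 0] by auto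
    show "u N \<le> y (Suc N)" using u[of N] by auto
    show "1 * (-1)^i * v (u i) > 0" if "i \<le> N" for i
      using u[OF that] by auto
  qed
qed

text \<open>Of the \<open>m\<close> steps, the last convolution is undone by
  \<open>alternates_of_zeros\<close> and the other \<open>m - 1\<close> by
  \<open>alternates_step\<close>. Each costs one, so \<open>N + m + 1\<close> zeros leave
  \<open>N\<close> sign changes.\<close>

lemma alternates_of_zeros_chain:
  assumes E: "\<And>j. j < m \<Longrightarrow> exp_primitive (d j) (v j) (v (Suc j))" and d: "\<And>j. j < m \<Longrightarrow> d j \<noteq> 0"
    and S: "signed_somewhere (v 0)" and c: "\<And>j. 0 < j \<Longrightarrow> j < m \<Longrightarrow> continuous_on UNIV (v j)" and m: "m > 0"
    and y: "\<And>i. i < N + m \<Longrightarrow> y i < y (Suc i)" and z: "\<And>i. i \<le> N + m \<Longrightarrow> v m (y i) = 0"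
  shows "alternates (v 0) N (y 0) (y (N + m))"
proof -
  have S': "signed_somewhere (v j)" if "j < m" for j
    using that
  proof (induction j)
    case (Suc j)
    thus ?case using c[of "Suc j"] by (intro signed_somewhere_step[OF E[of j] d[of j]]) auto
  qed (use S in simp)
  \<comment> \<open>The induction runs down the chain: \<open>i\<close> counts the sign-change steps
    already taken below \<open>v (m - 1)\<close>.\<close>
  have "alternates (v (m - 1 - i)) (N + (m - 1 - i)) (y 0) (y (N + m))" if "i < m" for i
    using that
  proof (induction i)
    case 0
    have "alternates (v (m - 1)) (N + (m - 1)) (y 0) (y (Suc (N + (m - 1))))"
      using m E[of "m - 1"] d[of "m - 1"] S'[of "m - 1"] y z by (intro alternates_of_zeros[of "d (m-1)" _ "v m"]) auto
    thus ?case using m by simp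
  next
    case (Suc i)
    have eq: "m - 1 - i = Suc (m - 1 - Suc i)" using Suc by simp
    have "alternates (v (Suc (m - 1 - Suc i))) (Suc (N + (m - 1 - Suc i))) (y 0) (y (N + m))"
      using Suc eq by (metis Suc_lessD add_Suc_right)
    thus ?case
      by (rule alternates_step[OF E d, rotated 2]) (use Suc in auto)
  qed
  from this[of "m - 1"] m show ?thesis by simp
qed

text \<open>This is \<open>Re (c Z)\<close> for the Zak transform \<open>Z\<close> of a single
  kernel, with \<open>B = 1 / d\<close> and \<open>c\<close> chosen as in
  \<open>zak_exp_conv_zero_density\<close>. Its sign on the cell \<open>[n M, (n + 1) M)\<close> is
  that of \<open>B * cos (\<phi> - \<theta> * n)\<close>.\<close>

definition exp_cos_step :: "real \<Rightarrow> real \<Rightarrow> real \<Rightarrow> real \<Rightarrow> real \<Rightarrow> real \<Rightarrow> real" where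
  "exp_cos_step B d M \<phi> \<theta> x =
     B * exp ((of_int \<lfloor>x / M\<rfloor> * M - x) / d) * cos (\<phi> - \<theta> * of_int \<lfloor>x / M\<rfloor>)"

text \<open>The floor numbers the half-wave of the cosine, centred at a multiple of
  \<open>pi\<close>, that contains \<open>u\<close>; its parity is the sign there. The inequality is
  weak because of the end points of half-waves.\<close>

lemma cos_sign_floor:
  "(if even \<lfloor>u / pi + 1 / 2\<rfloor> then 1 else -1) * cos u \<ge> 0"
proof -
  define k where "k = \<lfloor>u / pi + 1 / 2\<rfloor>"
  have "of_int k \<le> u / pi + 1 / 2" "u / pi + 1 / 2 < of_int k + 1"
    unfolding k_def by linarith+
  hence "- (pi / 2) \<le> u - pi * of_int k" "u - pi * of_int k \<le> pi / 2"
    by (simp_all add: field_simps)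
  hence "0 \<le> cos (u - pi * of_int k)"
    by (rule cos_ge_zero)
  also have "\<dots> = (if even k then 1 else -1) * cos u"
    by (simp add: cos_diff cos_npi_int sin_npi_int)
  finally show ?thesis by (simp add: k_def)
qed

text \<open>As \<open>\<theta>\<close> is nonnegative, the phase \<open>u\<close> can only decrease
  along the points, so its half-wave index \<open>k\<close> never increases, and a sign change
  forces it to drop. The total drop is the phase difference over \<open>pi\<close> up to rounding:
  the outer \<open>+ 1\<close> rounds the half-wave index, the inner one the number of cells met by
  an interval.\<close>

lemma alternates_exp_cos_step_le:
  assumes A: "alternates (exp_cos_step B d M \<phi> \<theta>) N a b" and M: "M > 0" and \<theta>: "\<theta> \<ge> 0"
  shows "real N \<le> \<theta> * ((b - a) / M + 1) / pi + 1"
proof -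
  obtain s t where s: "\<bar>s\<bar> = 1" and mono: "\<And>i. i < N \<Longrightarrow> t i \<le> t (Suc i)"
    and ab: "a \<le> t 0" "t N \<le> b" and pos: "\<And>i. i \<le> N \<Longrightarrow> s * (-1)^i * exp_cos_step B d M \<phi> \<theta> (t i) > 0"
    using A unfolding alternates_def by blast
  define n where "n = (\<lambda>i. \<lfloor>t i / M\<rfloor>)"
  define u where "u = (\<lambda>i. \<phi> - \<theta> * of_int (n i))"
  define k where "k = (\<lambda>i. \<lfloor>u i / pi + 1 / 2\<rfloor>)"
  have pos': "s * B * (-1)^i * cos (u i) > 0" if i: "i \<le> N" for i
  proof -
    have "s * (-1)^i * exp_cos_step B d M \<phi> \<theta> (t i) =
        exp ((of_int (n i) * M - t i) / d) * (s * B * (-1)^i * cos (u i))"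
      by (simp add: exp_cos_step_def n_def u_def)
    thus ?thesis using pos[OF i] by (metis exp_gt_zero zero_less_mult_pos)
  qed
  have step: "k (Suc i) \<le> k i - 1" if i: "i < N" for i
  proof -
    have "t i / M \<le> t (Suc i) / M" using mono[OF i] M by (simp add: divide_right_mono)
    hence "n i \<le> n (Suc i)" by (simp add: n_def floor_mono)
    hence "u (Suc i) \<le> u i" using \<theta> by (simp add: u_def mult_left_mono)
    hence "u (Suc i) / pi + 1 / 2 \<le> u i / pi + 1 / 2" by (simp add: divide_right_mono)
    hence "k (Suc i) \<le> k i" by (simp add: k_def floor_mono)
    moreover have "k (Suc i) \<noteq> k i"
    proof
      assume eq: "k (Suc i) = k i"
      have p1: "s * B * (-1)^i * cos (u i) > 0" and p2: "- (s * B * (-1)^i * cos (u (Suc i))) > 0"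
        using pos'[of i] pos'[of "Suc i"] i by simp_all
      \<comment> \<open>Multiplying the two strict inequalities turns the unknown sign of
        \<open>s * B * (-1)^i\<close> into a square.\<close>
      have "(s * B * (-1)^i * cos (u i)) * (- (s * B * (-1)^i * cos (u (Suc i)))) > 0"
        by (rule mult_pos_pos[OF p1 p2])
      also have "(s * B * (-1)^i * cos (u i)) * (- (s * B * (-1)^i * cos (u (Suc i)))) =
        - ((s * B * (-1)^i)\<^sup>2 * (cos (u i) * cos (u (Suc i))))"
        by (simp add: power2_eq_square algebra_simps)
      finally have "(s * B * (-1)^i)\<^sup>2 * (cos (u i) * cos (u (Suc i))) < 0" by simp
      hence "cos (u i) * cos (u (Suc i)) < 0"
        by (metis mult_nonneg_nonneg not_less zero_le_power2)
      moreover have "cos (u i) * cos (u (Suc i)) \<ge> 0"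
      proof -
        have "((if even (k i) then 1 else -1) * cos (u i)) * ((if even (k i) then 1 else -1) * cos (u (Suc i))) \<ge> 0"
          using cos_sign_floor[of "u i"] cos_sign_floor[of "u (Suc i)"] eq
          unfolding k_def by (metis mult_nonneg_nonneg)
        thus ?thesis by (auto split: if_splits)
      qed
      ultimately show False by linarith
    qed
    ultimately show ?thesis by linarith
  qed
  have "k i \<le> k 0 - int i" if "i \<le> N" for i
    using that
  proof (induction i)
    case (Suc i)
    thus ?case using step[of i] by simp
  qed simp
  hence "real_of_int (k N) \<le> of_int (k 0 - int N)"
    unfolding of_int_le_iff by simp
  hence "real N \<le> of_int (k 0) - of_int (k N)" by simp
  also have "\<dots> \<le> (u 0 / pi + 1 / 2) - (u N / pi + 1 / 2 - 1)"
    unfolding k_def by linarith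
  also have "\<dots> = \<theta> * (of_int (n N) - of_int (n 0)) / pi + 1"
    by (simp add: u_def field_simps)
  also have "\<dots> \<le> \<theta> * ((b - a) / M + 1) / pi + 1"
  proof -
    have "real_of_int (n N) - of_int (n 0) \<le> t N / M - (t 0 / M - 1)"
      unfolding n_def by linarith
    also have "\<dots> = (t N - t 0) / M + 1" by (simp add: diff_divide_distrib)
    also have "\<dots> \<le> (b - a) / M + 1"
      using ab M by (simp add: divide_right_mono)
    finally show ?thesis using \<theta> by (simp add: divide_right_mono mult_left_mono)
  qed
  finally show ?thesis .
qed

lemma signed_somewhere_exp_cos_step:
  assumes B: "B \<noteq> 0" and M: "M > 0" and nz: "\<And>n::int. cos (\<phi> - \<theta> * of_int n) \<noteq> 0"
  shows "signed_somewhere (exp_cos_step B d M \<phi> \<theta>)"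
  unfolding signed_somewhere_def
proof (intro allI impI)
  fix a b :: real assume ab: "a < b"
  define n where "n = \<lfloor>a / M\<rfloor>"
  \<comment> \<open>The midpoint between \<open>a\<close> and the right end of its cell, cut off at
    \<open>b\<close>: the closed interval \<open>{a..e}\<close> then avoids the jump at the next
    multiple of \<open>M\<close>.\<close>
  define e where "e = min b ((a + (of_int n + 1) * M) / 2)"
  have n: "of_int n \<le> a / M" "a / M < of_int n + 1" unfolding n_def by linarith+
  have "a < (of_int n + 1) * M" using n M by (simp add: field_simps)
  hence e: "a < e" "e \<le> b" "e < (of_int n + 1) * M" using ab by (auto simp: e_def min_def field_simps)
  have fl: "\<lfloor>x / M\<rfloor> = n" if x: "x \<in> {a..e}" for x
  proof -
    have "a / M \<le> x / M" using x M by (simp add: divide_right_mono)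
    moreover have "x / M < of_int n + 1" using x e M by (simp add: field_simps)
    ultimately show ?thesis using n by linarith
  qed
  define C where "C = B * cos (\<phi> - \<theta> * of_int n)"
  have C: "C \<noteq> 0" using B nz by (simp add: C_def)
  have eq: "exp_cos_step B d M \<phi> \<theta> x = C * exp ((of_int n * M - x) / d)" if "x \<in> {a..e}" for x
    using fl[OF that] by (simp add: exp_cos_step_def C_def)
  show "\<exists>c e s. a \<le> c \<and> c < e \<and> e \<le> b \<and> \<bar>s\<bar> = 1 \<and> continuous_on {c..e} (exp_cos_step B d M \<phi> \<theta>) \<and>
      (\<forall>t\<in>{c..e}. 0 < s * exp_cos_step B d M \<phi> \<theta> t)"
  proof (intro exI conjI ballI)
    show "\<bar>sgn C\<bar> = 1" using C by (simp add: abs_sgn_eq)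
    have "continuous_on {a..e} (\<lambda>x. C * exp ((of_int n * M - x) * inverse d))"
      by (intro continuous_intros)
    thus "continuous_on {a..e} (exp_cos_step B d M \<phi> \<theta>)"
      using eq by (simp add: divide_inverse cong: continuous_on_cong_simp)
    show "0 < sgn C * exp_cos_step B d M \<phi> \<theta> t" if "t \<in> {a..e}" for t
      using eq[OF that] C by (auto simp: sgn_if mult_neg_pos)
  qed (use e in auto)
qed

text \<open>Every \<open>n\<close> excludes only countably many phases, and the reals are
  uncountable. For such a phase the starting function of the chain has no zeros at all.\<close>

lemma ex_generic_phase: fixes \<theta> :: real
  shows "\<exists>\<phi>. \<forall>n::int. cos (\<phi> - \<theta> * of_int n) \<noteq> 0"
proof -
  have "countable (\<Union>n::int. \<Union>i::int. {\<theta> * of_int n + of_int i * (pi / 2)})"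
    by (intro countable_UN) auto
  hence "(\<Union>n::int. \<Union>i::int. {\<theta> * of_int n + of_int i * (pi / 2)}) \<noteq> UNIV"
    using uncountable_UNIV_real by metis
  then obtain \<phi> where \<phi>: "\<phi> \<notin> (\<Union>n::int. \<Union>i::int. {\<theta> * of_int n + of_int i * (pi / 2)})" by blast
  show ?thesis
  proof (intro exI allI notI)
    fix n :: int assume "cos (\<phi> - \<theta> * of_int n) = 0"
    then obtain i :: int where "\<phi> - \<theta> * of_int n = of_int i * (pi / 2)"
      using cos_zero_iff_int by auto
    hence "\<phi> = \<theta> * of_int n + of_int i * (pi / 2)" by simp
    thus False using \<phi> by blast
  qed
qed

text \<open>Each convolution costs at most one sign change, so the zeros of \<open>v m\<close> cannot be denser than
  the sign changes of \<open>v 0\<close>, of which there are about \<open>\<theta> / pi\<close> per length \<open>M\<close>.\<close>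

lemma zero_density_bound:
  assumes E: "\<And>j. j < m \<Longrightarrow> exp_primitive (d j) (v j) (v (Suc j))" and d: "\<And>j. j < m \<Longrightarrow> d j \<noteq> 0"
    and v0: "v 0 = exp_cos_step B d0 M \<phi> \<theta>" and B: "B \<noteq> 0" and nz: "\<And>n::int. cos (\<phi> - \<theta> * of_int n) \<noteq> 0"
    and c: "\<And>j. 0 < j \<Longrightarrow> j < m \<Longrightarrow> continuous_on UNIV (v j)" and m: "m > 0"
    and M: "M > 0" and \<theta>: "\<theta> \<ge> 0" and \<kappa>: "\<kappa> > 0"
    and y: "\<And>i. y i < y (Suc i)" and per: "\<And>n. y (\<kappa> * n) = y 0 + real n * M" and z: "\<And>i. v m (y i) = 0"
  shows "real \<kappa> * pi \<le> \<theta>"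
proof (rule ccontr)
  assume "\<not> ?thesis"
  hence lt: "\<theta> / pi < real \<kappa>" by (simp add: field_simps)
  \<comment> \<open>The largest \<open>n\<close> compatible with
    \<open>n * (\<kappa> - \<theta> / pi) \<le> m + 1 + \<theta> / pi\<close>, which is what the
    sign-change bound yields on an interval of length \<open>n * M\<close>.\<close>
  define r where "r = (real m + 1 + \<theta> / pi) / (real \<kappa> - \<theta> / pi)"
  obtain n0 :: nat where n0: "r < real n0" using reals_Archimedean2 by blast
  \<comment> \<open>Adding \<open>m\<close> guarantees \<open>m \<le> \<kappa> * n\<close>, so that
    the subtraction \<open>\<kappa> * n - m\<close> on natural numbers is a true one.\<close>
  define n where "n = n0 + m"
  have n: "real n > r" "n \<ge> m" using n0 by (auto simp: n_def)
  have "n \<le> \<kappa> * n" using \<kappa> by (cases \<kappa>) auto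
  hence mn: "m \<le> \<kappa> * n" using n(2) by (rule le_trans[rotated])
  have "alternates (v 0) (\<kappa> * n - m) (y 0) (y (\<kappa> * n - m + m))"
    using signed_somewhere_exp_cos_step[OF B M nz] v0 E d c m y z
    by (intro alternates_of_zeros_chain[where d = d and v = v]) simp_all
  hence "alternates (exp_cos_step B d0 M \<phi> \<theta>) (\<kappa> * n - m) (y 0) (y 0 + real n * M)"
    using mn by (simp add: v0 per)
  from alternates_exp_cos_step_le[OF this M \<theta>]
  have "real (\<kappa> * n - m) \<le> \<theta> * (real n + 1) / pi + 1" using M by simp
  hence "real \<kappa> * real n - real m \<le> \<theta> / pi * (real n + 1) + 1" using mn by (simp add: of_nat_diff)
  hence "real n * (real \<kappa> - \<theta> / pi) \<le> real m + 1 + \<theta> / pi" by (simp add: algebra_simps)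
  hence "real n \<le> r" using lt by (simp add: r_def pos_le_divide_eq)
  thus False using n by simp
qed

section \<open>Convolutions of one-sided exponentials\<close>

text \<open>The value at \<open>0\<close> makes the kernel right-continuous for both signs of \<open>d\<close>; then
  the formula \<open>zak_exp_kernel\<close> below holds for all \<open>x\<close>.\<close>

definition exp_kernel :: "real \<Rightarrow> real \<Rightarrow> real" where
  "exp_kernel d x = (if (0 < d) = (0 \<le> x) then exp (- x / d) / \<bar>d\<bar> else 0)"

text \<open>Index \<open>j\<close> means \<open>j + 1\<close> kernels, so a function of type
  \<open>m\<close> corresponds to the index \<open>m - 1\<close>.\<close>

primrec exp_conv :: "(nat \<Rightarrow> real) \<Rightarrow> nat \<Rightarrow> real \<Rightarrow> real" where
  "exp_conv d 0 x = exp_kernel (d 0) x"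
| "exp_conv d (Suc j) x = (LINT t|lborel. exp_kernel (d (Suc j)) (x - t) * exp_conv d j t)"

text \<open>One class for the whole chain: it is preserved by convolution with a kernel and makes
  all sums over translates absolutely convergent.\<close>

definition exp_decay :: "(real \<Rightarrow> real) \<Rightarrow> bool" where
  "exp_decay h \<longleftrightarrow> (\<exists>C a. 0 < a \<and> (\<forall>x. \<bar>h x\<bar> \<le> C * exp (- a * \<bar>x\<bar>)))"

lemma exp_kernel_measurable [measurable]: "exp_kernel d \<in> borel_measurable borel"
  unfolding exp_kernel_def by measurable

lemma exp_kernel_bound: "d \<noteq> 0 \<Longrightarrow> \<bar>exp_kernel d x\<bar> \<le> 1 / \<bar>d\<bar> * exp (- (1 / \<bar>d\<bar>) * \<bar>x\<bar>)"
  by (auto simp: exp_kernel_def field_simps abs_if)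

text \<open>Up to the factor \<open>a\<close>, the two-sided exponential is the exponential density
  plus its reflection, except at the origin, where both contribute and the sum is still a
  majorant.\<close>

lemma integrable_exp_neg_abs:
  assumes a: "(a::real) > 0"
  shows "integrable lborel (\<lambda>x. exp (- a * \<bar>x\<bar>))"
proof -
  interpret D: prob_space "density lborel (exponential_density a)"
    using a by (rule prob_space_exponential_density)
  have "integrable (density lborel (exponential_density a)) (\<lambda>_. 1::real)"
    by (rule D.integrable_const)
  hence I: "integrable lborel (exponential_density a)"
    using a by (subst (asm) integrable_density) (auto simp: exponential_density_nonneg)
  hence "integrable lborel (\<lambda>x. exponential_density a (0 + (-1) * x))"
    by (rule lborel_integrable_real_affine) simp
  with I have "integrable lborel (\<lambda>x. (exponential_density a x + exponential_density a (- x)) / a)"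
    by auto
  thus ?thesis
  proof (rule Bochner_Integration.integrable_bound)
    show "AE x in lborel. norm (exp (- a * \<bar>x\<bar>))
        \<le> norm ((exponential_density a x + exponential_density a (- x)) / a)"
    proof (intro AE_I2)
      fix x :: real
      show "norm (exp (- a * \<bar>x\<bar>)) \<le> norm ((exponential_density a x + exponential_density a (- x)) / a)"
        using a by (cases "x < 0"; cases "x = 0") (auto simp: exponential_density_def mult.commute)
    qed
  qed measurable
qed

lemma exp_decay_integrable:
  assumes "exp_decay h" and [measurable]: "h \<in> borel_measurable borel"
  shows "integrable lborel h"
proof -
  obtain C a where Ca: "a > 0" "\<And>x. \<bar>h x\<bar> \<le> C * exp (- a * \<bar>x\<bar>)"
    using assms(1) unfolding exp_decay_def by blast
  have "integrable lborel (\<lambda>x. C * exp (- a * \<bar>x\<bar>))"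
    using integrable_exp_neg_abs[OF Ca(1)] by auto
  thus ?thesis
    by (rule Bochner_Integration.integrable_bound) (use Ca(2) in \<open>auto intro: order_trans[OF _ abs_ge_self]\<close>)
qed

lemma exp_decay_rate:
  assumes "exp_decay h" and "b > 0"
  obtains C a where "0 < a" "a \<le> b" "C \<ge> 0" "\<And>x. \<bar>h x\<bar> \<le> C * exp (- a * \<bar>x\<bar>)"
proof -
  obtain C a where Ca: "a > 0" "\<And>x. \<bar>h x\<bar> \<le> C * exp (- a * \<bar>x\<bar>)"
    using assms(1) unfolding exp_decay_def by blast
  have C: "C \<ge> 0" using Ca(2)[of 0] by simp
  show ?thesis
  proof (rule that[of "min a b" C])
    fix x
    have "exp (- a * \<bar>x\<bar>) \<le> exp (- min a b * \<bar>x\<bar>)" by (auto intro: mult_right_mono)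
    thus "\<bar>h x\<bar> \<le> C * exp (- min a b * \<bar>x\<bar>)"
      using Ca(2)[of x] C by (meson mult_left_mono order_trans)
  qed (use Ca C assms in auto)
qed

lemma exp_kernel_decay: "d \<noteq> 0 \<Longrightarrow> exp_decay (exp_kernel d)"
  unfolding exp_decay_def using exp_kernel_bound[of d] by (intro exI[of _ "1 / \<bar>d\<bar>"]) auto

lemma
  assumes d: "d \<noteq> 0" and h: "exp_decay h" and [measurable]: "h \<in> borel_measurable borel"
  shows conv_exp_kernel_decay: "exp_decay (\<lambda>x. LINT t|lborel. exp_kernel d (x - t) * h t)"
    and conv_exp_kernel_integrable: "integrable lborel (\<lambda>t. exp_kernel d (x - t) * h t)"
proof -
  \<comment> \<open>Half the decay rate of the kernel. Then the kernel decays at least like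
    \<open>exp (- 2 * a * \<bar>x - t\<bar>)\<close>: one half of this combines with
    \<open>exp (- a * \<bar>t\<bar>)\<close> to give the decay in \<open>x\<close>, the other keeps
    the integral over \<open>t\<close> finite.\<close>
  define b where "b = 1 / \<bar>d\<bar> / 2"
  have b: "b > 0" using d by (simp add: b_def)
  obtain C a where Ca: "0 < a" "a \<le> b" "C \<ge> 0" "\<And>x. \<bar>h x\<bar> \<le> C * exp (- a * \<bar>x\<bar>)"
    using exp_decay_rate[OF h b] by metis
  have bd: "\<bar>exp_kernel d (x - t) * h t\<bar> \<le> C / \<bar>d\<bar> * exp (- a * \<bar>x\<bar>) * exp (- a * \<bar>x - t\<bar>)" for x t
  proof -
    have ab: "2 * a \<le> 1 / \<bar>d\<bar>" using Ca by (simp add: b_def)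
    have "\<bar>exp_kernel d (x - t) * h t\<bar> \<le>
        (1 / \<bar>d\<bar> * exp (- (1 / \<bar>d\<bar>) * \<bar>x - t\<bar>)) * (C * exp (- a * \<bar>t\<bar>))"
      unfolding abs_mult using exp_kernel_bound[OF d] Ca by (intro mult_mono) auto
    also have "\<dots> = C / \<bar>d\<bar> * exp (- (1 / \<bar>d\<bar>) * \<bar>x - t\<bar> - a * \<bar>t\<bar>)"
      by (simp add: exp_diff exp_minus field_simps)
    also have "\<dots> \<le> C / \<bar>d\<bar> * exp (- a * \<bar>x\<bar> - a * \<bar>x - t\<bar>)"
    proof (intro mult_left_mono)
      have "2 * a * \<bar>x - t\<bar> \<le> 1 / \<bar>d\<bar> * \<bar>x - t\<bar>" using ab by (intro mult_right_mono) auto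
      moreover have "a * \<bar>x\<bar> \<le> a * (\<bar>x - t\<bar> + \<bar>t\<bar>)" using Ca by (intro mult_left_mono) auto
      ultimately show "exp (- (1 / \<bar>d\<bar>) * \<bar>x - t\<bar> - a * \<bar>t\<bar>) \<le> exp (- a * \<bar>x\<bar> - a * \<bar>x - t\<bar>)"
        by (simp add: algebra_simps)
    qed (use Ca in auto)
    finally show ?thesis by (simp add: exp_diff exp_minus field_simps)
  qed
  have I0: "integrable lborel (\<lambda>t. exp (- a * \<bar>x - t\<bar>))" for x
    using lborel_integrable_real_affine[OF integrable_exp_neg_abs[OF Ca(1)], of "-1" x] by simp
  have I: "integrable lborel (\<lambda>t. exp_kernel d (x - t) * h t)" for x
  proof (rule Bochner_Integration.integrable_bound)
    show "integrable lborel (\<lambda>t. C / \<bar>d\<bar> * exp (- a * \<bar>x\<bar>) * exp (- a * \<bar>x - t\<bar>))"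
      using I0[of x] by auto
    show "AE t in lborel. norm (exp_kernel d (x - t) * h t)
        \<le> norm (C / \<bar>d\<bar> * exp (- a * \<bar>x\<bar>) * exp (- a * \<bar>x - t\<bar>))"
      unfolding real_norm_def by (intro AE_I2 order_trans[OF bd abs_ge_self])
  qed measurable
  show "integrable lborel (\<lambda>t. exp_kernel d (x - t) * h t)" by (rule I)
  define J where "J = (LINT t|lborel. exp (- a * \<bar>t\<bar>))"
  have J: "(LINT t|lborel. exp (- a * \<bar>x - t\<bar>)) = J" for x
    using lborel_integral_real_affine[of "-1" "\<lambda>t. exp (- a * \<bar>t\<bar>)" x] by (simp add: J_def)
  have "\<bar>LINT t|lborel. exp_kernel d (x - t) * h t\<bar> \<le> (C / \<bar>d\<bar> * J) * exp (- a * \<bar>x\<bar>)" for x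
  proof -
    have "\<bar>LINT t|lborel. exp_kernel d (x - t) * h t\<bar> \<le> (LINT t|lborel. \<bar>exp_kernel d (x - t) * h t\<bar>)"
      using integral_norm_bound[of lborel "\<lambda>t. exp_kernel d (x - t) * h t"] by simp
    also have "\<dots> \<le> (LINT t|lborel. C / \<bar>d\<bar> * exp (- a * \<bar>x\<bar>) * exp (- a * \<bar>x - t\<bar>))"
      using I[of x] I0[of x] bd by (intro integral_mono) auto
    also have "\<dots> = (C / \<bar>d\<bar> * J) * exp (- a * \<bar>x\<bar>)" using J by simp
    finally show ?thesis .
  qed
  thus "exp_decay (\<lambda>x. LINT t|lborel. exp_kernel d (x - t) * h t)"
    unfolding exp_decay_def using Ca(1) by blast
qed

text \<open>The product of \<open>exp (x / d)\<close> and \<open>exp_kernel d (x - t)\<close>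
  depends on \<open>x\<close> only through the side of \<open>x\<close> on which \<open>t\<close>
  lies. The difference of the two convolution integrals at \<open>q\<close> and \<open>p\<close> is
  therefore an integral over \<open>{p..q}\<close> alone, and \<open>d\<close> in place of its
  modulus absorbs the orientation.\<close>

lemma conv_exp_kernel_primitive:
  assumes d: "d \<noteq> 0" and h: "exp_decay h" and [measurable]: "h \<in> borel_measurable borel"
  shows "exp_primitive d h (\<lambda>x. LINT t|lborel. exp_kernel d (x - t) * h t)"
  unfolding exp_primitive_def
proof (intro allI impI)
  fix p q :: real assume pq: "p \<le> q"
  let ?w = "\<lambda>x. LINT t|lborel. exp_kernel d (x - t) * h t"
  let ?F = "\<lambda>t. exp (q / d) * (exp_kernel d (q - t) * h t) - exp (p / d) * (exp_kernel d (p - t) * h t)"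
  note I = conv_exp_kernel_integrable[OF assms]
  have "integrable lborel ?F" using I by auto
  hence "(?F has_integral (LINT t|lborel. ?F t)) UNIV" by (rule has_integral_integral_lborel)
  also have "(LINT t|lborel. ?F t) = exp (q / d) * ?w q - exp (p / d) * ?w p"
    using I by (subst Bochner_Integration.integral_diff) auto
  finally have "(?F has_integral (exp (q / d) * ?w q - exp (p / d) * ?w p)) UNIV" .
  hence "((\<lambda>t. if t \<in> {p..q} then exp (t / d) / d * h t else 0) has_integral
      (exp (q / d) * ?w q - exp (p / d) * ?w p)) UNIV"
  proof (rule has_integral_spike_finite[of "{p, q}", rotated 2])
    \<comment> \<open>The end points are left out because the value of the kernel at
      \<open>0\<close> depends on the sign of \<open>d\<close>.\<close>
    fix t assume "t \<in> UNIV - {p, q}"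
    hence t: "t \<noteq> p" "t \<noteq> q" by auto
    have e: "exp (x / d) * exp ((t - x) / d) = exp (t / d)" for x
      by (simp add: mult_exp_exp add_divide_distrib[symmetric])
    have k: "exp (x / d) * (exp_kernel d (x - t) * h t) =
        (if (0 < d) = (t \<le> x) then exp (t / d) / \<bar>d\<bar> * h t else 0)" for x
      using e[of x] by (auto simp: exp_kernel_def)
    show "(if t \<in> {p..q} then exp (t / d) / d * h t else 0) = ?F t"
      unfolding k using t pq d by auto
  qed simp
  thus "((\<lambda>t. exp (t / d) / d * h t) has_integral (exp (q / d) * ?w q - exp (p / d) * ?w p)) {p..q}"
    by (subst (asm) has_integral_restrict_UNIV)
qed

text \<open>An indefinite integral is continuous however irregular \<open>v\<close> is, so one
  convolution already removes the jumps of the first kernel.\<close>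

lemma exp_primitive_continuous:
  assumes E: "exp_primitive d v w"
  shows "continuous_on UNIV w"
proof -
  have "isCont w x" for x
  proof -
    define W where "W = (\<lambda>y. exp (y / d) * w y)"
    have H: "((\<lambda>t. exp (t / d) / d * v t) has_integral (W q - W p)) {p..q}" if "p \<le> q" for p q
      using E that unfolding exp_primitive_def W_def by blast
    have "continuous_on {x - 1..x + 1} (\<lambda>y. integral {x - 1..y} (\<lambda>t. exp (t / d) / d * v t))"
      using H[of "x - 1" "x + 1"] by (intro indefinite_integral_continuous_1) auto
    hence "continuous_on {x - 1..x + 1} (\<lambda>y. W y - W (x - 1))"
      using integral_unique[OF H] by (rule continuous_on_eq) auto
    from continuous_on_add[OF this continuous_on_const[of _ "W (x - 1)"]]
    have "continuous_on {x - 1..x + 1} W" by simp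
    hence "continuous_on {x - 1..x + 1} (\<lambda>y. exp (- y * inverse d) * W y)"
      by (intro continuous_intros) auto
    moreover have "exp (- y * inverse d) * W y = w y" for y
      by (simp add: W_def exp_minus divide_inverse)
    ultimately have "continuous_on {x - 1..x + 1} w" by simp
    thus ?thesis
      by (rule continuous_on_interior) auto
  qed
  thus ?thesis by (simp add: continuous_at_imp_continuous_on)
qed

lemma
  assumes d: "\<And>k. k \<le> j \<Longrightarrow> d k \<noteq> 0"
  shows exp_conv_decay: "exp_decay (exp_conv d j)"
    and exp_conv_measurable: "exp_conv d j \<in> borel_measurable borel"
proof -
  have "exp_decay (exp_conv d j) \<and> exp_conv d j \<in> borel_measurable borel"
    using d
  proof (induction j)
    case 0
    thus ?case by (simp add: exp_kernel_decay)
  next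
    case (Suc j)
    hence IH: "exp_decay (exp_conv d j)" "exp_conv d j \<in> borel_measurable borel" and d: "d (Suc j) \<noteq> 0" by auto
    have eq: "exp_conv d (Suc j) = (\<lambda>x. LINT t|lborel. exp_kernel (d (Suc j)) (x - t) * exp_conv d j t)"
      by (rule ext) simp
    show ?case
      using conv_exp_kernel_decay[OF d IH] exp_primitive_continuous[OF conv_exp_kernel_primitive[OF d IH]]
      unfolding eq by (auto intro: borel_measurable_continuous_onI)
  qed
  thus "exp_decay (exp_conv d j)" "exp_conv d j \<in> borel_measurable borel" by auto
qed

lemma exp_conv_primitive:
  assumes "\<And>k. k \<le> Suc j \<Longrightarrow> d k \<noteq> 0"
  shows "exp_primitive (d (Suc j)) (exp_conv d j) (exp_conv d (Suc j))"
proof -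
  have "exp_conv d (Suc j) = (\<lambda>x. LINT t|lborel. exp_kernel (d (Suc j)) (x - t) * exp_conv d j t)"
    by (rule ext) simp
  thus ?thesis
    using conv_exp_kernel_primitive[OF assms exp_conv_decay exp_conv_measurable, of "Suc j" j d] assms by auto
qed

lemma exp_conv_continuous:
  assumes "\<And>k. k \<le> j \<Longrightarrow> d k \<noteq> 0" "j > 0"
  shows "continuous_on UNIV (exp_conv d j)"
  using exp_primitive_continuous[OF exp_conv_primitive[of "j - 1" d]] assms by simp

section \<open>Fourier transforms\<close>

lemma integrable_lborel_measurable: "integrable lborel f \<Longrightarrow> f \<in> borel_measurable borel"
  using borel_measurable_integrable[of lborel f] by simp

text \<open>The fundamental theorem of calculus on the open half-line; absolute integrability comes
  from the real exponential with rate \<open>Re c\<close>.\<close>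

lemma integral_exp_neg_complex:
  fixes c :: complex
  assumes c: "Re c > 0"
  shows "(LINT x|lborel. indicator {0<..} x *\<^sub>R exp (- c * of_real x)) = 1 / c"
proof -
  have n0: "c \<noteq> 0" using c by auto
  have e: "einterval 0 \<infinity> = {0::real<..}" by (auto simp: einterval_def)
  have int_real: "integrable lborel (\<lambda>x. indicator {0<..} x *\<^sub>R exp (- (Re c) * x))"
  proof -
    have "((\<lambda>x. exp (- Re c * x)) has_integral exp (- Re c * 0) / Re c) {0..}"
      using c by (rule has_integral_exp_minus_to_infinity)
    hence "set_integrable lebesgue {0..} (\<lambda>x. exp (- Re c * x))"
      by (intro nonnegative_absolutely_integrable_1 ) auto
    hence "set_integrable lborel {0..} (\<lambda>x. exp (- Re c * x))"
      unfolding set_integrable_def by (subst (asm) integrable_completion) measurable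
    thus ?thesis
      unfolding set_integrable_def
      by (rule Bochner_Integration.integrable_bound) (auto simp: indicator_def)
  qed
  have int: "set_integrable lborel {0<..} (\<lambda>x. exp (- c * of_real x))"
    unfolding set_integrable_def using int_real
    by (rule Bochner_Integration.integrable_bound) (auto simp: indicator_def)
  have "(LBINT x=0..\<infinity>. exp (- c * of_real x)) = 0 - (- 1 / c)"
  proof (rule interval_integral_FTC_integrable)
    show "set_integrable lborel (einterval 0 \<infinity>) (\<lambda>x. exp (- c * of_real x))"
      unfolding e by (rule int)
    show "((\<lambda>x. - exp (- c * of_real x) / c) has_vector_derivative exp (- c * of_real x)) (at x)" for x :: real
    proof -
      have "((\<lambda>z. - exp (- c * z) / c) has_field_derivative exp (- c * of_real x)) (at (of_real x))"
        using n0 by (auto intro!: derivative_eq_intros)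
      from has_field_derivative_at_within[OF this]
      have "((\<lambda>z. - exp (- c * z) / c) has_field_derivative exp (- c * of_real x)) (at (of_real x) within of_real ` UNIV)"
        by (rule DERIV_subset) auto
      thus ?thesis
        using has_vector_derivative_real_field[of "\<lambda>z. - exp (- c * z) / c"]
          \<open>((\<lambda>z. - exp (- c * z) / c) has_field_derivative exp (- c * of_real x)) (at (of_real x))\<close> by blast
    qed
    show "isCont (\<lambda>x. exp (- c * of_real x)) x" for x :: real
      by (intro continuous_intros)
    have "((\<lambda>x::real. - exp (- c * of_real x) / c) \<longlongrightarrow> - exp (- c * of_real 0) / c) (at_right 0)"
      by (intro tendsto_intros) (use n0 in auto)
    thus "(((\<lambda>x. - exp (- c * of_real x) / c) \<circ> real_of_ereal) \<longlongrightarrow> - 1 / c) (at_right 0)"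
      unfolding zero_ereal_def by (subst ereal_tendsto_simps1) simp
    have "((\<lambda>x::real. - exp (- c * of_real x) / c) \<longlongrightarrow> 0) at_top"
    proof (rule tendsto_norm_zero_cancel)
      have "((\<lambda>x::real. exp (- Re c * x) / cmod c) \<longlongrightarrow> 0) at_top"
        using c by (intro tendsto_divide_zero filterlim_compose[OF exp_at_bot]
          filterlim_tendsto_neg_mult_at_bot[OF tendsto_const _ filterlim_ident]) simp
      thus "((\<lambda>x::real. cmod (- exp (- c * of_real x) / c)) \<longlongrightarrow> 0) at_top"
        by (simp add: norm_divide)
    qed
    thus "(((\<lambda>x. - exp (- c * of_real x) / c) \<circ> real_of_ereal) \<longlongrightarrow> 0) (at_left \<infinity>)"
      by (subst ereal_tendsto_simps1) simp
  qed auto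
  thus ?thesis
    by (simp add: interval_lebesgue_integral_def set_lebesgue_integral_def e)
qed

lemma fourier_conv:
  fixes f h :: "real \<Rightarrow> complex"
  assumes f: "integrable lborel f" and h: "integrable lborel h"
  shows "fourier (\<lambda>x. LINT t|lborel. f (x - t) * h t) \<xi> = fourier f \<xi> * fourier h \<xi>"
proof -
  have [measurable]: "f \<in> borel_measurable borel" "h \<in> borel_measurable borel"
    using f h by (auto dest: integrable_lborel_measurable)
  define e where "e = (\<lambda>x::real. cis (- 2 * pi * x * \<xi>))"
  have em[measurable]: "e \<in> borel_measurable borel"
    unfolding e_def by (intro borel_measurable_continuous_onI continuous_intros)
  have ne: "cmod (e x) = 1" for x by (simp add: e_def)
  define F where "F = (\<lambda>x. f x * e x)"
  define G where "G = (\<lambda>x. h x * e x)"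
  have [measurable]: "F \<in> borel_measurable borel" "G \<in> borel_measurable borel" unfolding F_def G_def by measurable
  have F: "integrable lborel F" unfolding F_def
    by (rule Bochner_Integration.integrable_bound[OF f]) (auto simp: norm_mult ne)
  have G: "integrable lborel G" unfolding G_def
    by (rule Bochner_Integration.integrable_bound[OF h]) (auto simp: norm_mult ne)
  have shift: "(LINT x|lborel. \<phi> (x - t)) = (LINT x|lborel. \<phi> x)" for t and \<phi> :: "real \<Rightarrow> 'a::{banach, second_countable_topology}"
    using lborel_integral_real_affine[of 1 \<phi> "- t"] by simp
  have Fs: "integrable lborel (\<lambda>x. F (x - t))" for t
    using lborel_integrable_real_affine[OF F, of 1 "- t"] by simp
  have int: "integrable (lborel \<Otimes>\<^sub>M lborel) (\<lambda>(t, x). F (x - t) * G t)"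
  proof (rule lborel_pair.Fubini_integrable)
    have "(LINT x|lborel. norm (F (x - t) * G t)) = norm (G t) * (LINT x|lborel. norm (F x))" for t
      using shift[of "\<lambda>x. norm (F x)" t] by (simp add: norm_mult)
    thus "integrable lborel (\<lambda>t. LINT x|lborel. norm (case (t, x) of (t, x) \<Rightarrow> F (x - t) * G t))"
      using G by auto
    show "AE t in lborel. integrable lborel (\<lambda>x. case (t, x) of (t, x) \<Rightarrow> F (x - t) * G t)"
      using Fs by auto
  qed measurable
  have ee: "e x = e (x - t) * e t" for x t
    by (simp add: e_def cis_mult algebra_simps)
  have "fourier (\<lambda>x. LINT t|lborel. f (x - t) * h t) \<xi> = (LINT x|lborel. (LINT t|lborel. f (x - t) * h t) * e x)"
    by (simp add: fourier_def e_def)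
  also have "\<dots> = (LINT x|lborel. (LINT t|lborel. F (x - t) * G t))"
  proof (rule Bochner_Integration.integral_cong[OF refl])
    fix x
    have "(LINT t|lborel. f (x - t) * h t) * e x = (LINT t|lborel. f (x - t) * h t * e x)" by simp
    also have "\<dots> = (LINT t|lborel. F (x - t) * G t)"
      by (rule Bochner_Integration.integral_cong[OF refl]) (simp add: F_def G_def ee[of x t for t])
    finally show "(LINT t|lborel. f (x - t) * h t) * e x = (LINT t|lborel. F (x - t) * G t)" .
  qed
  also have "\<dots> = (LINT t|lborel. (LINT x|lborel. F (x - t) * G t))"
    by (rule lborel_pair.Fubini_integral[OF int])
  also have "\<dots> = (LINT t|lborel. (LINT x|lborel. F x) * G t)"
    using shift[of F] by simp
  also have "\<dots> = (LINT x|lborel. F x) * (LINT t|lborel. G t)" by simp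
  finally show ?thesis by (simp add: F_def G_def e_def fourier_def)
qed

text \<open>The positive and the negative part of \<open>u\<close> are, after normalization, probability densities
  with the same characteristic function.\<close>

lemma fourier_zero_imp_AE_zero_real:
  fixes u :: "real \<Rightarrow> real"
  assumes u: "integrable lborel u" and z: "\<And>\<xi>. fourier (\<lambda>x. of_real (u x)) \<xi> = 0"
  shows "AE x in lborel. u x = 0"
proof -
  have [measurable]: "u \<in> borel_measurable borel"
    using u by (auto dest: integrable_lborel_measurable)
  define p where "p = (\<lambda>x. max 0 (u x))"
  define n where "n = (\<lambda>x. max 0 (- u x))"
  have p: "integrable lborel p" and n: "integrable lborel n"
    using u unfolding p_def n_def by auto
  have [measurable]: "p \<in> borel_measurable borel" "n \<in> borel_measurable borel"
    unfolding p_def n_def by measurable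
  have upn: "u x = p x - n x" for x by (auto simp: p_def n_def)
  have p0: "p x \<ge> 0" and n0: "n x \<ge> 0" for x by (auto simp: p_def n_def)
  define c where "c = (LINT x|lborel. p x)"
  have intC: "integrable lborel (\<lambda>x. of_real (w x) * cis (t * x) :: complex)" if "integrable lborel w" "w \<in> borel_measurable borel" for w :: "real \<Rightarrow> real" and t
  proof -
    have [measurable]: "w \<in> borel_measurable borel" by fact
    have [measurable]: "(\<lambda>x. cis (t * x)) \<in> borel_measurable borel"
      by (intro borel_measurable_continuous_onI continuous_intros)
    show ?thesis
      by (rule Bochner_Integration.integrable_bound[OF that(1)]) (auto simp: norm_mult)
  qed
  have four: "(LINT x|lborel. of_real (p x) * cis (t * x)) = (LINT x|lborel. of_real (n x) * cis (t * x))" for t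
  proof -
    \<comment> \<open>The frequency \<open>- t / (2 * pi)\<close> turns the kernel of
      \<open>fourier\<close> into \<open>cis (t * x)\<close>, that of characteristic
      functions.\<close>
    have "0 = (LINT x|lborel. of_real (u x) * cis (t * x))"
      using z[of "- t / (2 * pi)"] by (simp add: fourier_def mult.commute)
    also have "\<dots> = (LINT x|lborel. of_real (p x) * cis (t * x) - of_real (n x) * cis (t * x))"
      by (simp add: upn ring_distribs)
    also have "\<dots> = (LINT x|lborel. of_real (p x) * cis (t * x)) - (LINT x|lborel. of_real (n x) * cis (t * x))"
      using intC[OF p] intC[OF n] by (intro Bochner_Integration.integral_diff) auto
    finally show ?thesis by simp
  qed
  \<comment> \<open>At frequency \<open>0\<close> the identity compares total masses, so one
    constant normalizes both parts. If it is zero, both parts vanish almost everywhere and there is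
    nothing to normalize.\<close>
  have c': "c = (LINT x|lborel. n x)"
    using four[of 0] by (simp add: c_def)
  show ?thesis
  proof (cases "c = 0")
    case True
    hence "AE x in lborel. p x = 0" "AE x in lborel. n x = 0"
      using integral_nonneg_eq_0_iff_AE[OF p] integral_nonneg_eq_0_iff_AE[OF n] p0 n0 c' by (auto simp: c_def)
    thus ?thesis by eventually_elim (simp add: upn)
  next
    case False
    moreover have "c \<ge> 0" unfolding c_def using p0 by (intro Bochner_Integration.integral_nonneg)
    ultimately have c: "c > 0" by simp
    define D where "D = (\<lambda>w. density (lborel :: real measure) (\<lambda>x. ennreal (w x / c)))"
    have dist: "real_distribution (D w)" if w: "integrable lborel w" "w \<in> borel_measurable borel" "\<And>x. w x \<ge> 0" "(LINT x|lborel. w x) = c" for w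
    proof -
      have [measurable]: "w \<in> borel_measurable borel" by fact
      have "(\<integral>\<^sup>+x. ennreal (w x / c) \<partial>lborel) = ennreal (LINT x|lborel. w x / c)"
        using w c by (intro nn_integral_eq_integral) auto
      also have "\<dots> = 1" using w c by simp
      finally have "emeasure (D w) (space (D w)) = 1"
        unfolding D_def by (simp add: emeasure_density)
      hence "prob_space (D w)" by (rule prob_spaceI)
      thus ?thesis
        by (simp add: real_distribution_def real_distribution_axioms_def D_def)
    qed
    have ch: "char (D w) t = (LINT x|lborel. of_real (w x) * cis (t * x)) / c"
      if w: "w \<in> borel_measurable borel" "\<And>x. w x \<ge> 0" for w t
    proof -
      have [measurable]: "w \<in> borel_measurable borel" by fact
      have [measurable]: "(\<lambda>x. cis (t * x)) \<in> borel_measurable borel"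
        by (intro borel_measurable_continuous_onI continuous_intros)
      have "char (D w) t = (LINT x|lborel. (w x / c) *\<^sub>R cis (t * x))"
        unfolding char_def D_def cis_conv_exp[symmetric] using w c
        by (subst integral_density) (auto simp: cis_conv_exp)
      also have "\<dots> = (LINT x|lborel. of_real (w x) * cis (t * x) / c)"
        by (simp add: scaleR_conv_of_real)
      finally show ?thesis by simp
    qed
    have "D p = D n"
    proof (rule Levy_uniqueness)
      show "char (D p) = char (D n)"
        using ch[of p] ch[of n] p0 n0 four by (intro ext) simp
    qed (use dist[of p] dist[of n] p n p0 n0 c' c_def in auto)
    hence "AE x in lborel. ennreal (p x / c) = ennreal (n x / c)"
      unfolding D_def by (subst (asm) sigma_finite_measure.density_unique_iff[OF sigma_finite_lborel]) auto
    thus ?thesis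
      by eventually_elim (use c p0 n0 in \<open>simp add: upn\<close>)
  qed
qed

lemma continuous_AE_zero:
  fixes f :: "real \<Rightarrow> complex"
  assumes c: "continuous_on UNIV f" and ae: "AE x in lborel. f x = 0"
  shows "f x = 0"
proof -
  have o: "open {x. f x \<noteq> 0}"
    using c by (intro open_Collect_neq continuous_intros)
  have "{x. f x \<noteq> 0} \<in> null_sets lborel"
    using ae o by (subst AE_iff_null_sets) auto
  hence "negligible {x. f x \<noteq> 0}"
    using negligible_iff_null_sets null_sets_completionI by blast
  with o have "{x. f x \<noteq> 0} = {}" using open_not_negligible by blast
  thus ?thesis by blast
qed

text \<open>The transform of \<open>cnj (D x)\<close> is the conjugate of that of \<open>D\<close>
  at the opposite frequency, hence also zero. Real and imaginary part of \<open>D\<close> are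
  combinations of \<open>D\<close> and its conjugate, which reduces the claim to real functions;
  continuity removes the exceptional null set.\<close>

lemma fourier_inject:
  fixes f h :: "real \<Rightarrow> complex"
  assumes f: "integrable lborel f" "continuous_on UNIV f" and h: "integrable lborel h" "continuous_on UNIV h"
    and eq: "\<And>\<xi>. fourier f \<xi> = fourier h \<xi>"
  shows "f = h"
proof -
  define D where "D = (\<lambda>x. f x - h x)"
  have D: "integrable lborel D" unfolding D_def using f h by auto
  have [measurable]: "f \<in> borel_measurable borel" "h \<in> borel_measurable borel" "D \<in> borel_measurable borel"
    using f h D by (auto dest: integrable_lborel_measurable)
  have em[measurable]: "(\<lambda>x. cis (- 2 * pi * x * \<xi>)) \<in> borel_measurable borel" for \<xi>
    by (intro borel_measurable_continuous_onI continuous_intros)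
  have int: "integrable lborel (\<lambda>x. k x * cis (- 2 * pi * x * \<xi>))" if "integrable lborel k" "k \<in> borel_measurable borel" for k \<xi>
  proof -
    have [measurable]: "k \<in> borel_measurable borel" by fact
    have "(\<lambda>x. k x * cis (- 2 * pi * x * \<xi>)) \<in> borel_measurable borel" by measurable
    thus ?thesis by (intro Bochner_Integration.integrable_bound[OF that(1)]) (auto simp: norm_mult)
  qed
  have FD: "(LINT x|lborel. D x * cis (- 2 * pi * x * \<xi>)) = 0" for \<xi>
  proof -
    have "(LINT x|lborel. D x * cis (- 2 * pi * x * \<xi>)) =
        (LINT x|lborel. f x * cis (- 2 * pi * x * \<xi>) - h x * cis (- 2 * pi * x * \<xi>))"
      by (simp add: D_def ring_distribs)
    also have "\<dots> = fourier f \<xi> - fourier h \<xi>"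
      unfolding fourier_def using int f h by (intro Bochner_Integration.integral_diff) auto
    finally show ?thesis using eq by simp
  qed
  have FD': "(LINT x|lborel. cnj (D x) * cis (- 2 * pi * x * \<xi>)) = 0" for \<xi>
  proof -
    have "(LINT x|lborel. cnj (D x) * cis (- 2 * pi * x * \<xi>)) = (LINT x|lborel. cnj (D x * cis (- 2 * pi * x * (- \<xi>))))"
      by (simp add: cis_cnj)
    also have "\<dots> = cnj (LINT x|lborel. D x * cis (- 2 * pi * x * (- \<xi>)))"
      by (rule Bochner_Integration.integral_cnj)
    finally show ?thesis using FD[of "- \<xi>"] by simp
  qed
  have cD: "integrable lborel (\<lambda>x. cnj (D x))" using D by simp
  have cDm[measurable]: "(\<lambda>x. cnj (D x)) \<in> borel_measurable borel"
    by (rule integrable_lborel_measurable[OF cD])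
  have Re: "AE x in lborel. Re (D x) = 0"
  proof (rule fourier_zero_imp_AE_zero_real)
    fix \<xi>
    have "fourier (\<lambda>x. of_real (Re (D x))) \<xi> =
        (LINT x|lborel. (D x * cis (- 2 * pi * x * \<xi>) + cnj (D x) * cis (- 2 * pi * x * \<xi>)) / 2)"
      unfolding fourier_def
      by (intro Bochner_Integration.integral_cong refl) (simp add: complex_add_cnj flip: distrib_right)
    also have "\<dots> = 0"
      using int[OF D] int[OF cD] FD FD' by (simp add: Bochner_Integration.integral_add)
    finally show "fourier (\<lambda>x. of_real (Re (D x))) \<xi> = 0" .
  qed (use D in simp)
  have Im: "AE x in lborel. Im (D x) = 0"
  proof (rule fourier_zero_imp_AE_zero_real)
    fix \<xi>
    have im: "of_real (Im z) = (z - cnj z) / (2 * \<i>)" for z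
      by (simp add: complex_eq_iff)
    have "fourier (\<lambda>x. of_real (Im (D x))) \<xi> =
        (LINT x|lborel. (D x * cis (- 2 * pi * x * \<xi>) - cnj (D x) * cis (- 2 * pi * x * \<xi>)) / (2 * \<i>))"
      unfolding fourier_def
      by (intro Bochner_Integration.integral_cong refl) (simp add: im left_diff_distrib diff_divide_distrib)
    also have "\<dots> = 0"
      using int[OF D] int[OF cD] FD FD' by (simp add: Bochner_Integration.integral_diff)
    finally show "fourier (\<lambda>x. of_real (Im (D x))) \<xi> = 0" .
  qed (use D in simp)
  have "AE x in lborel. D x = 0"
    using Re Im by eventually_elim (simp add: complex_eq_iff)
  moreover have "continuous_on UNIV D" unfolding D_def using f h by (intro continuous_intros)
  ultimately have "D x = 0" for x by (intro continuous_AE_zero)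
  thus ?thesis by (auto simp: D_def)
qed

lemma fourier_exp_kernel_pos:
  assumes d: "d > 0"
  shows "fourier (\<lambda>x. of_real (exp_kernel d x)) \<xi> = 1 / (1 + \<i> * of_real (2 * pi * d * \<xi>))"
proof -
  define c where "c = of_real (1 / d) + \<i> * of_real (2 * pi * \<xi>)"
  have ce: "exp (- (c * of_real x)) = of_real (exp (- (x / d))) * cis (- (2 * pi * x * \<xi>))" for x
    by (simp add: c_def cis_conv_exp exp_of_real[symmetric] mult_exp_exp algebra_simps)
  have [measurable]: "(\<lambda>x. cis (- 2 * pi * x * \<xi>)) \<in> borel_measurable borel"
      "(\<lambda>x. exp (- c * of_real x)) \<in> borel_measurable borel"
    by (intro borel_measurable_continuous_onI continuous_intros)+
  have "fourier (\<lambda>x. of_real (exp_kernel d x)) \<xi> =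
      (LINT x|lborel. (indicator {0<..} x *\<^sub>R exp (- c * of_real x)) / of_real d)"
    unfolding fourier_def
  proof (rule integral_cong_AE)
    show "AE x in lborel. of_real (exp_kernel d x) * cis (- 2 * pi * x * \<xi>) =
        indicator {0<..} x *\<^sub>R exp (- c * of_real x) / of_real d"
      using AE_lborel_singleton[of 0]
      by eventually_elim (use d in \<open>auto simp: exp_kernel_def ce indicator_def\<close>)
  qed measurable
  also have "\<dots> = 1 / c / of_real d"
    using integral_exp_neg_complex[of c] d by (simp add: c_def)
  also have "\<dots> = 1 / (1 + \<i> * of_real (2 * pi * d * \<xi>))"
  proof -
    have "c * of_real d = 1 + \<i> * of_real (2 * pi * d * \<xi>)"
      using d by (simp add: c_def algebra_simps)
    thus ?thesis by (metis divide_divide_eq_left)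
  qed
  finally show ?thesis .
qed

text \<open>For negative \<open>d\<close> the kernel is, apart from its value at \<open>0\<close>,
  the reflection of the kernel for \<open>- d\<close>, and reflection negates the frequency.\<close>

lemma fourier_exp_kernel:
  assumes d: "d \<noteq> 0"
  shows "fourier (\<lambda>x. of_real (exp_kernel d x)) \<xi> = 1 / (1 + \<i> * of_real (2 * pi * d * \<xi>))"
proof (cases "d > 0")
  case False
  hence d: "- d > 0" using d by simp
  have [measurable]: "(\<lambda>x. cis (- 2 * pi * x * \<xi>)) \<in> borel_measurable borel"
      "(\<lambda>x. cis (2 * pi * x * \<xi>)) \<in> borel_measurable borel" for \<xi>
    by (intro borel_measurable_continuous_onI continuous_intros)+
  have "fourier (\<lambda>x. of_real (exp_kernel d x)) \<xi> =
      (LINT x|lborel. of_real (exp_kernel d (- x)) * cis (- 2 * pi * x * (- \<xi>)))"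
    unfolding fourier_def
    using lborel_integral_real_affine[of "-1" "\<lambda>x. of_real (exp_kernel d x) * cis (- 2 * pi * x * \<xi>)" 0] by simp
  also have "\<dots> = fourier (\<lambda>x. of_real (exp_kernel (- d) x)) (- \<xi>)"
    unfolding fourier_def
  proof (rule integral_cong_AE)
    show "AE x in lborel. of_real (exp_kernel d (- x)) * cis (- 2 * pi * x * (- \<xi>)) =
        of_real (exp_kernel (- d) x) * cis (- 2 * pi * x * (- \<xi>))"
      using AE_lborel_singleton[of 0]
      by eventually_elim (use d in \<open>auto simp: exp_kernel_def\<close>)
  qed measurable
  also have "\<dots> = 1 / (1 + \<i> * of_real (2 * pi * d * \<xi>))"
    using fourier_exp_kernel_pos[OF d, of "- \<xi>"] by simp
  finally show ?thesis .
qed (rule fourier_exp_kernel_pos)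

lemma fourier_exp_conv:
  assumes d: "\<And>k. k \<le> j \<Longrightarrow> d k \<noteq> 0"
  shows "fourier (\<lambda>x. of_real (exp_conv d j x)) \<xi> = 1 / (\<Prod>k<Suc j. 1 + \<i> * of_real (2 * pi * d k * \<xi>))"
  using d
proof (induction j)
  case 0
  thus ?case using fourier_exp_kernel[of "d 0" \<xi>] by simp
next
  case (Suc j)
  have I: "integrable lborel (\<lambda>x. complex_of_real (exp_conv d j x))"
      "integrable lborel (\<lambda>x. complex_of_real (exp_kernel (d (Suc j)) x))"
    using Suc exp_decay_integrable[OF exp_conv_decay exp_conv_measurable, of j d]
      exp_decay_integrable[OF exp_kernel_decay exp_kernel_measurable, of "d (Suc j)"] by auto
  have "(\<lambda>x. complex_of_real (exp_conv d (Suc j) x)) =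
      (\<lambda>x. LINT t|lborel. of_real (exp_kernel (d (Suc j)) (x - t)) * of_real (exp_conv d j t))"
    by (simp flip: of_real_mult)
  hence "fourier (\<lambda>x. of_real (exp_conv d (Suc j) x)) \<xi> =
      fourier (\<lambda>x. of_real (exp_kernel (d (Suc j)) x)) \<xi> * fourier (\<lambda>x. of_real (exp_conv d j x)) \<xi>"
    using fourier_conv[OF I(2) I(1), of \<xi>] by simp
  thus ?case using Suc fourier_exp_kernel[of "d (Suc j)" \<xi>] by simp
qed

text \<open>Equal transforms give equality everywhere once both sides are continuous: for
  \<open>g\<close> this is assumed, for the convolution it follows from its having at least two
  factors.\<close>

lemma TP_finite_type_exp_conv:
  assumes TP: "TP_finite_type g m" and m: "m \<ge> 2" and cont: "continuous_on UNIV g"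
  obtains C d where "C > 0" "\<And>k. k < m \<Longrightarrow> d k \<noteq> 0" "g = (\<lambda>x. of_real (C * exp_conv d (m - 1) x))"
proof -
  obtain C d where C: "C > 0" and d: "\<And>k. k < m \<Longrightarrow> d k \<noteq> (0::real)" and g: "integrable lborel g"
    and F: "\<And>\<xi>. fourier g \<xi> = of_real C / (\<Prod>k<m. 1 + \<i> * of_real (2 * pi * d k * \<xi>))"
    using TP unfolding TP_finite_type_def by blast
  have d': "\<And>k. k \<le> m - 1 \<Longrightarrow> d k \<noteq> 0" using d m by auto
  define h where "h = (\<lambda>x. complex_of_real (C * exp_conv d (m - 1) x))"
  have hi: "integrable lborel h"
    using exp_decay_integrable[OF exp_conv_decay exp_conv_measurable, of "m - 1" d] d' unfolding h_def by auto
  have "g = h"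
  proof (rule fourier_inject[OF g cont hi])
    have "continuous_on UNIV (exp_conv d (m - 1))"
      using d' m by (intro exp_conv_continuous) auto
    thus "continuous_on UNIV h" unfolding h_def by (intro continuous_intros)
    fix \<xi>
    have "fourier h \<xi> = of_real C * fourier (\<lambda>x. of_real (exp_conv d (m - 1) x)) \<xi>"
      by (simp add: fourier_def h_def mult.assoc)
    thus "fourier g \<xi> = fourier h \<xi>"
      using F fourier_exp_conv[of "m - 1" d \<xi>] d' m by simp
  qed
  thus ?thesis using that C d unfolding h_def by blast
qed

section \<open>The Zak transform\<close>

definition zak :: "(real \<Rightarrow> real) \<Rightarrow> real \<Rightarrow> real \<Rightarrow> real \<Rightarrow> complex" where
  "zak h M \<theta> x = (\<Sum>\<^sub>\<infinity>k::int. of_real (h (x + of_int k * M)) * cis (of_int k * \<theta>))"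

lemma summable_on_exp_neg_abs_int:
  assumes b: "(b::real) > 0"
  shows "(\<lambda>k::int. exp (- b * \<bar>of_int k\<bar>)) summable_on UNIV"
proof -
  have s: "(\<lambda>n::nat. exp (- b) ^ n) summable_on UNIV"
    using b by (intro norm_summable_imp_summable_on) (simp add: norm_power summable_geometric)
  have e: "exp (- b) ^ n = exp (- b * real n)" for n by (simp add: exp_of_nat_mult[symmetric] mult.commute)
  have "(\<lambda>k::int. exp (- b * \<bar>of_int k\<bar>)) summable_on range int"
    by (subst summable_on_reindex) (use s in \<open>auto simp: o_def e\<close>)
  moreover have "(\<lambda>k::int. exp (- b * \<bar>of_int k\<bar>)) summable_on range (\<lambda>n. - int n)"
    by (subst summable_on_reindex) (use s in \<open>auto simp: o_def e inj_def\<close>)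
  ultimately have "(\<lambda>k::int. exp (- b * \<bar>of_int k\<bar>)) summable_on (range int \<union> range (\<lambda>n. - int n))"
    by (rule summable_on_union)
  moreover have "range int \<union> range (\<lambda>n. - int n) = UNIV"
    by (metis (no_types, lifting) Un_iff UNIV_eq_I int_cases2 rangeI)
  ultimately show ?thesis by simp
qed

text \<open>The triangle inequality moves the dependence on \<open>x\<close> into the factor
  \<open>exp (a * R)\<close>. The resulting summable majorant, uniform on bounded sets, serves
  termwise integration and all Weierstrass tests in \<open>x\<close>.\<close>

lemma exp_decay_translates:
  assumes h: "exp_decay h" and M: "M > 0"
  obtains B where "B summable_on UNIV" "\<And>x k. \<bar>x\<bar> \<le> R \<Longrightarrow> \<bar>h (x + of_int k * M)\<bar> \<le> B k" "\<And>k::int. B k \<ge> 0"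
proof -
  obtain C a where Ca: "a > 0" "\<And>x. \<bar>h x\<bar> \<le> C * exp (- a * \<bar>x\<bar>)"
    using h unfolding exp_decay_def by blast
  have C: "C \<ge> 0" using Ca(2)[of 0] by simp
  show ?thesis
  proof (rule that[of "\<lambda>k. C * exp (a * R) * exp (- (a * M) * \<bar>of_int k\<bar>)"])
    show "(\<lambda>k::int. C * exp (a * R) * exp (- (a * M) * \<bar>of_int k\<bar>)) summable_on UNIV"
      using Ca M by (intro summable_on_cmult_right summable_on_exp_neg_abs_int) auto
    fix x and k :: int assume x: "\<bar>x\<bar> \<le> R"
    have "\<bar>of_int k * M\<bar> \<le> R + \<bar>x + of_int k * M\<bar>" using x by linarith
    hence "a * (\<bar>of_int k * M\<bar>) \<le> a * (R + \<bar>x + of_int k * M\<bar>)" using Ca by (intro mult_left_mono) auto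
    hence "exp (- a * \<bar>x + of_int k * M\<bar>) \<le> exp (a * R + - (a * M) * \<bar>of_int k\<bar>)"
      using M by (simp add: abs_mult algebra_simps)
    also have "\<dots> = exp (a * R) * exp (- (a * M) * \<bar>of_int k\<bar>)" by (rule exp_add)
    finally have "C * exp (- a * \<bar>x + of_int k * M\<bar>) \<le> C * (exp (a * R) * exp (- (a * M) * \<bar>of_int k\<bar>))"
      using C by (rule mult_left_mono)
    thus "\<bar>h (x + of_int k * M)\<bar> \<le> C * exp (a * R) * exp (- (a * M) * \<bar>of_int k\<bar>)"
      using Ca(2)[of "x + of_int k * M"] by (simp add: mult.assoc)
  qed (use C in auto)
qed

lemma zak_abs_summable:
  assumes "exp_decay h" "M > 0"
  shows "(\<lambda>k::int. norm (of_real (h (x + of_int k * M)) * cis (of_int k * \<theta>))) summable_on UNIV"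
proof -
  obtain B where B: "B summable_on UNIV" "\<And>k::int. \<bar>h (x + of_int k * M)\<bar> \<le> B k"
    using exp_decay_translates[OF assms, of "\<bar>x\<bar>"] by (metis order_refl)
  show ?thesis
    by (rule Infinite_Sum.abs_summable_on_comparison_test'[OF B(1)]) (use B(2) in \<open>simp add: norm_mult\<close>)
qed

lemma has_sum_minus:
  fixes f g :: "'a \<Rightarrow> 'b::real_normed_vector"
  assumes "(f has_sum a) A" "(g has_sum b) A"
  shows "((\<lambda>x. f x - g x) has_sum (a - b)) A"
proof -
  have "((\<lambda>x. - g x) has_sum (- b)) A"
    using assms(2) by (simp only: has_sum_uminus minus_minus)
  from has_sum_add[OF assms(1) this] show ?thesis by (simp only: add_uminus_conv_diff)
qed

lemma zak_has_sum:
  assumes "exp_decay h" "M > 0"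
  shows "((\<lambda>k::int. of_real (h (x + of_int k * M)) * cis (of_int k * \<theta>)) has_sum zak h M \<theta> x) UNIV"
  unfolding zak_def by (rule has_sum_infsum[OF abs_summable_summable[OF zak_abs_summable[OF assms]]])

text \<open>Quasi-periodicity by reindexing. The factor is unimodular, so one zero generates an
  arithmetic progression of zeros with step \<open>M\<close>.\<close>

lemma zak_shift:
  assumes "exp_decay h" "M > 0"
  shows "zak h M \<theta> (x + of_int n * M) = cis (- of_int n * \<theta>) * zak h M \<theta> x"
proof -
  have "((\<lambda>k::int. cis (- of_int n * \<theta>) * (of_real (h (x + of_int k * M)) * cis (of_int k * \<theta>)))
      has_sum (cis (- of_int n * \<theta>) * zak h M \<theta> x)) UNIV"
    using zak_has_sum[OF assms] by (rule has_sum_cmult_right)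
  also have "?this \<longleftrightarrow> ((\<lambda>k::int. of_real (h (x + of_int n * M + of_int k * M)) * cis (of_int k * \<theta>))
      has_sum (cis (- of_int n * \<theta>) * zak h M \<theta> x)) UNIV"
    by (rule has_sum_reindex_bij_witness[of _ "\<lambda>k. k + n" "\<lambda>k. k - n"])
       (auto simp: algebra_simps cis_mult)
  finally show ?thesis unfolding zak_def by (rule infsumI)
qed

text \<open>The majorant makes the finite partial sums converge uniformly, and on a bounded interval
  uniform convergence passes to integrals. Uniqueness of sums then identifies the integral with
  \<open>J\<close>.\<close>

lemma has_integral_infsum:
  fixes f :: "'a \<Rightarrow> real \<Rightarrow> real"
  assumes f: "\<And>k. (f k has_integral I k) {a..b}" and ab: "a \<le> b"
    and bd: "\<And>k x. x \<in> {a..b} \<Longrightarrow> \<bar>f k x\<bar> \<le> B k" and B: "B summable_on UNIV"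
    and J: "(I has_sum J) UNIV"
  shows "((\<lambda>x. \<Sum>\<^sub>\<infinity>k. f k x) has_integral J) {a..b}"
proof -
  define g where "g = (\<lambda>x. \<Sum>\<^sub>\<infinity>k. f k x)"
  let ?F = "finite_subsets_at_top (UNIV :: 'a set)"
  have ul: "uniform_limit {a..b} (\<lambda>S x. \<Sum>k\<in>S. f k x) g ?F"
    unfolding g_def using bd B by (intro Weierstrass_m_test_general) auto
  have ev: "\<forall>\<^sub>F S in ?F. finite S \<and> (\<forall>x\<in>{a..b}. \<bar>(\<Sum>k\<in>S. f k x) - g x\<bar> < e)" if "e > 0" for e
    using uniform_limitD[OF ul that] eventually_finite_subsets_at_top_finite[of UNIV]
    by (auto simp: dist_real_def elim: eventually_elim2)
  have sumI: "((\<lambda>x. \<Sum>k\<in>S. f k x) has_integral (\<Sum>k\<in>S. I k)) {a..b}" if "finite S" for S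
    using f that by (intro has_integral_sum)
  have "g integrable_on {a..b}"
  proof (rule integrable_uniform_limit_real)
    fix e :: real assume "e > 0"
    then obtain S where "finite S" "\<forall>x\<in>{a..b}. \<bar>(\<Sum>k\<in>S. f k x) - g x\<bar> < e"
      using eventually_happens'[OF finite_subsets_at_top_neq_bot ev] by blast
    thus "\<exists>h. (\<forall>x\<in>{a..b}. norm (g x - h x) \<le> e) \<and> h integrable_on {a..b}"
      using sumI[of S] by (intro exI[of _ "\<lambda>x. \<Sum>k\<in>S. f k x"]) (force simp: abs_minus_commute)
  qed
  then obtain G where G: "(g has_integral G) {a..b}" by blast
  have "(I has_sum G) UNIV"
    unfolding has_sum_def
  proof (rule tendstoI)
    fix e :: real assume e: "e > 0"
    \<comment> \<open>The \<open>+ 1\<close> keeps the quotient meaningful for \<open>a = b\<close>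
      and makes the final estimate strict.\<close>
    define r where "r = e / (b - a + 1)"
    have r: "r > 0" "r * (b - a) < e" using e ab by (auto simp: r_def field_simps)
    show "\<forall>\<^sub>F S in ?F. dist (sum I S) G < e"
      using ev[OF r(1)]
    proof eventually_elim
      case (elim S)
      have "((\<lambda>x. (\<Sum>k\<in>S. f k x) - g x) has_integral (sum I S - G)) {a..b}"
        using sumI G elim by (intro has_integral_diff) auto
      hence "norm (sum I S - G) \<le> r * measure lborel {a..b}"
        using r elim by (intro has_integral_bound_real) (auto intro: less_imp_le)
      thus ?case using r ab by (simp add: dist_real_def)
    qed
  qed
  hence "G = J" using J by (rule has_sum_unique)
  thus ?thesis using G by (simp add: g_def)
qed

lemma exp_primitive_infsum:
  fixes f w :: "int \<Rightarrow> real \<Rightarrow> real"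
  assumes d: "d \<noteq> 0" and E: "\<And>k. exp_primitive d (f k) (w k)"
    and bd: "\<And>R. \<exists>B. B summable_on UNIV \<and> (\<forall>x k. \<bar>x\<bar> \<le> R \<longrightarrow> \<bar>f k x\<bar> \<le> B k)"
    and w: "\<And>x. (\<lambda>k. w k x) summable_on UNIV"
  shows "exp_primitive d (\<lambda>x. \<Sum>\<^sub>\<infinity>k. f k x) (\<lambda>x. \<Sum>\<^sub>\<infinity>k. w k x)"
  unfolding exp_primitive_def
proof (intro allI impI)
  fix p q :: real assume pq: "p \<le> q"
  define R where "R = max \<bar>p\<bar> \<bar>q\<bar>"
  obtain B where B: "B summable_on UNIV" "\<And>x k. \<bar>x\<bar> \<le> R \<Longrightarrow> \<bar>f k x\<bar> \<le> B k"
    using bd[of R] by blast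
  have E': "((\<lambda>t. exp (t / d) / d * f k t) has_integral (exp (q / d) * w k q - exp (p / d) * w k p)) {p..q}" for k
    using E pq unfolding exp_primitive_def by blast
  have "((\<lambda>t. \<Sum>\<^sub>\<infinity>k. exp (t / d) / d * f k t) has_integral
      (exp (q / d) * (\<Sum>\<^sub>\<infinity>k. w k q) - exp (p / d) * (\<Sum>\<^sub>\<infinity>k. w k p))) {p..q}"
  proof (rule has_integral_infsum[OF E' pq])
    show "(\<lambda>k. exp (R / \<bar>d\<bar>) / \<bar>d\<bar> * B k) summable_on UNIV"
      using B(1) by (rule summable_on_cmult_right)
    show "\<bar>exp (x / d) / d * f k x\<bar> \<le> exp (R / \<bar>d\<bar>) / \<bar>d\<bar> * B k" if x: "x \<in> {p..q}" for k x
    proof -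
      have xR: "\<bar>x\<bar> \<le> R" using x unfolding R_def by auto
      have "x / d \<le> \<bar>x / d\<bar>" by (rule abs_ge_self)
      also have "\<dots> \<le> R / \<bar>d\<bar>" using xR by (simp add: divide_right_mono)
      finally have "exp (x / d) / \<bar>d\<bar> * \<bar>f k x\<bar> \<le> exp (R / \<bar>d\<bar>) / \<bar>d\<bar> * B k"
        using B(2)[OF xR] by (intro mult_mono divide_right_mono) auto
      thus ?thesis by (simp add: abs_mult)
    qed
    show "((\<lambda>k. exp (q / d) * w k q - exp (p / d) * w k p) has_sum
        (exp (q / d) * (\<Sum>\<^sub>\<infinity>k. w k q) - exp (p / d) * (\<Sum>\<^sub>\<infinity>k. w k p))) UNIV"
      using w by (intro has_sum_minus has_sum_cmult_right has_sum_infsum)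
  qed
  also have "(\<lambda>t. \<Sum>\<^sub>\<infinity>k. exp (t / d) / d * f k t) = (\<lambda>t. exp (t / d) / d * (\<Sum>\<^sub>\<infinity>k. f k t))"
    by (intro ext infsum_cmult_right') 
  finally show "((\<lambda>t. exp (t / d) / d * (\<Sum>\<^sub>\<infinity>k. f k t)) has_integral
      (exp (q / d) * (\<Sum>\<^sub>\<infinity>k. w k q) - exp (p / d) * (\<Sum>\<^sub>\<infinity>k. w k p))) {p..q}" .
qed

text \<open>The equation has constant coefficients and so is invariant under translation. The weight
  in its integrated form is not, and the factor \<open>exp (- s / d)\<close> repairs this.\<close>

lemma exp_primitive_shift_mult:
  assumes E: "exp_primitive d v w"
  shows "exp_primitive d (\<lambda>x. c * v (x + s)) (\<lambda>x. c * w (x + s))"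
  unfolding exp_primitive_def
proof (intro allI impI)
  fix p q :: real assume pq: "p \<le> q"
  have "((\<lambda>t. exp (t / d) / d * v t) has_integral
      (exp ((q + s) / d) * w (q + s) - exp ((p + s) / d) * w (p + s))) (cbox (p + s) (q + s))"
    using E pq unfolding exp_primitive_def by auto
  from has_integral_affinity'[OF this, of 1 s]
  have "((\<lambda>t. exp ((t + s) / d) / d * v (t + s)) has_integral
      (exp ((q + s) / d) * w (q + s) - exp ((p + s) / d) * w (p + s))) {p..q}"
    by simp
  hence "((\<lambda>t. c * exp (- s / d) * (exp ((t + s) / d) / d * v (t + s))) has_integral
      c * exp (- s / d) * (exp ((q + s) / d) * w (q + s) - exp ((p + s) / d) * w (p + s))) {p..q}"
    by (rule has_integral_mult_right)
  moreover have e: "exp (- s / d) * exp ((t + s) / d) = exp (t / d)" for t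
    by (simp add: mult_exp_exp add_divide_distrib)
  have "(\<lambda>t. c * exp (- s / d) * (exp ((t + s) / d) / d * v (t + s))) = (\<lambda>t. exp (t / d) / d * (c * v (t + s)))"
  proof
    fix t
    have "c * exp (- s / d) * (exp ((t + s) / d) / d * v (t + s)) =
        (exp (- s / d) * exp ((t + s) / d)) / d * (c * v (t + s))" by (simp only: mult_ac times_divide_eq_left times_divide_eq_right)
    thus "c * exp (- s / d) * (exp ((t + s) / d) / d * v (t + s)) = exp (t / d) / d * (c * v (t + s))"
      unfolding e .
  qed
  moreover have "c * exp (- s / d) * (exp ((q + s) / d) * w (q + s) - exp ((p + s) / d) * w (p + s))
      = exp (q / d) * (c * w (q + s)) - exp (p / d) * (c * w (p + s))"
  proof -
    have "c * exp (- s / d) * (exp ((q + s) / d) * w (q + s) - exp ((p + s) / d) * w (p + s)) =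
        (exp (- s / d) * exp ((q + s) / d)) * (c * w (q + s)) - (exp (- s / d) * exp ((p + s) / d)) * (c * w (p + s))"
      by (simp only: right_diff_distrib mult_ac)
    thus ?thesis unfolding e .
  qed
  ultimately show "((\<lambda>t. exp (t / d) / d * (c * v (t + s))) has_integral
      (exp (q / d) * (c * w (q + s)) - exp (p / d) * (c * w (p + s)))) {p..q}"
    by (simp only:)
qed

lemma Re_zak_has_sum:
  assumes h: "exp_decay h" and M: "M > 0"
  shows "((\<lambda>k::int. Re (c * cis (of_int k * \<theta>)) * h (x + of_int k * M)) has_sum Re (c * zak h M \<theta> x)) UNIV"
proof -
  have "((\<lambda>k::int. Re (c * (of_real (h (x + of_int k * M)) * cis (of_int k * \<theta>)))) has_sum Re (c * zak h M \<theta> x)) UNIV"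
    by (intro has_sum_Re has_sum_cmult_right zak_has_sum assms)
  thus ?thesis by (simp add: algebra_simps)
qed

text \<open>The Zak transform is a sum of translates with coefficients independent of
  \<open>x\<close>, so it respects the linear equation; the real part is taken because sign changes
  are counted.\<close>

lemma exp_primitive_Re_zak:
  assumes E: "exp_primitive d h w" and d: "d \<noteq> 0" and h: "exp_decay h" and w: "exp_decay w" and M: "M > 0"
  shows "exp_primitive d (\<lambda>x. Re (c * zak h M \<theta> x)) (\<lambda>x. Re (c * zak w M \<theta> x))"
proof -
  have "exp_primitive d (\<lambda>x. \<Sum>\<^sub>\<infinity>k::int. Re (c * cis (of_int k * \<theta>)) * h (x + of_int k * M))
      (\<lambda>x. \<Sum>\<^sub>\<infinity>k::int. Re (c * cis (of_int k * \<theta>)) * w (x + of_int k * M))"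
  proof (rule exp_primitive_infsum[OF d exp_primitive_shift_mult[OF E]])
    show "(\<lambda>k::int. Re (c * cis (of_int k * \<theta>)) * w (x + of_int k * M)) summable_on UNIV" for x
      using Re_zak_has_sum[OF w M] by (rule has_sum_imp_summable)
    fix R :: real
    obtain B where B: "B summable_on UNIV" "\<And>x k. \<bar>x\<bar> \<le> R \<Longrightarrow> \<bar>h (x + of_int k * M)\<bar> \<le> B k" "\<And>k::int. B k \<ge> 0"
      using exp_decay_translates[OF h M] by metis
    show "\<exists>B. B summable_on UNIV \<and> (\<forall>x (k::int). \<bar>x\<bar> \<le> R \<longrightarrow> \<bar>Re (c * cis (of_int k * \<theta>)) * h (x + of_int k * M)\<bar> \<le> B k)"
    proof (intro exI conjI allI impI)
      show "(\<lambda>k. cmod c * B k) summable_on UNIV" using B(1) by (rule summable_on_cmult_right)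
      fix x and k :: int assume x: "\<bar>x\<bar> \<le> R"
      have "\<bar>Re (c * cis (of_int k * \<theta>))\<bar> \<le> cmod c"
        using abs_Re_le_cmod[of "c * cis (of_int k * \<theta>)"] by (simp add: norm_mult)
      thus "\<bar>Re (c * cis (of_int k * \<theta>)) * h (x + of_int k * M)\<bar> \<le> cmod c * B k"
        unfolding abs_mult using B(2)[OF x] by (intro mult_mono) auto
    qed
  qed
  thus ?thesis
    using infsumI[OF Re_zak_has_sum[OF h M]] infsumI[OF Re_zak_has_sum[OF w M]] by simp
qed

text \<open>One-sidedness leaves a geometric series with ratio
  \<open>exp (- M / d) * cis \<theta>\<close>: over \<open>k \<ge> - n\<close> when
  \<open>d > 0\<close>, and over \<open>k < - n\<close> when \<open>d < 0\<close>, where the ratio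
  has modulus above one and the series runs in its inverse. Both cases sum to the same expression,
  and \<open>sgn d\<close> turns the modulus of \<open>d\<close> into \<open>d\<close>.\<close>

lemma zak_exp_kernel:
  assumes d: "d \<noteq> 0" and M: "M > 0"
  shows "zak (exp_kernel d) M \<theta> x * (1 - of_real (exp (- M / d)) * cis \<theta>) =
    of_real (exp ((of_int \<lfloor>x / M\<rfloor> * M - x) / d) / d) * cis (- of_int \<lfloor>x / M\<rfloor> * \<theta>)"
proof -
  define n where "n = \<lfloor>x / M\<rfloor>"
  define z where "z = of_real (exp (- M / d)) * cis \<theta>"
  define P where "P = of_real (exp ((of_int n * M - x) / d) / d) * cis (- of_int n * \<theta>)"
  have "of_int n \<le> x / M" "x / M < of_int n + 1" unfolding n_def by linarith+
  hence n: "of_int n * M \<le> x" "x < (of_int n + 1) * M" using M by (auto simp: field_simps)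
  have nonneg_iff: "0 \<le> x + of_int k * M \<longleftrightarrow> - n \<le> k" for k :: int
  proof
    assume "- n \<le> k"
    hence "- of_int n * M \<le> of_int k * M" using M by (intro mult_right_mono) (simp_all flip: of_int_minus)
    thus "0 \<le> x + of_int k * M" using n by linarith
  next
    assume a: "0 \<le> x + of_int k * M"
    show "- n \<le> k"
    proof (rule ccontr)
      assume "\<not> - n \<le> k"
      hence "k \<le> - n - 1" by linarith
      hence "of_int k * M \<le> of_int (- n - 1) * M" using M by (intro mult_right_mono) (simp_all only: of_int_le_iff)
      thus False using a n by (simp add: algebra_simps)
    qed
  qed
  have nz: "cmod z = exp (- M / d)" by (simp add: z_def norm_mult)
  have trm: "of_real (exp_kernel d (x + of_int k * M)) * cis (of_int k * \<theta>) =
     (if (0 < d) = (- n \<le> k) then of_real (sgn d) * P * z powi (k + n) else 0)" for k :: int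
  proof -
    have z0: "z powi (k + n) = of_real (exp (- (of_int (k + n) * M) / d)) * cis (of_int (k + n) * \<theta>)"
      unfolding z_def power_int_mult_distrib
      by (simp add: exp_power_int cis_power_int flip: of_real_power_int)
    have "of_real (sgn d) * P * z powi (k + n) = of_real (sgn d / d) *
        of_real (exp ((of_int n * M - x) / d) * exp (- (of_int (k + n) * M) / d)) *
         (cis (- of_int n * \<theta>) * cis (of_int (k + n) * \<theta>))"
      unfolding z0 P_def by simp
    also have "exp ((of_int n * M - x) / d) * exp (- (of_int (k + n) * M) / d) = exp (- (x + of_int k * M) / d)"
      unfolding mult_exp_exp add_divide_distrib[symmetric] by (simp add: algebra_simps)
    also have "cis (- of_int n * \<theta>) * cis (of_int (k + n) * \<theta>) = cis (of_int k * \<theta>)"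
      by (simp add: cis_mult algebra_simps)
    also have "sgn d / d = 1 / \<bar>d\<bar>" using d by (simp add: sgn_if)
    finally show ?thesis using nonneg_iff[of k] by (simp add: exp_kernel_def)
  qed
  have "zak (exp_kernel d) M \<theta> x * (1 - z) = P"
  proof (cases "d > 0")
    case True
    have z1: "cmod z < 1" using nz True M by simp
    hence zn: "z \<noteq> 1" by auto
    have "((\<lambda>i::nat. P * z ^ i) has_sum (P * (1 / (1 - z)))) UNIV"
      using z1 by (intro has_sum_cmult_right norm_summable_imp_has_sum geometric_sums) (simp_all add: norm_power summable_geometric)
    also have "?this \<longleftrightarrow> ((\<lambda>k. P * z powi (k + n)) has_sum (P * (1 / (1 - z)))) {- n..}"
      by (rule has_sum_reindex_bij_witness[of _ "\<lambda>k. nat (k + n)" "\<lambda>i. int i - n"]) auto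
    also have "\<dots> \<longleftrightarrow> ((\<lambda>k. of_real (exp_kernel d (x + of_int k * M)) * cis (of_int k * \<theta>)) has_sum (P * (1 / (1 - z)))) UNIV"
      by (rule has_sum_cong_neutral) (use True in \<open>auto simp: trm\<close>)
    finally have "zak (exp_kernel d) M \<theta> x = P * (1 / (1 - z))"
      unfolding zak_def by (rule infsumI)
    thus ?thesis using zn by simp
  next
    case False
    hence dn: "d < 0" using d by simp
    have z1: "cmod z > 1" using nz divide_pos_neg[OF M dn] by simp
    hence zn: "z \<noteq> 1" "z \<noteq> 0" by auto
    have z2: "cmod (inverse z) < 1" using less_imp_inverse_less[of 1 "cmod z"] z1 by (simp add: norm_inverse)
    have "((\<lambda>i::nat. - P * inverse z * inverse z ^ i) has_sum (- P * inverse z * (1 / (1 - inverse z)))) UNIV"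
      using z2 by (intro has_sum_cmult_right norm_summable_imp_has_sum geometric_sums)
        (simp_all add: norm_power summable_geometric)
    also have "?this \<longleftrightarrow> ((\<lambda>k. - P * z powi (k + n)) has_sum (- P * inverse z * (1 / (1 - inverse z)))) {..< - n}"
    proof (rule has_sum_reindex_bij_witness[of _ "\<lambda>k. nat (- n - 1 - k)" "\<lambda>i. - n - 1 - int i"])
      fix i :: nat
      have "z powi (- n - 1 - int i + n) = z powi (- int (Suc i))" by (simp add: algebra_simps)
      also have "\<dots> = inverse z * inverse z ^ i" by (simp only: power_int_minus power_int_of_nat power_Suc) (simp add: power_inverse)
      finally show "- P * z powi (- n - 1 - int i + n) = - P * inverse z * inverse z ^ i" by simp
    qed auto
    also have "\<dots> \<longleftrightarrow> ((\<lambda>k. of_real (exp_kernel d (x + of_int k * M)) * cis (of_int k * \<theta>)) has_sum (- P * inverse z * (1 / (1 - inverse z)))) UNIV"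
      by (rule has_sum_cong_neutral) (use dn in \<open>auto simp: trm\<close>)
    finally have "zak (exp_kernel d) M \<theta> x = - P * inverse z * (1 / (1 - inverse z))"
      unfolding zak_def by (rule infsumI)
    also have "\<dots> = - P / (z * (1 - inverse z))" by (simp add: divide_inverse)
    also have "z * (1 - inverse z) = - (1 - z)" using zn by (simp add: right_diff_distrib)
    also have "- P / - (1 - z) = P / (1 - z)" by (rule minus_divide_divide)
    finally have e: "zak (exp_kernel d) M \<theta> x = P / (1 - z)" .
    have "1 - z \<noteq> 0" using zn by simp
    thus ?thesis unfolding e by (simp only: times_divide_eq_left nonzero_mult_div_cancel_right not_False_eq_True)
  qed
  thus ?thesis unfolding n_def z_def P_def .
qed

section \<open>Zeros of the Zak transform\<close>

lemma zak_cong_cis: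
  assumes "cis \<theta> = cis \<theta>'"
  shows "zak h M \<theta> x = zak h M \<theta>' x"
proof -
  have "cis (of_int k * \<theta>) = cis (of_int k * \<theta>')" for k :: int
    using cis_power_int[of \<theta> k] cis_power_int[of \<theta>' k] assms by simp
  thus ?thesis by (simp add: zak_def)
qed

text \<open>A consequence of \<open>h\<close> being real; it reduces negative arguments to the case
  \<open>\<theta> \<ge> 0\<close> in which sign changes are counted.\<close>

lemma zak_uminus: "zak h M (- \<theta>) x = cnj (zak h M \<theta> x)"
proof -
  have "zak h M (- \<theta>) x = (\<Sum>\<^sub>\<infinity>k::int. cnj (of_real (h (x + of_int k * M)) * cis (of_int k * \<theta>)))"
    by (simp add: zak_def cis_cnj)
  also have "\<dots> = cnj (zak h M \<theta> x)" unfolding zak_def by (rule infsum_cnj)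
  finally show ?thesis .
qed

text \<open>Applies \<open>zero_density_bound\<close> to real parts \<open>Re (c Z)\<close> along
  the chain of partial convolutions, whose first member is the closed form in
  \<open>zak_exp_kernel\<close>. Zeros of \<open>Z\<close> remain zeros for any
  \<open>c\<close>.\<close>

lemma zak_exp_conv_zero_density:
  assumes d: "\<And>k. k \<le> j \<Longrightarrow> d k \<noteq> 0" and j: "j > 0" and M: "M > 0" and \<theta>: "\<theta> \<ge> 0" and \<kappa>: "\<kappa> > 0"
    and y: "\<And>i. y i < y (Suc i)" and per: "\<And>n. y (\<kappa> * n) = y 0 + real n * M"
    and z: "\<And>i. zak (exp_conv d j) M \<theta> (y i) = 0"
  shows "real \<kappa> * pi \<le> \<theta>"
proof -
  obtain \<phi> where \<phi>: "\<And>n::int. cos (\<phi> - \<theta> * of_int n) \<noteq> 0" using ex_generic_phase by blast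
  \<comment> \<open>the second factor cancels the denominator in \<open>zak_exp_kernel\<close>\<close>
  define c where "c = cis \<phi> * (1 - of_real (exp (- M / d 0)) * cis \<theta>)"
  define v where "v = (\<lambda>i x. Re (c * zak (exp_conv d i) M \<theta> x))"
  have dec: "exp_decay (exp_conv d i)" if "i \<le> j" for i
    using d that by (intro exp_conv_decay) auto
  have E: "exp_primitive (d (Suc i)) (v i) (v (Suc i))" if "i < j" for i
    unfolding v_def using d that M by (intro exp_primitive_Re_zak exp_conv_primitive dec) auto
  show ?thesis
  proof (rule zero_density_bound[where v = v and d = "\<lambda>i. d (Suc i)" and m = j and \<phi> = \<phi>, OF E])
    show "v 0 = exp_cos_step (1 / d 0) (d 0) M \<phi> \<theta>"
    proof
      fix x
      have "v 0 x = Re (cis \<phi> * (zak (exp_kernel (d 0)) M \<theta> x * (1 - of_real (exp (- M / d 0)) * cis \<theta>)))"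
        by (simp add: v_def c_def mult_ac exp_conv.simps(1)[abs_def])
      also have "\<dots> = Re (of_real (exp ((of_int \<lfloor>x / M\<rfloor> * M - x) / d 0) / d 0) * (cis \<phi> * cis (- of_int \<lfloor>x / M\<rfloor> * \<theta>)))"
        using d[of 0] by (subst zak_exp_kernel[OF _ M]) (auto simp only: mult_ac)
      also have "\<dots> = exp_cos_step (1 / d 0) (d 0) M \<phi> \<theta> x"
        by (simp add: cis_mult exp_cos_step_def mult_ac)
      finally show "v 0 x = exp_cos_step (1 / d 0) (d 0) M \<phi> \<theta> x" .
    qed
    show "continuous_on UNIV (v i)" if "0 < i" "i < j" for i
      using exp_primitive_continuous[OF E[of "i - 1"]] that by simp
    show "v j (y i) = 0" for i using z by (simp add: v_def)
  qed (use d[of 0] d \<phi> j M \<theta> \<kappa> y per in auto)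
qed

text \<open>After normalizing the argument to modulus below \<open>pi\<close>, a single zero and its
  translates by \<open>M\<close> have density \<open>\<kappa> = 1\<close>, which would force
  \<open>pi \<le> \<theta>\<close>.\<close>

lemma zak_exp_conv_nonzero:
  assumes d: "\<And>k. k \<le> j \<Longrightarrow> d k \<noteq> 0" and j: "j > 0" and M: "M > 0" and \<theta>: "cis \<theta> \<noteq> -1"
  shows "zak (exp_conv d j) M \<theta> x \<noteq> 0"
proof
  assume z: "zak (exp_conv d j) M \<theta> x = 0"
  define \<theta>' where "\<theta>' = Arg (cis \<theta>)"
  have eq: "cis \<theta>' = cis \<theta>" unfolding \<theta>'_def by (subst cis_Arg) (auto simp: sgn_div_norm)
  have "\<theta>' \<noteq> pi" using eq \<theta> by auto
  moreover have "- pi < \<theta>'" "\<theta>' \<le> pi" using Arg_bounded[of "cis \<theta>"] by (auto simp: \<theta>'_def)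
  ultimately have lt: "\<bar>\<theta>'\<bar> < pi" by linarith
  have "zak (exp_conv d j) M \<theta>' x = 0" using z zak_cong_cis[OF eq] by metis
  hence z': "zak (exp_conv d j) M \<bar>\<theta>'\<bar> x = 0" by (auto simp: abs_if zak_uminus)
  have "real 1 * pi \<le> \<bar>\<theta>'\<bar>"
  proof (rule zak_exp_conv_zero_density[where y = "\<lambda>i. x + real i * M", OF d j M])
    show "zak (exp_conv d j) M \<bar>\<theta>'\<bar> (x + real i * M) = 0" for i
      using zak_shift[OF exp_conv_decay[of j d, OF d] M, of "\<bar>\<theta>'\<bar>" x "int i"] z' by simp
  qed (use M in auto)
  thus False using lt by simp
qed

text \<open>The reindexing \<open>k\<close> to \<open>- 1 - k\<close> negates the sampling point
  \<open>M / 2 + k * M\<close> and flips the sign of \<open>cis (k * pi)\<close>; by evenness the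
  sum equals its own negative.\<close>

lemma zak_even_half:
  assumes h: "exp_decay h" and M: "M > 0" and ev: "\<And>x. h (- x) = h x"
  shows "zak h M pi (M / 2) = 0"
proof -
  let ?f = "\<lambda>k::int. of_real (h (M / 2 + of_int k * M)) * cis (of_int k * pi)"
  have "(?f has_sum zak h M pi (M / 2)) UNIV" by (rule zak_has_sum[OF h M])
  also have "?this \<longleftrightarrow> ((\<lambda>k. - ?f k) has_sum zak h M pi (M / 2)) UNIV"
  proof (rule has_sum_reindex_bij_witness[of _ "\<lambda>k. - 1 - k" "\<lambda>k. - 1 - k"])
    fix k :: int
    have "M / 2 + of_int (- 1 - k) * M = - (M / 2 + of_int k * M)"
      by (simp add: field_simps)
    hence "h (M / 2 + of_int (- 1 - k) * M) = h (M / 2 + of_int k * M)"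
      by (simp only: ev)
    moreover have "cis (of_int (- 1 - k) * pi) = - cis (of_int k * pi)"
    proof -
      have "cis (of_int (- 1 - k) * pi) = cis (- pi) * cis (- (of_int k * pi))"
        by (simp add: cis_mult algebra_simps)
      also have "cis (- (of_int k * pi)) = cis (of_int k * pi)"
        by (auto simp: complex_eq_iff sin_npi_int cos_npi_int mult.commute)
      also have "cis (- pi) = -1" by (simp add: complex_eq_iff)
      finally show ?thesis by simp
    qed
    ultimately show "- ?f (- 1 - k) = ?f k" by simp
  qed auto
  finally have "(?f has_sum (- zak h M pi (M / 2))) UNIV"
    by (simp only: has_sum_uminus)
  from has_sum_unique[OF zak_has_sum[OF h M] this]
  have "zak h M pi (M / 2) = - zak h M pi (M / 2)" .
  thus ?thesis by simp
qed

text \<open>Only argument \<open>pi\<close> is in question, and there \<open>M / 2\<close> is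
  already a zero. A second zero modulo \<open>M\<close> would give density
  \<open>\<kappa> = 2\<close> and the contradiction \<open>2 * pi \<le> pi\<close>.\<close>

lemma zak_exp_conv_even_nonzero:
  assumes d: "\<And>k. k \<le> j \<Longrightarrow> d k \<noteq> 0" and j: "j > 0" and M: "M > 0"
    and ev: "\<And>x. exp_conv d j (- x) = exp_conv d j x" and x: "\<And>n::int. x \<noteq> M / 2 + of_int n * M"
  shows "zak (exp_conv d j) M \<theta> x \<noteq> 0"
proof (cases "cis \<theta> = -1")
  case True
  note dec = exp_conv_decay[of j d, OF d]
  show ?thesis
  proof
    assume z: "zak (exp_conv d j) M \<theta> x = 0"
    have z: "zak (exp_conv d j) M pi x = 0"
      using zak_cong_cis[of \<theta> pi "exp_conv d j" M x] True z by simp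
    \<comment> \<open>Chosen so that the translate \<open>x'\<close> lies in the period starting at
      the known zero \<open>M / 2\<close>.\<close>
    define n where "n = \<lfloor>x / M - 1 / 2\<rfloor>"
    define x' where "x' = x + of_int (- n) * M"
    have z1: "zak (exp_conv d j) M pi (x' + of_int i * M) = 0" for i
      using zak_shift[OF dec M, of pi x "- n"] zak_shift[OF dec M, of pi x' i] z by (simp add: x'_def)
    have z0: "zak (exp_conv d j) M pi (M / 2 + of_int i * M) = 0" for i
      using zak_shift[OF dec M, of pi "M / 2" i] zak_even_half[OF dec M ev] by simp
    have "of_int n \<le> x / M - 1 / 2" "x / M - 1 / 2 < of_int n + 1" unfolding n_def by linarith+
    hence "M / 2 \<le> x'" "x' < M / 2 + M" using M by (auto simp: x'_def field_simps)
    moreover have "x' \<noteq> M / 2" using x[of n] by (auto simp: x'_def algebra_simps)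
    ultimately have x': "M / 2 < x'" "x' < M / 2 + M" by auto
    \<comment> \<open>Interleaves the two progressions of zeros: even indices translate
      \<open>M / 2\<close>, odd ones \<open>x'\<close>.\<close>
    define y where "y = (\<lambda>i. (if even i then M / 2 else x') + real (i div 2) * M)"
    have "real 2 * pi \<le> pi"
    proof (rule zak_exp_conv_zero_density[where y = y, OF d j M])
      show "y i < y (Suc i)" for i
        using x' by (cases "even i") (auto simp: y_def algebra_simps elim!: oddE evenE)
      show "zak (exp_conv d j) M pi (y i) = 0" for i
        using z0[of "int (i div 2)"] z1[of "int (i div 2)"] by (auto simp: y_def)
    qed (auto simp: y_def)
    thus False by simp
  qed
qed (rule zak_exp_conv_nonzero[OF d j M])

section \<open>Discrete Fourier transform and cyclic correlations\<close>

lemma cis_2pi_eq_1_iff: "cis (2 * pi * t) = 1 \<longleftrightarrow> t \<in> \<int>"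
proof
  assume "cis (2 * pi * t) = 1"
  hence "cos (2 * pi * t) = 1" by (simp add: complex_eq_iff)
  then obtain n :: int where "2 * pi * t = of_int n * 2 * pi" using cos_one_2pi_int by blast
  hence "t = of_int n" by simp
  thus "t \<in> \<int>" by simp
next
  assume "t \<in> \<int>"
  thus "cis (2 * pi * t) = 1" by (rule cis_multiple_2pi)
qed

lemma sum_cis_roots_of_unity:
  assumes N: "N > 0" and jk: "j < N" "k < N"
  shows "(\<Sum>s<N. cis (2 * pi * (real j - real k) * real s / real N)) = (if j = k then of_nat N else 0)"
proof (cases "j = k")
  case False
  define w where "w = cis (2 * pi * ((real j - real k) / real N))"
  have "w ^ s = cis (2 * pi * (real j - real k) * real s / real N)" for s
    unfolding w_def Complex.DeMoivre by (rule arg_cong[where f = cis]) (simp add: mult_ac)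
  hence "(\<Sum>s<N. cis (2 * pi * (real j - real k) * real s / real N)) = (\<Sum>s<N. w ^ s)" by simp
  moreover have "w \<noteq> 1"
  proof
    assume "w = 1"
    then obtain n :: int where n: "(real j - real k) / real N = of_int n"
      unfolding w_def cis_2pi_eq_1_iff by (auto elim: Ints_cases)
    hence "real_of_int (int j - int k) = real_of_int (n * int N)" using N by (simp add: field_simps)
    hence e: "int j - int k = n * int N" by (simp only: of_int_eq_iff)
    have "\<bar>int j - int k\<bar> < int N" using jk by linarith
    hence "\<bar>n\<bar> * int N < 1 * int N" unfolding e by (simp add: abs_mult)
    hence "n = 0" using N by simp
    thus False using e False by simp
  qed
  moreover have "w ^ N = 1"
  proof -
    have "w ^ N = cis (2 * pi * (real_of_int (int j - int k)))"
      unfolding w_def Complex.DeMoivre using N by simp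
    also have "\<dots> = 1" unfolding cis_2pi_eq_1_iff by (rule Ints_of_int)
    finally show ?thesis .
  qed
  ultimately show ?thesis using False by (simp add: geometric_sum)
qed simp

lemma dft_parseval:
  fixes a :: "nat \<Rightarrow> complex"
  assumes N: "N > 0"
  shows "(\<Sum>s<N. (cmod (\<Sum>j<N. a j * cis (2 * pi * real j * real s / real N)))\<^sup>2) = real N * (\<Sum>j<N. (cmod (a j))\<^sup>2)"
proof -
  let ?e = "\<lambda>j s. cis (2 * pi * real j * real s / real N)"
  have "of_real (\<Sum>s<N. (cmod (\<Sum>j<N. a j * ?e j s))\<^sup>2) =
      (\<Sum>s<N. (\<Sum>j<N. a j * ?e j s) * cnj (\<Sum>k<N. a k * ?e k s))"
    by (simp only: of_real_sum complex_norm_square)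
  also have "\<dots> = (\<Sum>s<N. \<Sum>j<N. \<Sum>k<N. a j * cnj (a k) * cis (2 * pi * (real j - real k) * real s / real N))"
  proof -
    have ee: "?e j s * cnj (?e k s) = cis (2 * pi * (real j - real k) * real s / real N)" for j k s
      by (simp add: cis_cnj cis_mult algebra_simps diff_divide_distrib)
    have "(a j * ?e j s) * cnj (a k * ?e k s) = a j * cnj (a k) * (?e j s * cnj (?e k s))" for j k s
      by (simp only: complex_cnj_mult mult_ac)
    hence "(a j * ?e j s) * cnj (a k * ?e k s) = a j * cnj (a k) * cis (2 * pi * (real j - real k) * real s / real N)" for j k s
      unfolding ee .
    thus ?thesis by (simp only: sum_product cnj_sum)
  qed
  also have "\<dots> = (\<Sum>j<N. \<Sum>k<N. a j * cnj (a k) * (\<Sum>s<N. cis (2 * pi * (real j - real k) * real s / real N)))"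
    unfolding sum_distrib_left by (rule trans[OF sum.swap], rule sum.cong[OF refl], rule sum.swap)
  also have "\<dots> = (\<Sum>j<N. \<Sum>k<N. if k = j then a j * cnj (a j) * of_nat N else 0)"
    by (intro sum.cong refl) (auto simp: sum_cis_roots_of_unity[OF N])
  also have "\<dots> = (\<Sum>j<N. a j * cnj (a j) * of_nat N)" by simp
  also have "\<dots> = of_real (real N * (\<Sum>j<N. (cmod (a j))\<^sup>2))"
    by (simp only: of_real_mult of_real_sum of_real_of_nat_eq complex_norm_square sum_distrib_left mult_ac)
  finally show ?thesis by (simp only: of_real_eq_iff)
qed

lemma dft_parseval_neg:
  fixes a :: "nat \<Rightarrow> complex"
  assumes N: "N > 0"
  shows "(\<Sum>s<N. (cmod (\<Sum>j<N. a j * cis (- (2 * pi * real s * real j / real N))))\<^sup>2) = real N * (\<Sum>j<N. (cmod (a j))\<^sup>2)"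
proof -
  have "cmod (\<Sum>j<N. a j * cis (- (2 * pi * real s * real j / real N))) =
      cmod (\<Sum>j<N. cnj (a j) * cis (2 * pi * real j * real s / real N))" for s
  proof -
    have "(\<Sum>j<N. a j * cis (- (2 * pi * real s * real j / real N))) =
        cnj (\<Sum>j<N. cnj (a j) * cis (2 * pi * real j * real s / real N))"
      by (simp add: cnj_sum cis_cnj mult_ac)
    thus ?thesis by (simp only: complex_mod_cnj)
  qed
  thus ?thesis using dft_parseval[OF N, of "\<lambda>j. cnj (a j)"] by simp
qed

lemma sum_periodic_reflect:
  fixes \<phi> :: "int \<Rightarrow> 'a::comm_monoid_add"
  assumes N: "N > 0" and per: "\<And>i n. \<phi> (i + n * int N) = \<phi> i"
  shows "(\<Sum>k<N. \<phi> (j - int k)) = (\<Sum>i<N. \<phi> (int i))"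
proof -
  have m: "\<phi> (i mod int N) = \<phi> i" for i
    using per[of i "- (i div int N)"] by (simp add: minus_div_mult_eq_mod)
  have inv: "nat ((j - int (nat ((j - int k) mod int N))) mod int N) = k" if "k < N" for k
  proof -
    have "(j - (j - int k) mod int N) mod int N = (j - (j - int k)) mod int N" by (rule mod_diff_right_eq)
    thus ?thesis using that N by simp
  qed
  show ?thesis
    by (rule sum.reindex_bij_witness[of _ "\<lambda>i. nat ((j - int i) mod int N)" "\<lambda>k. nat ((j - int k) mod int N)"])
       (use N inv m in \<open>auto simp: nat_less_iff\<close>)
qed

text \<open>The sum is a correlation: with \<open>i = j - k\<close> the phase of \<open>k\<close>
  splits as that of \<open>j\<close> times the opposite phase of \<open>i\<close>. This is the
  origin of the minus sign in the arguments \<open>- 2 * pi * s / N\<close> at which the Zak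
  transform is sampled.\<close>

lemma cyclic_conv_dft:
  fixes q :: "int \<Rightarrow> complex"
  assumes N: "N > 0" and per: "\<And>i n. q (i + n * int N) = q i"
  shows "(\<Sum>k<N. (\<Sum>j<N. f j * q (int j - int k)) * cis (2 * pi * real k * real s / real N)) =
    (\<Sum>j<N. f j * cis (2 * pi * real j * real s / real N)) * (\<Sum>i<N. q (int i) * cis (real i * (- 2 * pi * real s / real N)))"
proof -
  define \<phi> where "\<phi> = (\<lambda>i::int. q i * cis (of_int i * (- 2 * pi * real s / real N)))"
  have "\<phi> (i + n * int N) = \<phi> i" for i n
  proof -
    have "cis (of_int (i + n * int N) * (- 2 * pi * real s / real N)) =
        cis (of_int i * (- 2 * pi * real s / real N)) * cis (2 * pi * of_int (- n * int s))"
      unfolding cis_mult using N by (intro arg_cong[where f = cis]) (simp add: field_simps)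
    also have "cis (2 * pi * of_int (- n * int s)) = 1"
      unfolding cis_2pi_eq_1_iff by (rule Ints_of_int)
    finally show ?thesis by (simp add: \<phi>_def per)
  qed
  note refl' = sum_periodic_reflect[of N \<phi>, OF N this]
  have "(\<Sum>k<N. (\<Sum>j<N. f j * q (int j - int k)) * cis (2 * pi * real k * real s / real N)) =
      (\<Sum>j<N. \<Sum>k<N. f j * q (int j - int k) * cis (2 * pi * real k * real s / real N))"
    unfolding sum_distrib_right by (rule sum.swap)
  also have "\<dots> = (\<Sum>j<N. f j * cis (2 * pi * real j * real s / real N) * (\<Sum>k<N. \<phi> (int j - int k)))"
  proof -
    have "cis (2 * pi * real k * real s / real N) = cis (2 * pi * real j * real s / real N) *
        cis (of_int (int j - int k) * (- 2 * pi * real s / real N))" for j k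
      unfolding cis_mult using N by (intro arg_cong[where f = cis]) (simp add: field_simps)
    hence "f j * q (int j - int k) * cis (2 * pi * real k * real s / real N) =
        f j * cis (2 * pi * real j * real s / real N) * \<phi> (int j - int k)" for j k
      by (simp add: \<phi>_def)
    thus ?thesis unfolding sum_distrib_left by (simp only:)
  qed
  also have "\<dots> = (\<Sum>j<N. f j * cis (2 * pi * real j * real s / real N)) * (\<Sum>i<N. \<phi> (int i))"
    unfolding refl' sum_distrib_right ..
  finally show ?thesis by (simp add: \<phi>_def)
qed

text \<open>By Parseval on both sides the correlation acts as multiplication by the transform of
  \<open>q\<close>, so bounds for this symbol are bounds for the operator.\<close>

lemma cyclic_conv_bounds:
  fixes q :: "int \<Rightarrow> complex"
  assumes N: "N > 0" and per: "\<And>i n. q (i + n * int N) = q i"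
    and bd: "\<And>s. s < N \<Longrightarrow> c \<le> (cmod (\<Sum>i<N. q (int i) * cis (real i * (- 2 * pi * real s / real N))))\<^sup>2"
            "\<And>s. s < N \<Longrightarrow> (cmod (\<Sum>i<N. q (int i) * cis (real i * (- 2 * pi * real s / real N))))\<^sup>2 \<le> D"
  shows "c * (\<Sum>j<N. (cmod (f j))\<^sup>2) \<le> (\<Sum>k<N. (cmod (\<Sum>j<N. f j * q (int j - int k)))\<^sup>2)" (is ?lower)
    and "(\<Sum>k<N. (cmod (\<Sum>j<N. f j * q (int j - int k)))\<^sup>2) \<le> D * (\<Sum>j<N. (cmod (f j))\<^sup>2)" (is ?upper)
proof -
  let ?S = "\<Sum>k<N. (cmod (\<Sum>j<N. f j * q (int j - int k)))\<^sup>2"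
  let ?F = "\<lambda>s. (cmod (\<Sum>j<N. f j * cis (2 * pi * real j * real s / real N)))\<^sup>2"
  let ?Q = "\<lambda>s. (cmod (\<Sum>i<N. q (int i) * cis (real i * (- 2 * pi * real s / real N))))\<^sup>2"
  have eq: "real N * ?S = (\<Sum>s<N. ?F s * ?Q s)"
    unfolding dft_parseval[OF N, symmetric] cyclic_conv_dft[OF N per] norm_mult power_mult_distrib ..
  have F: "(\<Sum>s<N. ?F s) = real N * (\<Sum>j<N. (cmod (f j))\<^sup>2)" by (rule dft_parseval[OF N])
  have "(\<Sum>s<N. ?F s * c) \<le> real N * ?S"
    unfolding eq using bd by (intro sum_mono mult_left_mono) auto
  hence "real N * (c * (\<Sum>j<N. (cmod (f j))\<^sup>2)) \<le> real N * ?S"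
    unfolding sum_distrib_right[symmetric] F by (simp add: mult_ac)
  thus ?lower using N by simp
  have "real N * ?S \<le> (\<Sum>s<N. ?F s * D)"
    unfolding eq using bd by (intro sum_mono mult_left_mono) auto
  hence "real N * ?S \<le> real N * (D * (\<Sum>j<N. (cmod (f j))\<^sup>2))"
    unfolding sum_distrib_right[symmetric] F by (simp add: mult_ac)
  thus ?upper using N by simp
qed

section \<open>Periodization and its finite Fourier transform, the sampled Zak transform\<close>

lemma periodize_shift:
  assumes K: "K \<noteq> 0"
  shows "periodize g K (x + of_int n * K) = periodize g K x"
  unfolding periodize_def
  by (rule infsum_reindex_bij_witness[of _ "\<lambda>k. k + n" "\<lambda>k. k - n"]) (auto simp: algebra_simps)

lemma periodize_realmod: "K \<noteq> 0 \<Longrightarrow> periodize g K (realmod x K) = periodize g K x"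
  using periodize_shift[of K g x "- \<lfloor>x / K\<rfloor>"] by (simp add: realmod_def mult.commute)

lemma PKS_eq_periodize: "PKS g K n = periodize g (real K) (of_int n)"
  by (simp add: PKS_def periodize_def)

lemma PKS_mod: "K > 0 \<Longrightarrow> PKS g K (n mod int K) = periodize g (real K) (of_int n)"
proof -
  assume K: "K > 0"
  have "of_int (n mod int K) = real_of_int n + of_int (- (n div int K)) * real K"
    by (simp add: minus_div_mult_eq_mod[symmetric])
  thus ?thesis
    using periodize_shift[of "real K" g "of_int n" "- (n div int K)"] K by (simp only: PKS_eq_periodize)
qed

lemma has_sum_of_real_exp_decay:
  assumes h: "exp_decay h" and K: "K > 0"
  shows "((\<lambda>k::int. of_real (h (x - of_int k * K))) has_sum (periodize (\<lambda>x. of_real (h x)) K x)) UNIV"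
proof -
  have "((\<lambda>k::int. of_real (h (x + of_int k * K)) :: complex) has_sum zak h K 0 x) UNIV"
    using zak_has_sum[OF h K, of x 0] by simp
  also have "?this \<longleftrightarrow> ((\<lambda>k::int. of_real (h (x - of_int k * K)) :: complex) has_sum zak h K 0 x) UNIV"
    by (rule has_sum_reindex_bij_witness[of _ uminus uminus]) auto
  finally show ?thesis unfolding periodize_def using has_sum_infsum has_sum_imp_summable by blast
qed

lemma periodize_real:
  assumes h: "exp_decay h" and K: "K > 0"
  shows "cnj (periodize (\<lambda>x. of_real (h x)) K x) = periodize (\<lambda>x. of_real (h x)) K x"
  unfolding periodize_def infsum_cnj[symmetric] by simp

text \<open>Writing \<open>k = i - l * N\<close>, the phase at an \<open>N\<close>-th root of unity
  depends only on \<open>i\<close>, and the inner sum over \<open>l\<close> is the periodization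
  with period \<open>N * M\<close>.\<close>

lemma zak_eq_dft_periodize:
  assumes h: "exp_decay h" and M: "M > 0" and N: "N > 0"
  shows "(\<Sum>i<N. periodize (\<lambda>x. of_real (h x)) (real N * M) (x + real i * M) * cis (real i * (- 2 * pi * real s / real N)))
    = zak h M (- 2 * pi * real s / real N) x"
proof -
  define \<theta> where "\<theta> = - 2 * pi * real s / real N"
  let ?f = "\<lambda>k::int. of_real (h (x + of_int k * M)) * cis (of_int k * \<theta>)"
  have "(?f has_sum zak h M \<theta> x) UNIV" by (rule zak_has_sum[OF h M])
  \<comment> \<open>The quotient is negated because \<open>periodize\<close> subtracts its
    shifts.\<close>
  also have "?this \<longleftrightarrow> ((\<lambda>(i, l). ?f (int i - l * int N)) has_sum zak h M \<theta> x) (SIGMA i:{..<N}. UNIV)"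
  proof (rule has_sum_reindex_bij_witness[of _ "\<lambda>(i, l). int i - l * int N" "\<lambda>k. (nat (k mod int N), - (k div int N))"])
    fix p assume "p \<in> (SIGMA i:{..<N}. (UNIV :: int set))"
    then obtain i l where p: "p = (i, l)" "i < N" by auto
    have "(int i - l * int N) div int N = - l" "(int i - l * int N) mod int N = int i"
      using p N div_mult_self1[of "int N" "int i" "- l"] mod_mult_self1[of "int i" "- l" "int N"]
      by (auto simp: mult.commute)
    thus "(\<lambda>k. (nat (k mod int N), - (k div int N))) ((\<lambda>(i, l). int i - l * int N) p) = p"
      using p by simp
  next
    fix k :: int
    have "int (nat (k mod int N)) - - (k div int N) * int N = k"
      using N by simp
    thus "(\<lambda>(i, l). ?f (int i - l * int N)) (nat (k mod int N), - (k div int N)) = ?f k"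
      unfolding prod.case by simp
  qed (use N in \<open>auto simp: nat_less_iff\<close>)
  finally have H: "((\<lambda>(i, l). ?f (int i - l * int N)) has_sum zak h M \<theta> x) (SIGMA i:{..<N}. UNIV)" .
  have "((\<lambda>i. periodize (\<lambda>x. of_real (h x)) (real N * M) (x + real i * M) * cis (real i * \<theta>)) has_sum zak h M \<theta> x) {..<N}"
  proof (rule has_sum_SigmaD[OF H])
    fix i assume "i \<in> {..<N}"
    have c: "cis (of_int (int i - l * int N) * \<theta>) = cis (real i * \<theta>)" for l
    proof -
      have "cis (of_int (int i - l * int N) * \<theta>) = cis (real i * \<theta>) * cis (2 * pi * of_int (l * int s))"
        unfolding cis_mult \<theta>_def using N by (intro arg_cong[where f = cis]) (simp add: field_simps)
      also have "cis (2 * pi * of_int (l * int s)) = 1" unfolding cis_2pi_eq_1_iff by (rule Ints_of_int)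
      finally show ?thesis by simp
    qed
    have H': "((\<lambda>l::int. of_real (h (x + real i * M - of_int l * (real N * M))) * cis (real i * \<theta>)) has_sum
       (periodize (\<lambda>x. of_real (h x)) (real N * M) (x + real i * M) * cis (real i * \<theta>))) UNIV"
      using M N by (intro has_sum_cmult_left has_sum_of_real_exp_decay h) auto
    have eq: "x + of_int (int i - l * int N) * M = x + real i * M - of_int l * (real N * M)" for l
      by (simp add: algebra_simps)
    show "((\<lambda>l. case (i, l) of (i, l) \<Rightarrow> ?f (int i - l * int N)) has_sum
       (periodize (\<lambda>x. of_real (h x)) (real N * M) (x + real i * M) * cis (real i * \<theta>))) UNIV"
      unfolding prod.case c eq by (rule H')
  qed
  from has_sum_unique[OF has_sum_finite[OF finite_lessThan] this]
  show ?thesis unfolding \<theta>_def .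
qed

section \<open>Frames of C^K\<close>

lemma sum_lessThan_mult_split:
  fixes F :: "nat \<Rightarrow> 'a::comm_monoid_add"
  shows "(\<Sum>n<N * M. F n) = (\<Sum>r<M. \<Sum>j<N. F (r + j * M))"
proof -
  have "sum F {j * M..<j * M + M} = (\<Sum>r<M. F (r + j * M))" for j
    using sum.shift_bounds_nat_ivl[of F 0 "j * M" M] by (simp add: add.commute atLeast0LessThan)
  hence "(\<Sum>n<N * M. F n) = (\<Sum>j<N. \<Sum>r<M. F (r + j * M))"
    using sum.nat_group[of F M N] by simp
  also have "\<dots> = (\<Sum>r<M. \<Sum>j<N. F (r + j * M))" by (rule sum.swap)
  finally show ?thesis .
qed

lemma cis_modulation_shift:
  assumes "M > 0"
  shows "cis (2 * pi * (real l / real M) * real (r + j * M)) = cis (2 * pi * real l * real r / real M)"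
proof -
  have "cis (2 * pi * (real l / real M) * real (r + j * M)) =
      cis (2 * pi * real l * real r / real M) * cis (2 * pi * of_int (int (l * j)))"
    unfolding cis_mult using assms by (intro arg_cong[where f = cis]) (simp add: field_simps)
  also have "cis (2 * pi * of_int (int (l * j))) = 1"
    unfolding cis_2pi_eq_1_iff by (rule Ints_of_int)
  finally show ?thesis by simp
qed

text \<open>Stated for one real \<open>x\<close>, so that it serves residues modulo \<open>M\<close>
  in the discrete case as well as points of \<open>{0..M}\<close> in the continuous one.\<close>

lemma periodize_cyclic_bounds:
  assumes h: "exp_decay h" and N: "N > 0" and M: "M > 0"
    and bd: "\<And>s. s < N \<Longrightarrow> c \<le> (cmod (zak h M (- 2 * pi * real s / real N) x))\<^sup>2"
            "\<And>s. s < N \<Longrightarrow> (cmod (zak h M (- 2 * pi * real s / real N) x))\<^sup>2 \<le> D"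
  shows "c * (\<Sum>j<N. (cmod (f j))\<^sup>2) \<le>
      (\<Sum>k<N. (cmod (\<Sum>j<N. f j * periodize (\<lambda>x. of_real (h x)) (real N * M) (x + of_int (int j - int k) * M)))\<^sup>2)"
    and "(\<Sum>k<N. (cmod (\<Sum>j<N. f j * periodize (\<lambda>x. of_real (h x)) (real N * M) (x + of_int (int j - int k) * M)))\<^sup>2)
      \<le> D * (\<Sum>j<N. (cmod (f j))\<^sup>2)"
proof -
  define q where "q = (\<lambda>i::int. periodize (\<lambda>x. complex_of_real (h x)) (real N * M) (x + of_int i * M))"
  have per: "q (i + n * int N) = q i" for i n
  proof -
    have eq: "x + of_int (i + n * int N) * M = x + of_int i * M + of_int n * (real N * M)" by (simp add: algebra_simps)
    show ?thesis unfolding q_def eq using N M by (intro periodize_shift) simp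
  qed
  have dft: "(\<Sum>i<N. q (int i) * cis (real i * (- 2 * pi * real s / real N))) = zak h M (- 2 * pi * real s / real N) x" for s
    using zak_eq_dft_periodize[OF h M N, of x s] by (simp add: q_def)
  show "c * (\<Sum>j<N. (cmod (f j))\<^sup>2) \<le>
      (\<Sum>k<N. (cmod (\<Sum>j<N. f j * periodize (\<lambda>x. of_real (h x)) (real N * M) (x + of_int (int j - int k) * M)))\<^sup>2)"
    using cyclic_conv_bounds(1)[of N q c D f, OF N per] bd unfolding dft by (simp add: q_def)
  show "(\<Sum>k<N. (cmod (\<Sum>j<N. f j * periodize (\<lambda>x. of_real (h x)) (real N * M) (x + of_int (int j - int k) * M)))\<^sup>2)
      \<le> D * (\<Sum>j<N. (cmod (f j))\<^sup>2)"
    using cyclic_conv_bounds(2)[of N q c D f, OF N per] bd unfolding dft by (simp add: q_def)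
qed

text \<open>With \<open>n = r + j * M\<close> the modulation sees only \<open>r\<close>, while the
  translation by \<open>k * M\<close> acts only on \<open>j\<close>. The inner product is thus a
  Fourier transform over \<open>r\<close> of correlations over \<open>j\<close>.\<close>

lemma CK_inner_gabor:
  assumes h: "exp_decay h" and N: "N > 0" and M: "M > 0"
  shows "CK_inner (N * M) f (gabor_PKSg (\<lambda>x. of_real (h x)) (N * M) M (k, l)) =
    (\<Sum>r<M. (\<Sum>j<N. f (r + j * M) * periodize (\<lambda>x. of_real (h x)) (real N * real M) (real r + of_int (int j - int k) * real M))
      * cis (- (2 * pi * real l * real r / real M)))"
proof -
  let ?g = "\<lambda>x. complex_of_real (h x)"
  have K: "real (N * M) > 0" "N * M > 0" using N M by simp_all
  have t: "f (r + j * M) * cnj (gabor_PKSg ?g (N * M) M (k, l) (r + j * M)) =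
      f (r + j * M) * periodize ?g (real N * real M) (real r + of_int (int j - int k) * real M)
        * cis (- (2 * pi * real l * real r / real M))" for r j
  proof -
    have "cnj (PKS ?g (N * M) ((int (r + j * M) - int (k * M)) mod int (N * M))) =
        periodize ?g (real (N * M)) (of_int (int (r + j * M) - int (k * M)))"
      unfolding PKS_mod[OF K(2)] by (rule periodize_real[OF h K(1)])
    also have "real_of_int (int (r + j * M) - int (k * M)) = real r + of_int (int j - int k) * real M"
      by (simp add: algebra_simps)
    finally show ?thesis
      unfolding gabor_PKSg_def prod.case complex_cnj_mult cis_modulation_shift[OF M] by (simp add: cis_cnj)
  qed
  show ?thesis
    unfolding CK_inner_def sum_lessThan_mult_split t sum_distrib_right ..
qed

text \<open>Parseval in \<open>l\<close> decouples the residues \<open>r\<close> at the price of a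
  factor \<open>M\<close>. Each residue contributes a cyclic correlation with the Zak transform as
  symbol, and finitely many nonzero values have a positive minimum.\<close>

lemma CK_frame_gabor:
  assumes h: "exp_decay h" and N: "N > 0" and M: "M > 0"
    and nz: "\<And>r s. r < M \<Longrightarrow> s < N \<Longrightarrow> zak h M (- 2 * pi * real s / real N) (real r) \<noteq> 0"
  shows "CK_frame (N * M) ({0..<N} \<times> {0..<M}) (gabor_PKSg (\<lambda>x. of_real (h x)) (N * M) M)"
proof -
  define Z where "Z = (\<lambda>(r, s). (cmod (zak h M (- 2 * pi * real s / real N) (real r)))\<^sup>2) ` ({..<M} \<times> {..<N})"
  have Z: "finite Z" "Z \<noteq> {}" using N M by (auto simp: Z_def)
  define c where "c = Min Z"
  define D where "D = Max Z"
  have mem: "(cmod (zak h M (- 2 * pi * real s / real N) (real r)))\<^sup>2 \<in> Z" if "r < M" "s < N" for r s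
    using that unfolding Z_def by (intro image_eqI[of _ _ "(r, s)"]) auto
  have c: "c \<le> (cmod (zak h M (- 2 * pi * real s / real N) (real r)))\<^sup>2"
    and D: "(cmod (zak h M (- 2 * pi * real s / real N) (real r)))\<^sup>2 \<le> D" if "r < M" "s < N" for r s
    unfolding c_def D_def using mem[OF that] Z by auto
  have "c \<in> Z" unfolding c_def using Z by (rule Min_in)
  hence c0: "c > 0" using nz by (auto simp: Z_def)
  have D0: "D > 0" using c[of 0 0] D[of 0 0] N M c0 by linarith
  let ?e = "gabor_PKSg (\<lambda>x. of_real (h x)) (N * M) M"
  let ?p = "periodize (\<lambda>x. complex_of_real (h x)) (real N * real M)"
  have S: "(\<Sum>i\<in>{0..<N} \<times> {0..<M}. (cmod (CK_inner (N * M) f (?e i)))\<^sup>2) =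
     (\<Sum>r<M. real M * (\<Sum>k<N. (cmod (\<Sum>j<N. f (r + j * M) * ?p (real r + of_int (int j - int k) * real M)))\<^sup>2))" for f
  proof -
    have "(\<Sum>i\<in>{0..<N} \<times> {0..<M}. (cmod (CK_inner (N * M) f (?e i)))\<^sup>2) =
        (\<Sum>k<N. \<Sum>l<M. (cmod (CK_inner (N * M) f (?e (k, l))))\<^sup>2)"
      by (simp add: sum.cartesian_product atLeast0LessThan split_def)
    also have "\<dots> = (\<Sum>k<N. real M * (\<Sum>r<M. (cmod (\<Sum>j<N. f (r + j * M) * ?p (real r + of_int (int j - int k) * real M)))\<^sup>2))"
      unfolding CK_inner_gabor[OF h N M] dft_parseval_neg[OF M] ..
    also have "\<dots> = (\<Sum>r<M. real M * (\<Sum>k<N. (cmod (\<Sum>j<N. f (r + j * M) * ?p (real r + of_int (int j - int k) * real M)))\<^sup>2))"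
      unfolding sum_distrib_left by (rule sum.swap)
    finally show ?thesis .
  qed
  have norm: "(\<Sum>n<N * M. (cmod (f n))\<^sup>2) = (\<Sum>r<M. \<Sum>j<N. (cmod (f (r + j * M)))\<^sup>2)" for f :: "nat \<Rightarrow> complex"
    by (rule sum_lessThan_mult_split)
  have M': "real M > 0" using M by simp
  show ?thesis
    unfolding CK_frame_def
  proof (intro conjI exI allI)
    show "0 < real M * c" "0 < real M * D" using M c0 D0 by auto
    fix f :: "nat \<Rightarrow> complex"
    have "real M * c * (\<Sum>n<N * M. (cmod (f n))\<^sup>2) = (\<Sum>r<M. real M * (c * (\<Sum>j<N. (cmod (f (r + j * M)))\<^sup>2)))"
      unfolding norm by (simp only: sum_distrib_left mult.assoc)
    also have "\<dots> \<le> (\<Sum>r<M. real M * (\<Sum>k<N. (cmod (\<Sum>j<N. f (r + j * M) * ?p (real r + of_int (int j - int k) * real M)))\<^sup>2))"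
      by (intro sum_mono mult_left_mono periodize_cyclic_bounds(1)[OF h N M', where D = D]) (use c D in auto)
    finally show "real M * c * (\<Sum>n<N * M. (cmod (f n))\<^sup>2) \<le> (\<Sum>i\<in>{0..<N} \<times> {0..<M}. (cmod (CK_inner (N * M) f (?e i)))\<^sup>2)"
      unfolding S .
    have "(\<Sum>r<M. real M * (\<Sum>k<N. (cmod (\<Sum>j<N. f (r + j * M) * ?p (real r + of_int (int j - int k) * real M)))\<^sup>2))
       \<le> (\<Sum>r<M. real M * (D * (\<Sum>j<N. (cmod (f (r + j * M)))\<^sup>2)))"
      by (intro sum_mono mult_left_mono periodize_cyclic_bounds(2)[OF h N M', where c = c]) (use c D in auto)
    also have "\<dots> = real M * D * (\<Sum>n<N * M. (cmod (f n))\<^sup>2)"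
      unfolding norm by (simp only: sum_distrib_left mult.assoc)
    finally show "(\<Sum>i\<in>{0..<N} \<times> {0..<M}. (cmod (CK_inner (N * M) f (?e i)))\<^sup>2) \<le> real M * D * (\<Sum>n<N * M. (cmod (f n))\<^sup>2)"
      unfolding S .
  qed simp
qed

section \<open>Parseval's identity on an interval\<close>

text \<open>An inductive span makes closure under products a double induction; the explicit sums
  with coefficients are recovered in \<open>trig_poly_sum_rep\<close>.\<close>

inductive trig_poly :: "real \<Rightarrow> (real \<Rightarrow> complex) \<Rightarrow> bool" for P where
  monom: "trig_poly P (\<lambda>t. a * cis (2 * pi * of_int l * t / P))"
| add: "trig_poly P p \<Longrightarrow> trig_poly P q \<Longrightarrow> trig_poly P (\<lambda>t. p t + q t)"

lemma trig_poly_const: "trig_poly P (\<lambda>t. c)"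
  using trig_poly.monom[of P c 0] by simp

lemma trig_poly_mult:
  assumes "trig_poly P p" "trig_poly P q"
  shows "trig_poly P (\<lambda>t. p t * q t)"
  using assms
proof (induction p rule: trig_poly.induct)
  case (monom a l)
  from monom show ?case
  proof (induction q rule: trig_poly.induct)
    case (monom b k)
    have "(\<lambda>t. a * cis (2 * pi * of_int l * t / P) * (b * cis (2 * pi * of_int k * t / P))) =
        (\<lambda>t. (a * b) * cis (2 * pi * of_int (l + k) * t / P))"
    proof
      fix t
      have "cis (2 * pi * of_int l * t / P) * cis (2 * pi * of_int k * t / P) = cis (2 * pi * of_int (l + k) * t / P)"
        unfolding cis_mult by (simp add: add_divide_distrib distrib_left distrib_right)
      thus "a * cis (2 * pi * of_int l * t / P) * (b * cis (2 * pi * of_int k * t / P)) =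
        (a * b) * cis (2 * pi * of_int (l + k) * t / P)"
        by (metis (no_types, lifting) mult.assoc mult.left_commute)
    qed
    thus ?case using trig_poly.monom[of P "a * b" "l + k"] by simp
  next
    case (add p q)
    thus ?case using trig_poly.add[OF add.IH] by (simp add: distrib_left)
  qed
next
  case (add p p')
  thus ?case using trig_poly.add[OF add.IH(1) add.IH(2)] by (simp add: distrib_right)
qed

lemma trig_poly_continuous: "trig_poly P p \<Longrightarrow> continuous_on A p"
proof (induction rule: trig_poly.induct)
  case (monom a l)
  have "continuous_on A (\<lambda>t. a * cis (2 * pi * of_int l * t * inverse P))" by (intro continuous_intros)
  thus ?case by (simp add: divide_inverse)
qed (intro continuous_intros)

lemma trig_poly_sum_rep:
  assumes "trig_poly P p"
  obtains S a where "finite S" "p = (\<lambda>t. \<Sum>l\<in>S. a l * cis (2 * pi * of_int l * t / P))"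
  using assms
proof (induction arbitrary: thesis rule: trig_poly.induct)
  case (monom a l)
  show ?case by (rule monom[of "{l}" "\<lambda>_. a"]) auto
next
  case (add p q)
  obtain S a where S: "finite S" "p = (\<lambda>t. \<Sum>l\<in>S. a l * cis (2 * pi * of_int l * t / P))" using add.IH(1) by blast
  obtain T b where T: "finite T" "q = (\<lambda>t. \<Sum>l\<in>T. b l * cis (2 * pi * of_int l * t / P))" using add.IH(2) by blast
  define c where "c = (\<lambda>l. (if l \<in> S then a l else 0) + (if l \<in> T then b l else 0))"
  show ?case
  proof (rule add.prems[of "S \<union> T" c])
    show "(\<lambda>t. p t + q t) = (\<lambda>t. \<Sum>l\<in>S \<union> T. c l * cis (2 * pi * of_int l * t / P))"
    proof
      fix t
      have "p t = (\<Sum>l\<in>S \<union> T. (if l \<in> S then a l else 0) * cis (2 * pi * of_int l * t / P))"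
        unfolding S(2) using S(1) T(1) by (intro sum.mono_neutral_cong_left) auto
      moreover have "q t = (\<Sum>l\<in>S \<union> T. (if l \<in> T then b l else 0) * cis (2 * pi * of_int l * t / P))"
        unfolding T(2) using S(1) T(1) by (intro sum.mono_neutral_cong_left) auto
      ultimately show "p t + q t = (\<Sum>l\<in>S \<union> T. c l * cis (2 * pi * of_int l * t / P))"
        by (simp add: c_def distrib_right sum.distrib)
    qed
  qed (use S T in auto)
qed

lemma trig_poly_of_real_polynomial:
  assumes "real_polynomial_function r"
  shows "trig_poly P (\<lambda>t. of_real (r (cis (2 * pi * t / P))))"
  using assms
proof (induction r rule: real_polynomial_function.induct)
  case (linear f)
  interpret bounded_linear f by fact
  \<comment> \<open>A real linear form on the plane restricted to the circle is
    \<open>f 1 * cos x + f \<i> * sin x\<close>; these are its coefficients with respect to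
    \<open>cis x\<close> and \<open>cis (- x)\<close>.\<close>
  define a b where "a = (of_real (f 1) - \<i> * of_real (f \<i>)) / 2" and "b = (of_real (f 1) + \<i> * of_real (f \<i>)) / 2"
  have "of_real (f (cis x)) = a * cis x + b * cis (- x)" for x
  proof -
    have "cis x = cos x *\<^sub>R 1 + sin x *\<^sub>R \<i>" by (simp add: complex_eq_iff)
    hence "f (cis x) = cos x * f 1 + sin x * f \<i>" by (simp only: add scaleR) simp
    thus ?thesis by (simp add: a_def b_def complex_eq_iff field_simps)
  qed
  hence "(\<lambda>t. of_real (f (cis (2 * pi * t / P)))) = (\<lambda>t. a * cis (2 * pi * of_int 1 * t / P) + b * cis (2 * pi * of_int (- 1) * t / P))"
    by simp
  thus ?case using trig_poly.add[OF trig_poly.monom[of P a 1] trig_poly.monom[of P b "- 1"]] by (simp only:)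
next
  case (const c)
  thus ?case by (rule trig_poly_const)
next
  case (add f g)
  thus ?case using trig_poly.add[OF add.IH] by simp
next
  case (mult f g)
  thus ?case using trig_poly_mult[OF mult.IH] by simp
qed

text \<open>Stone-Weierstrass on the unit circle. Because \<open>G 0 = G P\<close>, the function
  descends to \<open>\<Gamma>\<close> on the circle; \<open>\<Gamma>\<close> is continuous because
  \<open>E\<close>, a continuous surjection from a compact interval onto the circle, is a quotient
  map.\<close>

lemma trig_poly_approx:
  fixes G :: "real \<Rightarrow> complex"
  assumes P: "P > 0" and c: "continuous_on {0..P} G" and per: "G 0 = G P" and e: "e > 0"
  shows "\<exists>p. trig_poly P p \<and> (\<forall>t\<in>{0..P}. cmod (G t - p t) < e)"
proof -
  define E where "E = (\<lambda>t. cis (2 * pi * t / P))"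
  define \<Gamma> where "\<Gamma> = (\<lambda>z. G (P * Arg2pi z / (2 * pi)))"
  have \<Gamma>E: "\<Gamma> (E t) = G t" if t: "t \<in> {0..P}" for t
  proof (cases "t = P")
    case True
    have "E P = of_real 1" using P by (simp add: E_def complex_eq_iff)
    hence "Arg2pi (E P) = 0" by (simp only: Arg2pi_of_real) simp
    thus ?thesis using True per by (simp add: \<Gamma>_def)
  next
    case False
    have "Arg2pi (E t) = 2 * pi * t / P"
      by (rule Arg2pi_unique[of 1]) (use t False P in \<open>auto simp: E_def cis_conv_exp field_simps\<close>)
    thus ?thesis using P by (simp add: \<Gamma>_def)
  qed
  have Ec: "continuous_on {0..P} E"
  proof -
    have "continuous_on {0..P} (\<lambda>t. cis (2 * pi * t * inverse P))" by (intro continuous_intros)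
    thus ?thesis by (simp add: E_def divide_inverse)
  qed
  have Eim: "E ` {0..P} = sphere 0 1"
  proof
    show "E ` {0..P} \<subseteq> sphere 0 1" by (auto simp: E_def)
    show "sphere 0 1 \<subseteq> E ` {0..P}"
    proof
      fix z :: complex assume z: "z \<in> sphere 0 1"
      have "z = E (P * Arg2pi z / (2 * pi))"
        using Arg2pi_eq[of z] z P by (simp add: E_def cis_conv_exp)
      moreover have "P * Arg2pi z / (2 * pi) \<in> {0..P}"
        using Arg2pi_ge_0[of z] Arg2pi_lt_2pi[of z] P by (auto simp: field_simps)
      ultimately show "z \<in> E ` {0..P}" by blast
    qed
  qed
  have \<Gamma>c: "continuous_on (sphere 0 1) \<Gamma>"
    unfolding continuous_openin_preimage_eq
  proof (intro allI impI)
    fix U :: "complex set" assume U: "open U"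
    have "{0..P} \<inter> E -` (sphere 0 1 \<inter> \<Gamma> -` U) = {0..P} \<inter> G -` U"
      using \<Gamma>E Eim by auto
    moreover have "openin (top_of_set {0..P}) ({0..P} \<inter> G -` U)"
      using c U by (simp add: continuous_openin_preimage_gen)
    ultimately show "openin (top_of_set (sphere 0 1)) (sphere 0 1 \<inter> \<Gamma> -` U)"
      using Abstract_Topology_2.continuous_imp_quotient_map[OF Ec Eim compact_Icc, of "sphere 0 1 \<inter> \<Gamma> -` U"] by auto
  qed
  obtain p where p: "polynomial_function p" "\<And>z. z \<in> sphere 0 1 \<Longrightarrow> cmod (\<Gamma> z - p z) < e"
    using Stone_Weierstrass_polynomial_function[OF compact_sphere \<Gamma>c e] by blast
  have "real_polynomial_function (Re \<circ> p)" "real_polynomial_function (Im \<circ> p)"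
    using p(1) bounded_linear_Re bounded_linear_Im unfolding polynomial_function_def by blast+
  from this[THEN trig_poly_of_real_polynomial[where P = P]]
  have R: "trig_poly P (\<lambda>t. of_real (Re (p (E t))))" and I: "trig_poly P (\<lambda>t. of_real (Im (p (E t))))"
    by (simp_all add: E_def)
  have "trig_poly P (\<lambda>t. of_real (Re (p (E t))) + \<i> * of_real (Im (p (E t))))"
    by (rule trig_poly.add[OF R trig_poly_mult[OF trig_poly_const I]])
  hence "trig_poly P (\<lambda>t. p (E t))" by (simp flip: complex_eq)
  moreover have "cmod (G t - p (E t)) < e" if "t \<in> {0..P}" for t
    using p(2)[of "E t"] \<Gamma>E[OF that] by (simp add: E_def)
  ultimately show ?thesis by blast
qed

section \<open>Square-integrable functions on an interval and density of trigonometric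
  polynomials\<close>

definition L2_on :: "real \<Rightarrow> (real \<Rightarrow> complex) \<Rightarrow> bool" where
  "L2_on P f \<longleftrightarrow> f \<in> borel_measurable (lebesgue_on {0..P}) \<and>
     integrable (lebesgue_on {0..P}) (\<lambda>t. (cmod (f t))\<^sup>2)"

lemma L2_on_mult:
  assumes "L2_on P f" "L2_on P h"
  shows "integrable (lebesgue_on {0..P}) (\<lambda>t. f t * h t)"
proof (rule Bochner_Integration.integrable_bound)
  show "integrable (lebesgue_on {0..P}) (\<lambda>t. (cmod (f t))\<^sup>2 + (cmod (h t))\<^sup>2)"
    using assms by (auto simp: L2_on_def)
  have "cmod (f t) * cmod (h t) \<le> (cmod (f t))\<^sup>2 + (cmod (h t))\<^sup>2" for t
  proof -
    have "2 * (cmod (f t) * cmod (h t)) \<le> (cmod (f t))\<^sup>2 + (cmod (h t))\<^sup>2"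
      using zero_le_power2[of "cmod (f t) - cmod (h t)"] by (simp add: power2_diff mult.assoc)
    moreover have "0 \<le> cmod (f t) * cmod (h t)" by simp
    ultimately show ?thesis by linarith
  qed
  thus "AE t in lebesgue_on {0..P}. norm (f t * h t) \<le> norm ((cmod (f t))\<^sup>2 + (cmod (h t))\<^sup>2)"
    by (auto simp: norm_mult)
qed (use assms in \<open>auto simp: L2_on_def\<close>)

lemma cmod_add_power2_le: "(cmod (a + b))\<^sup>2 \<le> 2 * (cmod a)\<^sup>2 + 2 * (cmod b)\<^sup>2"
proof -
  have "(cmod (a + b))\<^sup>2 \<le> (cmod a + cmod b)\<^sup>2" by (intro power_mono norm_triangle_ineq) auto
  also have "\<dots> \<le> 2 * (cmod a)\<^sup>2 + 2 * (cmod b)\<^sup>2"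
    using zero_le_power2[of "cmod a - cmod b"] by (simp add: power2_diff power2_sum)
  finally show ?thesis .
qed

lemma L2_on_add:
  assumes f: "L2_on P f" and h: "L2_on P h"
  shows "L2_on P (\<lambda>t. f t + h t)"
  unfolding L2_on_def
proof
  show m: "(\<lambda>t. f t + h t) \<in> borel_measurable (lebesgue_on {0..P})" using f h by (auto simp: L2_on_def)
  show "integrable (lebesgue_on {0..P}) (\<lambda>t. (cmod (f t + h t))\<^sup>2)"
  proof (rule Bochner_Integration.integrable_bound)
    show "integrable (lebesgue_on {0..P}) (\<lambda>t. 2 * (cmod (f t))\<^sup>2 + 2 * (cmod (h t))\<^sup>2)"
      using f h by (auto simp: L2_on_def)
  qed (use m cmod_add_power2_le in \<open>auto intro!: borel_measurable_power borel_measurable_norm\<close>)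
qed

lemma L2_on_cmult: "L2_on P f \<Longrightarrow> L2_on P (\<lambda>t. c * f t)"
  unfolding L2_on_def by (auto simp: norm_mult power_mult_distrib)

lemma L2_on_cnj:
  assumes "L2_on P f"
  shows "L2_on P (\<lambda>t. cnj (f t))"
proof -
  have "cnj \<in> borel_measurable borel" by (intro borel_measurable_continuous_onI continuous_intros)
  from measurable_compose[OF _ this, of f] assms show ?thesis by (simp add: L2_on_def)
qed

lemma L2_on_diff: "L2_on P f \<Longrightarrow> L2_on P h \<Longrightarrow> L2_on P (\<lambda>t. f t - h t)"
  using L2_on_add[of P f "\<lambda>t. - 1 * h t"] L2_on_cmult[of P h "- 1"] by simp

lemma L2_on_sum: "finite S \<Longrightarrow> (\<And>i. i \<in> S \<Longrightarrow> L2_on P (f i)) \<Longrightarrow> L2_on P (\<lambda>t. \<Sum>i\<in>S. f i t)"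
proof (induction S rule: finite_induct)
  case empty
  show ?case by (simp add: L2_on_def)
next
  case (insert i S)
  thus ?case using L2_on_add[of P "f i" "\<lambda>t. \<Sum>i\<in>S. f i t"] by simp
qed

lemma L2_on_continuous:
  assumes "continuous_on {0..P} f"
  shows "L2_on P f"
  unfolding L2_on_def
proof
  show "f \<in> borel_measurable (lebesgue_on {0..P})"
    using assms by (intro continuous_imp_measurable_on_sets_lebesgue) auto
  show "integrable (lebesgue_on {0..P}) (\<lambda>t. (cmod (f t))\<^sup>2)"
    using assms by (intro continuous_imp_integrable_real continuous_intros)
qed

lemma L2_on_norm2_add_le:
  assumes f: "L2_on P f" and h: "L2_on P h"
  shows "(LINT t|lebesgue_on {0..P}. (cmod (f t + h t))\<^sup>2) \<le>
    2 * (LINT t|lebesgue_on {0..P}. (cmod (f t))\<^sup>2) + 2 * (LINT t|lebesgue_on {0..P}. (cmod (h t))\<^sup>2)"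
proof -
  have "(LINT t|lebesgue_on {0..P}. (cmod (f t + h t))\<^sup>2) \<le> (LINT t|lebesgue_on {0..P}. 2 * (cmod (f t))\<^sup>2 + 2 * (cmod (h t))\<^sup>2)"
    using L2_on_add[OF f h] f h cmod_add_power2_le by (intro integral_mono) (auto simp: L2_on_def)
  also have "\<dots> = 2 * (LINT t|lebesgue_on {0..P}. (cmod (f t))\<^sup>2) + 2 * (LINT t|lebesgue_on {0..P}. (cmod (h t))\<^sup>2)"
    using f h by (subst Bochner_Integration.integral_add) (auto simp: L2_on_def)
  finally show ?thesis .
qed

text \<open>A Lebesgue measurable function is an almost everywhere limit of continuous ones; a
  common bound lets dominated convergence turn this into convergence in the mean.\<close>

lemma L2_on_bounded_density:
  fixes f :: "real \<Rightarrow> complex"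
  assumes P: "P > 0" and m: "f \<in> borel_measurable (lebesgue_on {0..P})" and B: "\<And>t. cmod (f t) \<le> B" "B > 0"
    and e: "e > 0"
  shows "\<exists>G. continuous_on {0..P} G \<and> G 0 = G P \<and> (LINT t|lebesgue_on {0..P}. (cmod (f t - G t))\<^sup>2) < e"
proof -
  let ?L = "lebesgue_on {0..P}"
  have "{0..P} \<in> sets lebesgue" by (metis cbox_interval lmeasurable_cbox fmeasurableD)
  hence "f measurable_on {0..P}" using m by (simp only: measurable_on_iff_borel_measurable)
  then obtain N g where N: "negligible N" and g: "\<And>n. continuous_on UNIV (g n)"
    and lim: "\<And>x. x \<notin> N \<Longrightarrow> (\<lambda>n. g n x) \<longlonglongrightarrow> (if x \<in> {0..P} then f x else 0)"
    unfolding measurable_on_def by blast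
  \<comment> \<open>truncate \<open>g n\<close> at modulus \<open>B\<close> and cut it off near the end points, so that it becomes periodic\<close>
  define G where "G = (\<lambda>n t. of_real (min 1 (real n * min t (P - t)) * (B / max B (cmod (g n t)))) * g n t)"
  have Gc: "continuous_on {0..P} (G n)" for n
    unfolding G_def using B(2) by (intro continuous_intros continuous_on_subset[OF g]) auto
  have bd: "cmod (G n t) \<le> B" if t: "t \<in> {0..P}" for n t
  proof -
    have "cmod (G n t) = \<bar>min 1 (real n * min t (P - t))\<bar> * (B / max B (cmod (g n t)) * cmod (g n t))"
    proof -
      have "\<bar>B / max B (cmod (g n t))\<bar> = B / max B (cmod (g n t))" using B(2) by simp
      thus ?thesis unfolding G_def norm_mult norm_of_real abs_mult by (simp only: mult.assoc)
    qed
    also have "\<dots> \<le> 1 * B"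
    proof (rule mult_mono)
      show "\<bar>min 1 (real n * min t (P - t))\<bar> \<le> 1" using t by auto
      show "B / max B (cmod (g n t)) * cmod (g n t) \<le> B" using B(2) by (auto simp: field_simps max_def)
    qed (use B(2) in auto)
    finally show ?thesis by simp
  qed
  have Glim: "(\<lambda>n. G n t) \<longlonglongrightarrow> f t" if t: "0 < t" "t < P" "t \<notin> N" for t
  proof -
    have gl: "(\<lambda>n. g n t) \<longlonglongrightarrow> f t" using lim[OF t(3)] t by simp
    have "(\<lambda>n. B / max B (cmod (g n t))) \<longlonglongrightarrow> B / max B (cmod (f t))"
      using B(2) by (intro tendsto_intros gl) auto
    hence l2: "(\<lambda>n. B / max B (cmod (g n t))) \<longlonglongrightarrow> 1" using B by (simp add: max_absorb1)
    define c where "c = min t (P - t)"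
    have c: "c > 0" using t by (simp add: c_def)
    obtain n0 where n0: "1 / c < real n0" using reals_Archimedean2 by blast
    have "eventually (\<lambda>n. min 1 (real n * c) = 1) sequentially"
    proof (rule eventually_sequentiallyI[of n0])
      fix n assume "n0 \<le> n"
      hence "1 / c \<le> real n" using n0 by linarith
      thus "min 1 (real n * c) = 1" using c by (simp add: field_simps)
    qed
    hence l1: "(\<lambda>n. min 1 (real n * c)) \<longlonglongrightarrow> 1" by (rule tendsto_eventually)
    have "(\<lambda>n. G n t) \<longlonglongrightarrow> of_real (1 * 1) * f t"
      unfolding G_def c_def[symmetric] by (intro tendsto_mult tendsto_of_real l1 l2 gl)
    thus ?thesis by simp
  qed
  have ae: "AE t in ?L. 0 < t \<and> t < P \<and> t \<notin> N"
  proof -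
    have "negligible (N \<union> {0, P})" using N by (simp add: negligible_Un)
    hence "N \<union> {0, P} \<in> null_sets lebesgue" by (simp add: negligible_iff_null_sets)
    hence "AE t in lebesgue. t \<notin> N \<union> {0, P}" by (rule AE_not_in)
    hence "AE t in lebesgue. t \<in> {0..P} \<longrightarrow> 0 < t \<and> t < P \<and> t \<notin> N"
      by eventually_elim auto
    thus ?thesis by (subst AE_restrict_space_iff) auto
  qed
  have "(\<lambda>n. LINT t|?L. (cmod (f t - G n t))\<^sup>2) \<longlonglongrightarrow> (LINT t|?L. 0)"
  proof (rule integral_dominated_convergence)
    show "integrable ?L (\<lambda>t. (2 * B)\<^sup>2)" by simp
    show "AE t in ?L. (\<lambda>n. (cmod (f t - G n t))\<^sup>2) \<longlonglongrightarrow> 0"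
      using ae
    proof eventually_elim
      case (elim t)
      have "(\<lambda>n. (cmod (f t - G n t))\<^sup>2) \<longlonglongrightarrow> (cmod (f t - f t))\<^sup>2"
        using elim by (intro tendsto_intros Glim) auto
      thus ?case by simp
    qed
    show "AE t in ?L. norm ((cmod (f t - G n t))\<^sup>2) \<le> (2 * B)\<^sup>2" for n
      using ae
    proof eventually_elim
      case (elim t)
      have "cmod (f t - G n t) \<le> 2 * B"
        using norm_triangle_ineq4[of "f t" "G n t"] B(1)[of t] bd[of t n] elim by auto
      from power_mono[OF this norm_ge_zero, of 2] show ?case by simp
    qed
    have "G n \<in> borel_measurable ?L" for n
      using Gc by (intro continuous_imp_measurable_on_sets_lebesgue) auto
    thus "(\<lambda>t. (cmod (f t - G n t))\<^sup>2) \<in> borel_measurable ?L" for n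
      using m by measurable
  qed simp
  hence "(\<lambda>n. LINT t|?L. (cmod (f t - G n t))\<^sup>2) \<longlonglongrightarrow> 0" by simp
  from order_tendstoD(2)[OF this e]
  obtain n where "(LINT t|?L. (cmod (f t - G n t))\<^sup>2) < e"
    using eventually_happens' sequentially_bot by blast
  moreover have "G n 0 = G n P" using P by (simp add: G_def)
  ultimately show ?thesis using Gc by blast
qed

lemma L2_on_trig_poly_dense:
  assumes P: "P > 0" and f: "L2_on P f" and e: "e > 0"
  shows "\<exists>p. trig_poly P p \<and> (LINT t|lebesgue_on {0..P}. (cmod (f t - p t))\<^sup>2) < e"
proof -
  let ?L = "lebesgue_on {0..P}"
  have m: "f \<in> borel_measurable ?L" using f by (simp add: L2_on_def)
  define F where "F = (\<lambda>n t. if cmod (f t) \<le> real n then f t else 0)"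
  have Fm: "F n \<in> borel_measurable ?L" for n
    unfolding F_def using m by measurable
  have "(\<lambda>n. LINT t|?L. (cmod (f t - F n t))\<^sup>2) \<longlonglongrightarrow> (LINT t|?L. 0)"
  proof (rule integral_dominated_convergence)
    show "integrable ?L (\<lambda>t. (cmod (f t))\<^sup>2)" using f by (simp add: L2_on_def)
    show "AE t in ?L. (\<lambda>n. (cmod (f t - F n t))\<^sup>2) \<longlonglongrightarrow> 0"
    proof (rule AE_I2)
      fix t
      obtain n0 where n0: "cmod (f t) < real n0" using reals_Archimedean2 by blast
      have "eventually (\<lambda>n. (cmod (f t - F n t))\<^sup>2 = 0) sequentially"
        by (rule eventually_sequentiallyI[of n0]) (use n0 in \<open>auto simp: F_def\<close>)
      thus "(\<lambda>n. (cmod (f t - F n t))\<^sup>2) \<longlonglongrightarrow> 0" by (rule tendsto_eventually)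
    qed
    show "AE t in ?L. norm ((cmod (f t - F n t))\<^sup>2) \<le> (cmod (f t))\<^sup>2" for n
      by (auto simp: F_def)
    show "(\<lambda>t. (cmod (f t - F n t))\<^sup>2) \<in> borel_measurable ?L" for n
      using m Fm by measurable
  qed simp
  hence "(\<lambda>n. LINT t|?L. (cmod (f t - F n t))\<^sup>2) \<longlonglongrightarrow> 0" by simp
  \<comment> \<open>The squared triangle inequality doubles the errors twice: \<open>e / 16\<close>
    and \<open>e / 16\<close> combine to \<open>e / 4\<close>, and this with \<open>e / 8\<close>
    gives \<open>3 * e / 4\<close>.\<close>
  moreover have e16: "e / 16 > 0" using e by simp
  ultimately have "\<forall>\<^sub>F n in sequentially. (LINT t|?L. (cmod (f t - F n t))\<^sup>2) < e / 16"
    by (rule order_tendstoD)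
  then obtain n where n: "(LINT t|?L. (cmod (f t - F n t))\<^sup>2) < e / 16"
    using eventually_happens' sequentially_bot by blast
  have "cmod (F n t) \<le> real n + 1" for t by (auto simp: F_def)
  from L2_on_bounded_density[OF P Fm this _ e16]
  obtain G where G: "continuous_on {0..P} G" "G 0 = G P" "(LINT t|?L. (cmod (F n t - G t))\<^sup>2) < e / 16"
    by auto
  \<comment> \<open>The uniform error whose square, integrated over length \<open>P\<close>, is
    \<open>e / 8\<close>.\<close>
  define \<delta> where "\<delta> = sqrt (e / (8 * P))"
  have \<delta>: "\<delta> > 0" "\<delta>\<^sup>2 * P = e / 8" using e P by (auto simp: \<delta>_def)
  obtain p where p: "trig_poly P p" "\<And>t. t \<in> {0..P} \<Longrightarrow> cmod (G t - p t) < \<delta>"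
    using trig_poly_approx[OF P G(1,2) \<delta>(1)] by blast
  have LF: "L2_on P (F n)"
    unfolding L2_on_def
  proof
    show "integrable ?L (\<lambda>t. (cmod (F n t))\<^sup>2)"
    proof (rule Bochner_Integration.integrable_bound)
      show "integrable ?L (\<lambda>t. (cmod (f t))\<^sup>2)" using f by (simp add: L2_on_def)
    qed (use Fm in \<open>auto simp: F_def intro!: borel_measurable_power borel_measurable_norm\<close>)
  qed (rule Fm)
  have LG: "L2_on P G" by (rule L2_on_continuous[OF G(1)])
  have Lp: "L2_on P p" by (rule L2_on_continuous[OF trig_poly_continuous[OF p(1)]])
  have "(LINT t|?L. (cmod (G t - p t))\<^sup>2) \<le> (LINT t|?L. \<delta>\<^sup>2)"
  proof (rule integral_mono)
    show "integrable ?L (\<lambda>t. (cmod (G t - p t))\<^sup>2)" using L2_on_diff[OF LG Lp] by (simp add: L2_on_def)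
    show "(cmod (G t - p t))\<^sup>2 \<le> \<delta>\<^sup>2" if "t \<in> space ?L" for t
      using p(2)[of t] that by (intro power_mono) auto
  qed simp
  also have "\<dots> = \<delta>\<^sup>2 * P" using P by (simp add: measure_restrict_space)
  finally have Gp: "(LINT t|?L. (cmod (G t - p t))\<^sup>2) \<le> e / 8" using \<delta> by simp
  have "(LINT t|?L. (cmod (f t - G t))\<^sup>2) = (LINT t|?L. (cmod ((f t - F n t) + (F n t - G t)))\<^sup>2)" by simp
  also have "\<dots> \<le> 2 * (LINT t|?L. (cmod (f t - F n t))\<^sup>2) + 2 * (LINT t|?L. (cmod (F n t - G t))\<^sup>2)"
    by (intro L2_on_norm2_add_le L2_on_diff f LF LG)
  also have "\<dots> < e / 4" using n G(3) by linarith
  finally have fG: "(LINT t|?L. (cmod (f t - G t))\<^sup>2) < e / 4" .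
  have "(LINT t|?L. (cmod (f t - p t))\<^sup>2) = (LINT t|?L. (cmod ((f t - G t) + (G t - p t)))\<^sup>2)" by simp
  also have "\<dots> \<le> 2 * (LINT t|?L. (cmod (f t - G t))\<^sup>2) + 2 * (LINT t|?L. (cmod (G t - p t))\<^sup>2)"
    by (intro L2_on_norm2_add_le L2_on_diff f LG Lp)
  also have "\<dots> < e" using fG Gp e by linarith
  finally show ?thesis using p(1) by blast
qed

text \<open>Not divided by \<open>P\<close>: in this form it is literally an inner product with a
  modulated element, and Parseval carries the factor \<open>P\<close>.\<close>

definition fourier_coeff :: "real \<Rightarrow> (real \<Rightarrow> complex) \<Rightarrow> int \<Rightarrow> complex" where
  "fourier_coeff P f l = (LINT t|lebesgue_on {0..P}. f t * cis (- (2 * pi * of_int l * t / P)))"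

lemma continuous_on_cis_linear: "continuous_on A (\<lambda>t. cis (2 * pi * c * t / P))"
proof -
  have "continuous_on A (\<lambda>t. cis (2 * pi * c * t * inverse P))" by (intro continuous_intros)
  thus ?thesis by (simp add: divide_inverse)
qed

lemma integral_cis_period:
  assumes P: "P > 0"
  shows "(LINT t|lebesgue_on {0..P}. cis (2 * pi * of_int n * t / P)) = (if n = 0 then of_real P else 0)"
proof (cases "n = 0")
  case True
  thus ?thesis using P by (simp add: measure_restrict_space scaleR_conv_of_real)
next
  case False
  define c where "c = \<i> * of_real (2 * pi * of_int n / P)"
  have c0: "c \<noteq> 0" using False P by (simp add: c_def)
  have ce: "cis (2 * pi * of_int n * t / P) = exp (c * of_real t)" for t
    by (simp add: c_def cis_conv_exp mult_ac)
  have der: "((\<lambda>t. exp (c * of_real t) / c) has_vector_derivative exp (c * of_real t)) (at t within {0..P})" for t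
  proof -
    have "((\<lambda>z. exp (c * z) / c) has_field_derivative exp (c * of_real t)) (at (of_real t))"
      using c0 by (auto intro!: derivative_eq_intros)
    thus ?thesis by (rule has_vector_derivative_real_field)
  qed
  have "((\<lambda>t. exp (c * of_real t)) has_integral (exp (c * of_real P) / c - exp (c * of_real 0) / c)) {0..P}"
    using P der by (intro fundamental_theorem_of_calculus) auto
  moreover have "exp (c * of_real P) = 1"
    using cis_2pi_eq_1_iff[of "of_int n"] ce[of P] P by simp
  ultimately have "integral {0..P} (\<lambda>t. exp (c * of_real t)) = 0"
    by (simp add: integral_unique)
  moreover have "integrable (lebesgue_on {0..P}) (\<lambda>t. exp (c * of_real t))"
    by (intro continuous_imp_integrable_real continuous_intros)
  ultimately show ?thesis
    using False unfolding ce by (simp add: lebesgue_integral_eq_integral)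
qed

text \<open>Completing the square in each coefficient. The same identity gives Bessel's inequality,
  by the choice \<open>a l = fourier_coeff P f l / P\<close>, and the optimality of that
  choice.\<close>

lemma trig_poly_dist:
  assumes P: "P > 0" and f: "L2_on P f" and S: "finite S"
  shows "(LINT t|lebesgue_on {0..P}. (cmod (f t - (\<Sum>l\<in>S. a l * cis (2 * pi * of_int l * t / P))))\<^sup>2) =
    (LINT t|lebesgue_on {0..P}. (cmod (f t))\<^sup>2) - (\<Sum>l\<in>S. (cmod (fourier_coeff P f l))\<^sup>2) / P
      + P * (\<Sum>l\<in>S. (cmod (a l - fourier_coeff P f l / P))\<^sup>2)"
proof -
  let ?L = "lebesgue_on {0..P}"
  let ?e = "\<lambda>l t. cis (2 * pi * of_int l * t / P)"
  let ?c = "fourier_coeff P f"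
  define p where "p = (\<lambda>t. \<Sum>l\<in>S. a l * ?e l t)"
  have Le: "L2_on P (?e l)" for l :: int by (rule L2_on_continuous[OF continuous_on_cis_linear])
  have Lce: "L2_on P (\<lambda>t. cnj (?e l t))" for l :: int
    by (intro L2_on_cnj Le)
  have Lp: "L2_on P p" unfolding p_def by (intro L2_on_sum S L2_on_cmult Le)
  have Lcp: "L2_on P (\<lambda>t. cnj (p t))" by (intro L2_on_cnj Lp)
  have ee: "?e l t * cnj (?e k t) = ?e (l - k) t" for l k t
    by (simp add: cis_cnj cis_mult diff_divide_distrib algebra_simps)
  have fp: "(LINT t|?L. f t * cnj (p t)) = (\<Sum>l\<in>S. cnj (a l) * ?c l)"
  proof -
    have "(LINT t|?L. f t * cnj (p t)) = (LINT t|?L. (\<Sum>l\<in>S. cnj (a l) * (f t * cnj (?e l t))))"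
      by (simp add: p_def cnj_sum sum_distrib_left mult_ac)
    also have "\<dots> = (\<Sum>l\<in>S. LINT t|?L. cnj (a l) * (f t * cnj (?e l t)))"
      by (intro Bochner_Integration.integral_sum integrable_mult_right L2_on_mult f Lce)
    finally show ?thesis by (simp add: fourier_coeff_def cis_cnj)
  qed
  have pp: "(LINT t|?L. p t * cnj (p t)) = (\<Sum>l\<in>S. of_real P * (a l * cnj (a l)))"
  proof -
    have "(LINT t|?L. p t * cnj (p t)) = (LINT t|?L. (\<Sum>l\<in>S. \<Sum>k\<in>S. a l * cnj (a k) * ?e (l - k) t))"
    proof (rule Bochner_Integration.integral_cong[OF refl])
      fix t
      have "p t * cnj (p t) = (\<Sum>l\<in>S. \<Sum>k\<in>S. a l * ?e l t * cnj (a k * ?e k t))"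
        by (simp only: p_def cnj_sum sum_product)
      also have "\<dots> = (\<Sum>l\<in>S. \<Sum>k\<in>S. a l * cnj (a k) * (?e l t * cnj (?e k t)))"
        by (simp only: complex_cnj_mult mult_ac)
      finally show "p t * cnj (p t) = (\<Sum>l\<in>S. \<Sum>k\<in>S. a l * cnj (a k) * ?e (l - k) t)"
        unfolding ee .
    qed
    also have "\<dots> = (\<Sum>l\<in>S. \<Sum>k\<in>S. LINT t|?L. a l * cnj (a k) * ?e (l - k) t)"
    proof -
      have i: "integrable ?L (\<lambda>t. a l * cnj (a k) * ?e (l - k) t)" for l k
        by (intro integrable_mult_right continuous_imp_integrable_real continuous_on_cis_linear)
      show ?thesis
        by (subst Bochner_Integration.integral_sum, intro Bochner_Integration.integrable_sum i,
            rule sum.cong[OF refl], rule Bochner_Integration.integral_sum, rule i)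
    qed
    also have "\<dots> = (\<Sum>l\<in>S. \<Sum>k\<in>S. if k = l then of_real P * (a l * cnj (a l)) else 0)"
      by (intro sum.cong refl) (auto simp: integral_cis_period[OF P] simp del: of_int_diff)
    also have "\<dots> = (\<Sum>l\<in>S. of_real P * (a l * cnj (a l)))" using S by simp
    finally show ?thesis .
  qed
  have pp': "(LINT t|?L. (cmod (p t))\<^sup>2) = (\<Sum>l\<in>S. P * (cmod (a l))\<^sup>2)"
  proof -
    have "complex_of_real (LINT t|?L. (cmod (p t))\<^sup>2) = (LINT t|?L. p t * cnj (p t))"
      unfolding integral_complex_of_real[symmetric] by (simp only: complex_norm_square)
    also have "\<dots> = of_real (\<Sum>l\<in>S. P * (cmod (a l))\<^sup>2)"
      unfolding pp by (simp only: of_real_sum of_real_mult complex_norm_square)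
    finally show ?thesis by (simp only: of_real_eq_iff)
  qed
  have sq: "(cmod (x - y))\<^sup>2 = (cmod x)\<^sup>2 - 2 * Re (x * cnj y) + (cmod y)\<^sup>2" for x y
    unfolding cmod_power2 by (simp add: power2_eq_square algebra_simps)
  have ifp: "integrable ?L (\<lambda>t. f t * cnj (p t))" by (rule L2_on_mult[OF f Lcp])
  have "(LINT t|?L. (cmod (f t - p t))\<^sup>2) = (LINT t|?L. (cmod (f t))\<^sup>2 - 2 * Re (f t * cnj (p t)) + (cmod (p t))\<^sup>2)"
    by (simp only: sq)
  also have "\<dots> = (LINT t|?L. (cmod (f t))\<^sup>2 - 2 * Re (f t * cnj (p t))) + (LINT t|?L. (cmod (p t))\<^sup>2)"
    using f Lp ifp by (intro Bochner_Integration.integral_add) (auto simp: L2_on_def simp del: complex_mult_cnj times_complex.sel)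
  also have "(LINT t|?L. (cmod (f t))\<^sup>2 - 2 * Re (f t * cnj (p t))) =
      (LINT t|?L. (cmod (f t))\<^sup>2) - (LINT t|?L. 2 * Re (f t * cnj (p t)))"
    using f ifp by (intro Bochner_Integration.integral_diff) (auto simp: L2_on_def simp del: complex_mult_cnj times_complex.sel)
  also have "(LINT t|?L. 2 * Re (f t * cnj (p t))) = 2 * Re (LINT t|?L. f t * cnj (p t))"
    using ifp by (simp del: times_complex.sel)
  also have "\<dots> = (\<Sum>l\<in>S. 2 * Re (cnj (a l) * ?c l))"
    unfolding fp Re_sum sum_distrib_left ..
  finally have "(LINT t|?L. (cmod (f t - p t))\<^sup>2) = (LINT t|?L. (cmod (f t))\<^sup>2) -
      (\<Sum>l\<in>S. 2 * Re (cnj (a l) * ?c l)) + (\<Sum>l\<in>S. P * (cmod (a l))\<^sup>2)"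
    unfolding pp' .
  also have "\<dots> = (LINT t|?L. (cmod (f t))\<^sup>2) + (\<Sum>l\<in>S. P * (cmod (a l))\<^sup>2 - 2 * Re (cnj (a l) * ?c l))"
    by (simp add: sum_subtractf del: times_complex.sel)
  also have "(\<Sum>l\<in>S. P * (cmod (a l))\<^sup>2 - 2 * Re (cnj (a l) * ?c l)) =
      (\<Sum>l\<in>S. P * (cmod (a l - ?c l / P))\<^sup>2 - (cmod (?c l))\<^sup>2 / P)"
  proof (rule sum.cong[OF refl])
    fix l
    have "P * (cmod (a l - ?c l / P))\<^sup>2 = P * (cmod (a l))\<^sup>2 - P * (2 * Re (a l * cnj (?c l / P))) + P * (cmod (?c l / P))\<^sup>2"
      unfolding sq by (simp only: distrib_left right_diff_distrib)
    moreover have "P * (2 * Re (a l * cnj (?c l / P))) = 2 * Re (cnj (a l) * ?c l)"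
      using P by (simp add: field_simps)
    moreover have "P * (cmod (?c l / P))\<^sup>2 = (cmod (?c l))\<^sup>2 / P"
      using P by (simp add: norm_divide power_divide power2_eq_square)
    ultimately show "P * (cmod (a l))\<^sup>2 - 2 * Re (cnj (a l) * ?c l) = P * (cmod (a l - ?c l / P))\<^sup>2 - (cmod (?c l))\<^sup>2 / P"
      by linarith
  qed
  also have "\<dots> = P * (\<Sum>l\<in>S. (cmod (a l - ?c l / P))\<^sup>2) - (\<Sum>l\<in>S. (cmod (?c l))\<^sup>2) / P"
    by (simp add: sum_subtractf sum_distrib_left sum_divide_distrib)
  finally show ?thesis by (simp add: p_def)
qed

text \<open>Bessel bounds all finite sums from above. A close trigonometric polynomial with
  frequencies in \<open>S\<close> bounds the sum over \<open>S\<close> from below, and larger sets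
  only increase it.\<close>

theorem parseval:
  assumes P: "P > 0" and f: "L2_on P f"
  shows "((\<lambda>l. (cmod (fourier_coeff P f l))\<^sup>2) has_sum (P * (LINT t|lebesgue_on {0..P}. (cmod (f t))\<^sup>2))) UNIV"
proof -
  let ?L = "lebesgue_on {0..P}"
  let ?c = "fourier_coeff P f"
  define I where "I = (LINT t|?L. (cmod (f t))\<^sup>2)"
  have bessel: "(\<Sum>l\<in>S. (cmod (?c l))\<^sup>2) \<le> P * I" if "finite S" for S
  proof -
    have "0 \<le> (LINT t|?L. (cmod (f t - (\<Sum>l\<in>S. (?c l / P) * cis (2 * pi * of_int l * t / P))))\<^sup>2)" by simp
    also have "\<dots> = I - (\<Sum>l\<in>S. (cmod (?c l))\<^sup>2) / P"
      unfolding trig_poly_dist[OF P f that] I_def by simp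
    finally show ?thesis using P by (simp add: field_simps)
  qed
  show ?thesis
    unfolding I_def[symmetric] has_sum_def
  proof (rule tendstoI)
    fix e :: real assume e: "e > 0"
    obtain p where p: "trig_poly P p" "(LINT t|?L. (cmod (f t - p t))\<^sup>2) < e / P"
      using L2_on_trig_poly_dense[OF P f, of "e / P"] e P by auto
    obtain S a where S: "finite S" "p = (\<lambda>t. \<Sum>l\<in>S. a l * cis (2 * pi * of_int l * t / P))"
      using trig_poly_sum_rep[OF p(1)] by blast
    have "I - (\<Sum>l\<in>S. (cmod (?c l))\<^sup>2) / P \<le> (LINT t|?L. (cmod (f t - p t))\<^sup>2)"
      unfolding S(2) trig_poly_dist[OF P f S(1)] I_def using P by (simp add: sum_nonneg)
    hence lt: "P * I - (\<Sum>l\<in>S. (cmod (?c l))\<^sup>2) < e" using p(2) P by (simp add: field_simps)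
    show "\<forall>\<^sub>F Y in finite_subsets_at_top UNIV. dist (\<Sum>l\<in>Y. (cmod (?c l))\<^sup>2) (P * I) < e"
      unfolding eventually_finite_subsets_at_top
    proof (intro exI[of _ S] conjI allI impI)
      fix Y assume Y: "finite Y \<and> S \<subseteq> Y \<and> Y \<subseteq> UNIV"
      have "(\<Sum>l\<in>S. (cmod (?c l))\<^sup>2) \<le> (\<Sum>l\<in>Y. (cmod (?c l))\<^sup>2)"
        using Y by (intro sum_mono2) auto
      thus "dist (\<Sum>l\<in>Y. (cmod (?c l))\<^sup>2) (P * I) < e"
        using lt bessel[of Y] Y by (simp add: dist_real_def)
    qed (use S in auto)
  qed
qed

section \<open>Correlations on l2(Z)\<close>

text \<open>Cauchy-Schwarz for \<open>sqrt (w j)\<close> and \<open>sqrt (w j) * x j\<close>, first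
  on finite sets.\<close>

lemma weighted_Cauchy_Schwarz_infsum:
  fixes w x :: "'a \<Rightarrow> real"
  assumes w: "w summable_on S" "\<And>j. w j \<ge> 0" and wx: "(\<lambda>j. w j * (x j)\<^sup>2) summable_on S" and x: "\<And>j. x j \<ge> 0"
  shows "(\<lambda>j. w j * x j) summable_on S"
    and "(\<Sum>\<^sub>\<infinity>j\<in>S. w j * x j)\<^sup>2 \<le> infsum w S * (\<Sum>\<^sub>\<infinity>j\<in>S. w j * (x j)\<^sup>2)"
proof -
  define A where "A = infsum w S"
  define B where "B = (\<Sum>\<^sub>\<infinity>j\<in>S. w j * (x j)\<^sup>2)"
  have AB: "A \<ge> 0" "B \<ge> 0" unfolding A_def B_def using w(2) by (auto intro!: infsum_nonneg)
  have fin: "(\<Sum>j\<in>F. w j * x j) \<le> sqrt (A * B)" if F: "finite F" "F \<subseteq> S" for F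
  proof -
    have "(\<Sum>j\<in>F. w j * x j) = (\<Sum>j\<in>F. sqrt (w j) * (sqrt (w j) * x j))"
      using w(2) by (simp flip: mult.assoc)
    hence "(\<Sum>j\<in>F. w j * x j)\<^sup>2 \<le> (\<Sum>j\<in>F. (sqrt (w j))\<^sup>2) * (\<Sum>j\<in>F. (sqrt (w j) * x j)\<^sup>2)"
      using Cauchy_Schwarz_ineq_sum[of "\<lambda>j. sqrt (w j)" "\<lambda>j. sqrt (w j) * x j" F] by simp
    also have "\<dots> = (\<Sum>j\<in>F. w j) * (\<Sum>j\<in>F. w j * (x j)\<^sup>2)"
      using w(2) by (simp add: power_mult_distrib)
    also have "\<dots> \<le> A * B"
    proof (rule mult_mono)
      show "(\<Sum>j\<in>F. w j) \<le> A" unfolding A_def using w F by (intro finite_sum_le_infsum) auto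
      show "(\<Sum>j\<in>F. w j * (x j)\<^sup>2) \<le> B" unfolding B_def using w wx F by (intro finite_sum_le_infsum) auto
    qed (use w AB in \<open>auto intro: sum_nonneg\<close>)
    finally show ?thesis by (rule real_le_rsqrt)
  qed
  show s: "(\<lambda>j. w j * x j) summable_on S"
    by (rule nonneg_bdd_above_summable_on) (use w x fin in \<open>auto intro!: bdd_aboveI2\<close>)
  have "(\<Sum>\<^sub>\<infinity>j\<in>S. w j * x j) \<le> sqrt (A * B)"
    using infsum_le_finite_sums[OF s fin] .
  hence "(\<Sum>\<^sub>\<infinity>j\<in>S. w j * x j)\<^sup>2 \<le> (sqrt (A * B))\<^sup>2"
    using w x by (intro power_mono infsum_nonneg) auto
  thus "(\<Sum>\<^sub>\<infinity>j\<in>S. w j * x j)\<^sup>2 \<le> infsum w S * (\<Sum>\<^sub>\<infinity>j\<in>S. w j * (x j)\<^sup>2)"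
    using AB by (simp add: A_def B_def)
qed

text \<open>A correlation, because \<open>k\<close> is the translation index of a Gabor element and
  \<open>j\<close> the variable of summation.\<close>

definition corr_Z :: "(int \<Rightarrow> complex) \<Rightarrow> (int \<Rightarrow> complex) \<Rightarrow> int \<Rightarrow> complex" where
  "corr_Z a f k = (\<Sum>\<^sub>\<infinity>j. f j * a (j - k))"

lemma summable_on_int_reflect: "(\<lambda>k::int. F (j - k)) summable_on UNIV \<longleftrightarrow> F summable_on UNIV"
  by (rule summable_on_reindex_bij_witness[of _ "\<lambda>k. j - k" "\<lambda>k. j - k"]) auto

lemma summable_on_int_translate: "(\<lambda>j::int. F (j - k)) summable_on UNIV \<longleftrightarrow> F summable_on UNIV"
  by (rule summable_on_reindex_bij_witness[of _ "\<lambda>j. j + k" "\<lambda>j. j - k"]) auto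

lemma infsum_int_reflect: "(\<Sum>\<^sub>\<infinity>k::int. F (j - k)) = infsum F UNIV"
  by (rule infsum_reindex_bij_witness[of _ "\<lambda>k. j - k" "\<lambda>k. j - k"]) auto

lemma infsum_int_translate: "(\<Sum>\<^sub>\<infinity>j::int. F (j - k)) = infsum F UNIV"
  by (rule infsum_reindex_bij_witness[of _ "\<lambda>j. j + k" "\<lambda>j. j - k"]) auto

text \<open>Young's inequality by Schur's argument: Cauchy-Schwarz with weights
  \<open>cmod (a (j - k))\<close> bounds each entry, and both the sum over \<open>j\<close> and the
  sum over \<open>k\<close> of the weights equal \<open>A\<close>, whence \<open>A\<close>
  squared.\<close>

lemma corr_Z_upper:
  assumes a: "(\<lambda>i. cmod (a i)) summable_on UNIV" and f: "l2Z f"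
  defines "A \<equiv> (\<Sum>\<^sub>\<infinity>i. cmod (a i))"
  shows "(\<lambda>j. cmod (f j * a (j - k))) summable_on UNIV"
    and "(\<lambda>k. (cmod (corr_Z a f k))\<^sup>2) summable_on UNIV"
    and "(\<Sum>\<^sub>\<infinity>k. (cmod (corr_Z a f k))\<^sup>2) \<le> A\<^sup>2 * (\<Sum>\<^sub>\<infinity>j. (cmod (f j))\<^sup>2)"
proof -
  have f2: "(\<lambda>j. (cmod (f j))\<^sup>2) summable_on UNIV" using f by (simp add: l2Z_def)
  define W where "W = (\<lambda>j k. cmod (a (j - k)) * (cmod (f j))\<^sup>2)"
  have A0: "A \<ge> 0" unfolding A_def by (intro infsum_nonneg) auto
  have rowsum: "((\<lambda>k. W j k) has_sum (A * (cmod (f j))\<^sup>2)) UNIV" for j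
  proof -
    have "((\<lambda>k. cmod (a (j - k))) has_sum A) UNIV"
      unfolding A_def using a summable_on_int_reflect[of "\<lambda>i. cmod (a i)" j] infsum_int_reflect[of "\<lambda>i. cmod (a i)" j]
      by (metis has_sum_infsum)
    thus ?thesis unfolding W_def by (rule has_sum_cmult_left)
  qed
  have rows: "(\<lambda>j. A * (cmod (f j))\<^sup>2) summable_on UNIV" using f2 by (rule summable_on_cmult_right)
  have Wsum: "(\<lambda>(j, k). W j k) summable_on UNIV \<times> UNIV"
    by (rule summable_on_SigmaI[where g = "\<lambda>j. A * (cmod (f j))\<^sup>2"]) (use rowsum rows in \<open>auto simp: W_def\<close>)
  have Wsum': "(\<lambda>(k, j). W j k) summable_on UNIV \<times> UNIV"
    using Wsum summable_on_swap[of "\<lambda>(j, k). W j k" UNIV UNIV] by (simp add: case_prod_unfold)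
  have Wk: "(\<lambda>j. W j k) summable_on UNIV" for k
    using summable_on_SigmaD1[OF Wsum', of k] by simp
  have ak: "(\<lambda>j. cmod (a (j - k))) summable_on UNIV" for k
    using a summable_on_int_translate[of "\<lambda>i. cmod (a i)" k] by simp
  have cs1: "(\<lambda>j. cmod (a (j - k)) * cmod (f j)) summable_on UNIV" for k
    using weighted_Cauchy_Schwarz_infsum(1)[OF ak[of k] _ Wk[of k, unfolded W_def]] by simp
  have cs2: "(\<Sum>\<^sub>\<infinity>j. cmod (a (j - k)) * cmod (f j))\<^sup>2 \<le> A * (\<Sum>\<^sub>\<infinity>j. W j k)" for k
    using weighted_Cauchy_Schwarz_infsum(2)[OF ak[of k] _ Wk[of k, unfolded W_def]]
    unfolding W_def A_def infsum_int_translate[of "\<lambda>i. cmod (a i)" k] by simp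
  show abs: "(\<lambda>j. cmod (f j * a (j - k))) summable_on UNIV" for k
    using cs1[of k] by (simp add: norm_mult mult.commute)
  have le: "(cmod (corr_Z a f k))\<^sup>2 \<le> A * (\<Sum>\<^sub>\<infinity>j. W j k)" for k
  proof -
    have "cmod (corr_Z a f k) \<le> (\<Sum>\<^sub>\<infinity>j. cmod (a (j - k)) * cmod (f j))"
      using norm_infsum_bound[OF abs[of k]] by (simp add: corr_Z_def norm_mult mult.commute)
    hence "(cmod (corr_Z a f k))\<^sup>2 \<le> (\<Sum>\<^sub>\<infinity>j. cmod (a (j - k)) * cmod (f j))\<^sup>2"
      by (intro power_mono) auto
    thus ?thesis using cs2[of k] by linarith
  qed
  have cols: "(\<lambda>k. \<Sum>\<^sub>\<infinity>j. W j k) summable_on UNIV"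
    using summable_on_Sigma_banach[OF Wsum'] by simp
  hence cols': "(\<lambda>k. A * (\<Sum>\<^sub>\<infinity>j. W j k)) summable_on UNIV" by (rule summable_on_cmult_right)
  show s: "(\<lambda>k. (cmod (corr_Z a f k))\<^sup>2) summable_on UNIV"
    by (rule summable_on_comparison_test[OF cols' le]) auto
  have "(\<Sum>\<^sub>\<infinity>k. (cmod (corr_Z a f k))\<^sup>2) \<le> (\<Sum>\<^sub>\<infinity>k. A * (\<Sum>\<^sub>\<infinity>j. W j k))"
    by (rule infsum_mono[OF s cols' le])
  also have "\<dots> = A * (\<Sum>\<^sub>\<infinity>k. \<Sum>\<^sub>\<infinity>j. W j k)" by (rule infsum_cmult_right')
  also have "(\<Sum>\<^sub>\<infinity>k. \<Sum>\<^sub>\<infinity>j. W j k) = (\<Sum>\<^sub>\<infinity>j. \<Sum>\<^sub>\<infinity>k. W j k)"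
    by (rule infsum_swap_banach[OF Wsum'])
  also have "\<dots> = (\<Sum>\<^sub>\<infinity>j. A * (cmod (f j))\<^sup>2)" using infsumI[OF rowsum] by simp
  also have "\<dots> = A * (\<Sum>\<^sub>\<infinity>j. (cmod (f j))\<^sup>2)" by (rule infsum_cmult_right')
  finally show "(\<Sum>\<^sub>\<infinity>k. (cmod (corr_Z a f k))\<^sup>2) \<le> A\<^sup>2 * (\<Sum>\<^sub>\<infinity>j. (cmod (f j))\<^sup>2)"
    by (simp add: power2_eq_square mult.assoc)
qed

section \<open>Absolutely convergent Fourier series and lower bounds for correlations\<close>

definition fourier_series :: "(int \<Rightarrow> complex) \<Rightarrow> real \<Rightarrow> complex" where
  "fourier_series b \<theta> = (\<Sum>\<^sub>\<infinity>k. b k * cis (of_int k * \<theta>))"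

lemma fourier_series_has_sum:
  assumes b: "(\<lambda>k. cmod (b k)) summable_on UNIV"
  shows "((\<lambda>k. b k * cis (of_int k * \<theta>)) has_sum fourier_series b \<theta>) UNIV"
proof -
  have "(\<lambda>k. cmod (b k * cis (of_int k * \<theta>))) summable_on UNIV" using b by (simp add: norm_mult)
  from has_sum_infsum[OF abs_summable_summable[OF this]] show ?thesis by (simp add: fourier_series_def)
qed

lemma fourier_series_uniform_limit:
  assumes b: "(\<lambda>k. cmod (b k)) summable_on UNIV"
  shows "uniform_limit X (\<lambda>S \<theta>. \<Sum>k\<in>S. b k * cis (of_int k * \<theta>)) (fourier_series b) (finite_subsets_at_top UNIV)"
  unfolding fourier_series_def by (rule Weierstrass_m_test_general[OF _ b]) (simp add: norm_mult)

lemma fourier_series_continuous: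
  assumes b: "(\<lambda>k. cmod (b k)) summable_on UNIV"
  shows "continuous_on X (fourier_series b)"
  by (rule uniform_limit_theorem[OF _ fourier_series_uniform_limit[OF b]])
     (auto intro!: always_eventually continuous_intros)

text \<open>Uniform convergence permits termwise integration, so the coefficients of the sum are the
  given \<open>b\<close>, and Parseval on \<open>{0..1}\<close> applies.\<close>

lemma parseval_fourier_series:
  assumes b: "(\<lambda>k. cmod (b k)) summable_on UNIV"
  shows "((\<lambda>k. (cmod (b k))\<^sup>2) has_sum (LINT t|lebesgue_on {0..1}. (cmod (fourier_series b (2 * pi * t)))\<^sup>2)) UNIV"
proof -
  define f where "f = (\<lambda>t. fourier_series b (2 * pi * t))"
  have fc: "continuous_on A f" for A
    unfolding f_def by (rule continuous_on_compose2[OF fourier_series_continuous[OF b, of UNIV]]) (auto intro!: continuous_intros)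
  have "fourier_coeff 1 f l = b l" for l
  proof -
    define g where "g = (\<lambda>t. f t * cis (- (2 * pi * of_int l * t)))"
    define G where "G = (\<lambda>S t. (\<Sum>k\<in>S. b k * cis (2 * pi * of_int (k - l) * t)))"
    let ?F = "finite_subsets_at_top (UNIV :: int set)"
    have gsum: "(\<Sum>\<^sub>\<infinity>k. b k * cis (2 * pi * of_int (k - l) * t)) = g t" for t
    proof -
      have "((\<lambda>k. b k * cis (of_int k * (2 * pi * t)) * cis (- (2 * pi * of_int l * t))) has_sum g t) UNIV"
        unfolding g_def f_def by (intro has_sum_cmult_left fourier_series_has_sum b)
      moreover have "b k * cis (of_int k * (2 * pi * t)) * cis (- (2 * pi * of_int l * t)) = b k * cis (2 * pi * of_int (k - l) * t)" for k
      proof -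
        have "cis (of_int k * (2 * pi * t)) * cis (- (2 * pi * of_int l * t)) = cis (2 * pi * of_int (k - l) * t)"
          unfolding cis_mult by (simp add: algebra_simps)
        thus ?thesis by (simp only: mult.assoc)
      qed
      ultimately show ?thesis by (simp only: infsumI)
    qed
    have ul: "uniform_limit {0..1} G g ?F"
    proof -
      have "uniform_limit {0..1} G (\<lambda>t. \<Sum>\<^sub>\<infinity>k. b k * cis (2 * pi * of_int (k - l) * t)) ?F"
        unfolding G_def by (rule Weierstrass_m_test_general[OF _ b]) (simp add: norm_mult)
      thus ?thesis unfolding gsum .
    qed
    have Gc: "continuous_on {0..1} (G S)" for S
      unfolding G_def by (intro continuous_intros)
    obtain I J where I: "\<And>S. (G S has_integral I S) {0..1}" and J: "(g has_integral J) {0..1}" and IJ: "(I \<longlongrightarrow> J) ?F"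
      using uniform_limit_integral[OF ul Gc finite_subsets_at_top_neq_bot] by blast
    have IS: "I S = (if l \<in> S then b l else 0)" if S: "finite S" for S
    proof -
      have "I S = (LINT t|lebesgue_on {0..1}. G S t)"
        using I[of S] Gc[of S] by (subst lebesgue_integral_eq_integral) (auto intro: continuous_imp_integrable_real simp: integral_unique)
      also have "\<dots> = (\<Sum>k\<in>S. LINT t|lebesgue_on {0..1}. b k * cis (2 * pi * of_int (k - l) * t))"
        unfolding G_def by (intro Bochner_Integration.integral_sum continuous_imp_integrable_real continuous_intros)
      also have "\<dots> = (\<Sum>k\<in>S. if k = l then b l else 0)"
      proof (rule sum.cong[OF refl])
        fix k
        show "(LINT t|lebesgue_on {0..1}. b k * cis (2 * pi * of_int (k - l) * t)) = (if k = l then b l else 0)"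
          using integral_cis_period[of 1 "k - l"] by (simp del: of_int_diff)
      qed
      finally show ?thesis using S by simp
    qed
    have "eventually (\<lambda>S. I S = b l) ?F"
      unfolding eventually_finite_subsets_at_top by (intro exI[of _ "{l}"]) (auto simp: IS)
    hence "(I \<longlongrightarrow> b l) ?F" by (rule tendsto_eventually)
    hence "J = b l" using IJ tendsto_unique[OF finite_subsets_at_top_neq_bot] by blast
    moreover have "integrable (lebesgue_on {0..1}) g"
      unfolding g_def by (intro continuous_imp_integrable_real continuous_intros fc)
    ultimately have "(LINT t|lebesgue_on {0..1}. g t) = b l"
      using J by (subst lebesgue_integral_eq_integral) (auto simp: integral_unique)
    thus ?thesis by (simp add: fourier_coeff_def g_def)
  qed
  moreover have "L2_on 1 f" by (rule L2_on_continuous[OF fc])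
  ultimately show ?thesis
    using parseval[of 1 f] by (simp add: f_def)
qed

lemma has_sum_finite_sum:
  fixes f :: "'a \<Rightarrow> 'b \<Rightarrow> 'c::topological_comm_monoid_add"
  assumes "finite F" "\<And>j. j \<in> F \<Longrightarrow> (f j has_sum s j) A"
  shows "((\<lambda>k. \<Sum>j\<in>F. f j k) has_sum (\<Sum>j\<in>F. s j)) A"
  using assms
proof (induction F rule: finite_induct)
  case (insert j F)
  thus ?case using has_sum_add[of "f j" A "s j" "\<lambda>k. \<Sum>j\<in>F. f j k" "\<Sum>j\<in>F. s j"] by simp
qed (simp add: has_sum_0)

text \<open>Finite support makes the correlation absolutely summable, so its Fourier series
  converges and factors into those of \<open>f\<close> and \<open>a\<close>, the latter at
  \<open>- \<theta>\<close> since \<open>k = j - i\<close>. The bound \<open>c\<close> then acts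
  pointwise under the integral.\<close>

lemma corr_Z_lower_finite:
  assumes a: "(\<lambda>i. cmod (a i)) summable_on UNIV" and F: "finite F" "\<And>j. j \<notin> F \<Longrightarrow> f j = 0"
    and c: "\<And>\<theta>. c \<le> (cmod (fourier_series a \<theta>))\<^sup>2"
  shows "c * (\<Sum>j\<in>F. (cmod (f j))\<^sup>2) \<le> (\<Sum>\<^sub>\<infinity>k. (cmod (corr_Z a f k))\<^sup>2)"
proof -
  have T: "corr_Z a f k = (\<Sum>j\<in>F. f j * a (j - k))" for k
    unfolding corr_Z_def by (subst infsum_cong_neutral[where T = F and g = "\<lambda>j. f j * a (j - k)"]) (use F in auto)
  have ref: "(\<lambda>k. cmod (a (j - k))) summable_on UNIV" for j
    using a summable_on_int_reflect[of "\<lambda>i. cmod (a i)" j] by simp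
  have "((\<lambda>k. \<Sum>j\<in>F. cmod (f j) * cmod (a (j - k))) has_sum (\<Sum>j\<in>F. \<Sum>\<^sub>\<infinity>k. cmod (f j) * cmod (a (j - k)))) UNIV"
    by (intro has_sum_finite_sum F(1) has_sum_infsum summable_on_cmult_right ref)
  hence "(\<lambda>k. \<Sum>j\<in>F. cmod (f j) * cmod (a (j - k))) summable_on UNIV"
    by (rule has_sum_imp_summable)
  hence Tabs: "(\<lambda>k. cmod (corr_Z a f k)) summable_on UNIV"
    by (rule summable_on_comparison_test) (auto simp: T norm_mult intro!: order_trans[OF norm_sum])
  have fabs: "(\<lambda>j. cmod (f j)) summable_on UNIV"
    using summable_on_cong_neutral[of UNIV F "\<lambda>j. cmod (f j)" "\<lambda>j. cmod (f j)"] F by auto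
  have ff: "fourier_series f \<theta> = (\<Sum>j\<in>F. f j * cis (of_int j * \<theta>))" for \<theta>
    unfolding fourier_series_def
    by (subst infsum_cong_neutral[where T = F and g = "\<lambda>j. f j * cis (of_int j * \<theta>)"]) (use F in auto)
  have mult: "fourier_series (corr_Z a f) \<theta> = fourier_series f \<theta> * fourier_series a (- \<theta>)" for \<theta>
  proof -
    have "((\<lambda>k. a (j - k) * cis (of_int k * \<theta>)) has_sum (cis (of_int j * \<theta>) * fourier_series a (- \<theta>))) UNIV" for j
    proof -
      have "((\<lambda>i. cis (of_int j * \<theta>) * (a i * cis (of_int i * (- \<theta>)))) has_sum (cis (of_int j * \<theta>) * fourier_series a (- \<theta>))) UNIV"
        by (intro has_sum_cmult_right fourier_series_has_sum a)
      also have "?this \<longleftrightarrow> ?thesis"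
      proof (rule has_sum_reindex_bij_witness[of _ "\<lambda>k. j - k" "\<lambda>k. j - k"])
        fix i :: int
        have "cis (of_int (j - i) * \<theta>) = cis (of_int j * \<theta>) * cis (of_int i * (- \<theta>))"
          unfolding cis_mult by (simp add: algebra_simps)
        thus "a (j - (j - i)) * cis (of_int (j - i) * \<theta>) = cis (of_int j * \<theta>) * (a i * cis (of_int i * (- \<theta>)))"
          by simp
      qed auto
      finally show ?thesis .
    qed
    hence "((\<lambda>k. \<Sum>j\<in>F. f j * (a (j - k) * cis (of_int k * \<theta>))) has_sum
        (\<Sum>j\<in>F. f j * (cis (of_int j * \<theta>) * fourier_series a (- \<theta>)))) UNIV"
      by (intro has_sum_finite_sum F(1) has_sum_cmult_right)
    moreover have "(\<Sum>j\<in>F. f j * (a (j - k) * cis (of_int k * \<theta>))) = corr_Z a f k * cis (of_int k * \<theta>)" for k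
      by (simp add: T sum_distrib_right mult.assoc)
    moreover have "(\<Sum>j\<in>F. f j * (cis (of_int j * \<theta>) * fourier_series a (- \<theta>))) = fourier_series f \<theta> * fourier_series a (- \<theta>)"
      by (simp add: ff sum_distrib_right mult.assoc)
    ultimately show ?thesis unfolding fourier_series_def[of "corr_Z a f"] by (simp only: infsumI)
  qed
  have cont: "continuous_on {0..1} (\<lambda>t. fourier_series b (2 * pi * t))" if "(\<lambda>k. cmod (b k)) summable_on UNIV" for b
    by (rule continuous_on_compose2[OF fourier_series_continuous[OF that, of UNIV]]) (auto intro!: continuous_intros)
  have "(\<Sum>j\<in>F. (cmod (f j))\<^sup>2) = (\<Sum>\<^sub>\<infinity>j. (cmod (f j))\<^sup>2)"
    by (subst infsum_cong_neutral[where T = F and g = "\<lambda>j. (cmod (f j))\<^sup>2"]) (use F in auto)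
  also have "\<dots> = (LINT t|lebesgue_on {0..1}. (cmod (fourier_series f (2 * pi * t)))\<^sup>2)"
    by (rule infsumI[OF parseval_fourier_series[OF fabs]])
  finally have "c * (\<Sum>j\<in>F. (cmod (f j))\<^sup>2) = (LINT t|lebesgue_on {0..1}. c * (cmod (fourier_series f (2 * pi * t)))\<^sup>2)"
    by simp
  also have "\<dots> \<le> (LINT t|lebesgue_on {0..1}. (cmod (fourier_series (corr_Z a f) (2 * pi * t)))\<^sup>2)"
  proof (rule integral_mono)
    show "integrable (lebesgue_on {0..1}) (\<lambda>t. c * (cmod (fourier_series f (2 * pi * t)))\<^sup>2)"
      by (intro continuous_imp_integrable_real continuous_intros cont fabs)
    show "integrable (lebesgue_on {0..1}) (\<lambda>t. (cmod (fourier_series (corr_Z a f) (2 * pi * t)))\<^sup>2)"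
      by (intro continuous_imp_integrable_real continuous_intros cont Tabs)
    show "c * (cmod (fourier_series f (2 * pi * t)))\<^sup>2 \<le> (cmod (fourier_series (corr_Z a f) (2 * pi * t)))\<^sup>2" for t
      unfolding mult norm_mult power_mult_distrib
      using mult_right_mono[OF c[of "- (2 * pi * t)"] zero_le_power2] by (simp add: mult.commute)
  qed
  also have "\<dots> = (\<Sum>\<^sub>\<infinity>k. (cmod (corr_Z a f k))\<^sup>2)"
    by (rule infsumI[OF parseval_fourier_series[OF Tabs], symmetric])
  finally show ?thesis .
qed

lemma l2Z_diff:
  assumes "l2Z f" "l2Z g"
  shows "l2Z (\<lambda>j. f j - g j)"
  unfolding l2Z_def
proof (rule summable_on_comparison_test)
  show "(\<lambda>j. 2 * (cmod (f j))\<^sup>2 + 2 * (cmod (g j))\<^sup>2) summable_on UNIV"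
    using assms unfolding l2Z_def by (intro summable_on_add summable_on_cmult_right)
  show "(cmod (f j - g j))\<^sup>2 \<le> 2 * (cmod (f j))\<^sup>2 + 2 * (cmod (g j))\<^sup>2" for j
    using cmod_add_power2_le[of "f j" "- g j"] by simp
qed simp

text \<open>The factor \<open>1/2\<close> is lost in \<open>|x + y|\<^sup>2 \<le> 2|x|\<^sup>2 + 2|y|\<^sup>2\<close>, which replaces Minkowski's inequality
  in the passage from finitely supported \<open>f\<close> to all of \<open>l\<^sup>2\<close>.\<close>

lemma corr_Z_lower:
  assumes a: "(\<lambda>i. cmod (a i)) summable_on UNIV" and f: "l2Z f"
    and c: "\<And>\<theta>. c \<le> (cmod (fourier_series a \<theta>))\<^sup>2"
  shows "c / 2 * (\<Sum>\<^sub>\<infinity>j. (cmod (f j))\<^sup>2) \<le> (\<Sum>\<^sub>\<infinity>k. (cmod (corr_Z a f k))\<^sup>2)"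
proof -
  have f2: "(\<lambda>j. (cmod (f j))\<^sup>2) summable_on UNIV" using f by (simp add: l2Z_def)
  define A where "A = (\<Sum>\<^sub>\<infinity>i. cmod (a i))"
  define n where "n = (\<Sum>\<^sub>\<infinity>j. (cmod (f j))\<^sup>2)"
  define T where "T = (\<Sum>\<^sub>\<infinity>k. (cmod (corr_Z a f k))\<^sup>2)"
  \<comment> \<open>Split \<open>f\<close> into its restriction \<open>u\<close> to \<open>F\<close>
    and the tail \<open>v\<close>: the finite case applies to \<open>u\<close>, and the upper bound
    shows that \<open>v\<close> disturbs little. As \<open>F\<close> exhausts the integers the tail
    term tends to zero.\<close>
  have fin: "c * (\<Sum>j\<in>F. (cmod (f j))\<^sup>2) \<le> 2 * T + 2 * A\<^sup>2 * (n - (\<Sum>j\<in>F. (cmod (f j))\<^sup>2))" if F: "finite F" for F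
  proof -
    define u where "u = (\<lambda>j. if j \<in> F then f j else 0)"
    define v where "v = (\<lambda>j. f j - u j)"
    have u: "l2Z u"
      unfolding l2Z_def by (rule summable_on_comparison_test[OF f2]) (auto simp: u_def)
    have v: "l2Z v" unfolding v_def by (rule l2Z_diff[OF f u])
    have nv: "(\<Sum>\<^sub>\<infinity>j. (cmod (v j))\<^sup>2) = n - (\<Sum>j\<in>F. (cmod (f j))\<^sup>2)"
    proof -
      have "n = (\<Sum>\<^sub>\<infinity>j. (cmod (u j))\<^sup>2 + (cmod (v j))\<^sup>2)"
        unfolding n_def by (rule infsum_cong) (auto simp: u_def v_def)
      also have "\<dots> = (\<Sum>\<^sub>\<infinity>j. (cmod (u j))\<^sup>2) + (\<Sum>\<^sub>\<infinity>j. (cmod (v j))\<^sup>2)"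
        using u v unfolding l2Z_def by (rule infsum_add)
      also have "(\<Sum>\<^sub>\<infinity>j. (cmod (u j))\<^sup>2) = (\<Sum>j\<in>F. (cmod (f j))\<^sup>2)"
        by (subst infsum_cong_neutral[where T = F and g = "\<lambda>j. (cmod (f j))\<^sup>2"]) (use F in \<open>auto simp: u_def\<close>)
      finally show ?thesis by simp
    qed
    have lin: "corr_Z a u k = corr_Z a f k - corr_Z a v k" for k
    proof -
      have "corr_Z a f k - corr_Z a v k = (\<Sum>\<^sub>\<infinity>j. f j * a (j - k) - v j * a (j - k))"
        unfolding corr_Z_def
        using corr_Z_upper(1)[OF a f, of k, THEN abs_summable_summable] corr_Z_upper(1)[OF a v, of k, THEN abs_summable_summable]
        by (intro infsumI[symmetric] has_sum_minus has_sum_infsum)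
      thus ?thesis by (simp add: corr_Z_def v_def algebra_simps)
    qed
    have "c * (\<Sum>j\<in>F. (cmod (f j))\<^sup>2) = c * (\<Sum>j\<in>F. (cmod (u j))\<^sup>2)" by (simp add: u_def)
    also have "\<dots> \<le> (\<Sum>\<^sub>\<infinity>k. (cmod (corr_Z a u k))\<^sup>2)"
      by (rule corr_Z_lower_finite[OF a F _ c]) (simp add: u_def)
    also have "\<dots> \<le> (\<Sum>\<^sub>\<infinity>k. 2 * (cmod (corr_Z a f k))\<^sup>2 + 2 * (cmod (corr_Z a v k))\<^sup>2)"
    proof (rule infsum_mono)
      show "(cmod (corr_Z a u k))\<^sup>2 \<le> 2 * (cmod (corr_Z a f k))\<^sup>2 + 2 * (cmod (corr_Z a v k))\<^sup>2" for k
        using cmod_add_power2_le[of "corr_Z a f k" "- corr_Z a v k"] by (simp add: lin)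
    qed (intro corr_Z_upper(2)[OF a u] summable_on_add summable_on_cmult_right corr_Z_upper(2)[OF a f] corr_Z_upper(2)[OF a v])+
    also have "\<dots> = 2 * T + 2 * (\<Sum>\<^sub>\<infinity>k. (cmod (corr_Z a v k))\<^sup>2)"
      unfolding T_def by (subst infsum_add)
        (auto simp: infsum_cmult_right' intro!: summable_on_cmult_right corr_Z_upper(2)[OF a f] corr_Z_upper(2)[OF a v])
    also have "(\<Sum>\<^sub>\<infinity>k. (cmod (corr_Z a v k))\<^sup>2) \<le> A\<^sup>2 * (n - (\<Sum>j\<in>F. (cmod (f j))\<^sup>2))"
      using corr_Z_upper(3)[OF a v] unfolding nv A_def .
    finally show ?thesis by simp
  qed
  have lim: "((\<lambda>F. \<Sum>j\<in>F. (cmod (f j))\<^sup>2) \<longlongrightarrow> n) (finite_subsets_at_top UNIV)"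
    unfolding n_def by (rule infsum_tendsto[OF f2])
  have "c * n \<le> 2 * T + 2 * A\<^sup>2 * (n - n)"
  proof (rule tendsto_le[OF finite_subsets_at_top_neq_bot])
    show "((\<lambda>F. c * (\<Sum>j\<in>F. (cmod (f j))\<^sup>2)) \<longlongrightarrow> c * n) (finite_subsets_at_top UNIV)"
      by (intro tendsto_intros lim)
    show "((\<lambda>F. 2 * T + 2 * A\<^sup>2 * (n - (\<Sum>j\<in>F. (cmod (f j))\<^sup>2))) \<longlongrightarrow> 2 * T + 2 * A\<^sup>2 * (n - n)) (finite_subsets_at_top UNIV)"
      by (intro tendsto_intros lim)
    show "\<forall>\<^sub>F F in finite_subsets_at_top UNIV. c * (\<Sum>j\<in>F. (cmod (f j))\<^sup>2) \<le> 2 * T + 2 * A\<^sup>2 * (n - (\<Sum>j\<in>F. (cmod (f j))\<^sup>2))"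
      by (rule eventually_finite_subsets_at_top_weakI) (rule fin)
  qed
  thus ?thesis unfolding n_def[symmetric] T_def[symmetric] by simp
qed

section \<open>Frames of l2(Z)\<close>

lemma zak_eq_fourier_series: "zak h M \<theta> x = fourier_series (\<lambda>i. of_real (h (x + of_int i * M))) \<theta>"
  by (simp add: zak_def fourier_series_def)

text \<open>The Zak transform is continuous in \<open>\<theta>\<close> and depends only on
  \<open>cis \<theta>\<close>, so its minimal modulus is attained on a compact period.\<close>

lemma zak_lower_bound:
  assumes h: "exp_decay h" and M: "M > 0" and nz: "\<And>\<theta>. zak h M \<theta> x \<noteq> 0"
  obtains c where "c > 0" "\<And>\<theta>. c \<le> (cmod (zak h M \<theta> x))\<^sup>2"
proof -
  let ?a = "\<lambda>i::int. complex_of_real (h (x + of_int i * M))"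
  have a: "(\<lambda>i. cmod (?a i)) summable_on UNIV"
    using zak_abs_summable[OF h M, of x 0] by (simp add: norm_mult)
  have "continuous_on {0..2 * pi} (\<lambda>\<theta>. (cmod (zak h M \<theta> x))\<^sup>2)"
    unfolding zak_eq_fourier_series by (intro continuous_intros fourier_series_continuous a)
  moreover have ne: "{0..2 * pi} \<noteq> {}" by simp
  ultimately obtain \<theta>0 where \<theta>0: "\<And>\<theta>. \<theta> \<in> {0..2 * pi} \<Longrightarrow> (cmod (zak h M \<theta>0 x))\<^sup>2 \<le> (cmod (zak h M \<theta> x))\<^sup>2"
    using continuous_attains_inf[of "{0..2 * pi}" "\<lambda>\<theta>. (cmod (zak h M \<theta> x))\<^sup>2"]
    by (simp only: compact_Icc) (use ne in blast)
  show ?thesis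
  proof (rule that)
    show "(cmod (zak h M \<theta>0 x))\<^sup>2 > 0" using nz by simp
    fix \<theta>
    define \<theta>' where "\<theta>' = Arg2pi (cis \<theta>)"
    have "cis \<theta>' = cis \<theta>" using Arg2pi_eq[of "cis \<theta>"] by (simp add: \<theta>'_def cis_conv_exp)
    hence "zak h M \<theta> x = zak h M \<theta>' x" by (rule zak_cong_cis[OF sym])
    moreover have "\<theta>' \<in> {0..2 * pi}"
      using Arg2pi_ge_0[of "cis \<theta>"] Arg2pi_lt_2pi[of "cis \<theta>"] by (simp add: \<theta>'_def)
    ultimately show "(cmod (zak h M \<theta>0 x))\<^sup>2 \<le> (cmod (zak h M \<theta> x))\<^sup>2" using \<theta>0 by simp
  qed
qed

lemma has_sum_int_residues:
  fixes F :: "int \<Rightarrow> 'a::{topological_comm_monoid_add,t3_space}"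
  assumes M: "M > 0" and S: "(F has_sum S) UNIV"
    and s: "\<And>r. r < M \<Longrightarrow> ((\<lambda>j. F (int r + j * int M)) has_sum s r) UNIV"
  shows "S = (\<Sum>r<M. s r)"
proof -
  have "(F has_sum S) UNIV \<longleftrightarrow> ((\<lambda>(r, j). F (int r + j * int M)) has_sum S) (SIGMA r:{..<M}. UNIV)"
  proof (rule has_sum_reindex_bij_witness[of _ "\<lambda>(r, j). int r + j * int M" "\<lambda>n. (nat (n mod int M), n div int M)"])
    fix p assume "p \<in> (SIGMA r:{..<M}. (UNIV :: int set))"
    then obtain r j where p: "p = (r, j)" "r < M" by auto
    thus "(\<lambda>n. (nat (n mod int M), n div int M)) ((\<lambda>(r, j). int r + j * int M) p) = p" by simp
  qed (use M in \<open>auto simp: nat_less_iff\<close>)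
  with S have "((\<lambda>(r, j). F (int r + j * int M)) has_sum S) (SIGMA r:{..<M}. UNIV)" by simp
  hence "(s has_sum S) {..<M}" by (rule has_sum_SigmaD) (use s in auto)
  from has_sum_unique[OF this has_sum_finite[OF finite_lessThan]] show ?thesis .
qed

lemma summable_on_int_residue:
  fixes F :: "int \<Rightarrow> real"
  assumes "F summable_on UNIV" "M > 0"
  shows "(\<lambda>j. F (int r + j * int M)) summable_on UNIV"
proof -
  have "inj (\<lambda>j. int r + j * int M)" using assms(2) by (auto simp: inj_def)
  moreover have "F summable_on range (\<lambda>j. int r + j * int M)"
    using assms(1) by (rule summable_on_subset_banach) auto
  ultimately show ?thesis by (simp add: summable_on_reindex o_def)
qed

lemma exp_decay_samples_l2Z:
  assumes h: "exp_decay h"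
  shows "l2Z (\<lambda>n. of_real (h (of_int n + x)) * cis (y n))"
proof -
  obtain B where B: "B summable_on UNIV" "\<And>n::int. \<bar>h (x + of_int n * 1)\<bar> \<le> B n" "\<And>n. B n \<ge> 0"
    using exp_decay_translates[OF h zero_less_one, of "\<bar>x\<bar>"] by (metis order_refl)
  \<comment> \<open>Each term of a nonnegative summable sequence is at most the sum, so squares are
    dominated by a multiple of the sequence itself.\<close>
  have le: "B n \<le> infsum B UNIV" for n
    using finite_sum_le_infsum[OF B(1), of "{n}"] B(3) by simp
  show ?thesis
    unfolding l2Z_def
  proof (rule summable_on_comparison_test)
    show "(\<lambda>n. infsum B UNIV * B n) summable_on UNIV" using B(1) by (rule summable_on_cmult_right)
    fix n
    have "(cmod (of_real (h (of_int n + x)) * cis (y n)))\<^sup>2 \<le> (B n)\<^sup>2"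
      using B(2)[of n] by (intro power_mono) (auto simp: norm_mult add.commute)
    also have "\<dots> \<le> infsum B UNIV * B n"
      unfolding power2_eq_square by (intro mult_right_mono le B(3))
    finally show "(cmod (of_real (h (of_int n + x)) * cis (y n)))\<^sup>2 \<le> infsum B UNIV * B n" .
  qed simp
qed

lemma l2Z_inner_summable:
  assumes "l2Z f" "l2Z e"
  shows "(\<lambda>n. f n * cnj (e n)) summable_on UNIV"
proof (rule abs_summable_summable)
  show "(\<lambda>n. norm (f n * cnj (e n))) summable_on UNIV"
    using assms by - (rule abs_summable_product; simp add: l2Z_def norm_mult power2_eq_square)
qed

text \<open>The splitting \<open>n = r + j * M\<close> as on the cyclic group, with \<open>j\<close>
  now running over all integers; decay of the samples justifies splitting the sum by
  residues.\<close>

lemma l2Z_inner_gabor: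
  assumes h: "exp_decay h" and M: "M > 0" and f: "l2Z f"
  shows "l2Z_inner f (gabor_Sg (\<lambda>x. of_real (h x)) M (k, l)) =
    (\<Sum>r<M. corr_Z (\<lambda>i. of_real (h (real r + of_int i * real M))) (\<lambda>j. f (int r + j * int M)) k * cis (- (2 * pi * real l * real r / real M)))"
proof -
  let ?e = "gabor_Sg (\<lambda>x. complex_of_real (h x)) M (k, l)"
  have e: "?e n = of_real (h (of_int n + of_int (- k) * real M)) * cis (2 * pi * (real l / real M) * of_int n)" for n
    by (simp add: gabor_Sg_def samp_def)
  have el: "l2Z ?e" unfolding e[abs_def] by (rule exp_decay_samples_l2Z[OF h])
  have "((\<lambda>n. f n * cnj (?e n)) has_sum (l2Z_inner f ?e)) UNIV"
    unfolding l2Z_inner_def by (rule has_sum_infsum[OF l2Z_inner_summable[OF f el]])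
  thus ?thesis
  proof (rule has_sum_int_residues[OF M])
    fix r assume "r < M"
    let ?a = "\<lambda>i::int. complex_of_real (h (real r + of_int i * real M))"
    let ?f = "\<lambda>j. f (int r + j * int M)"
    have a: "(\<lambda>i. cmod (?a i)) summable_on UNIV"
      using zak_abs_summable[OF h, of "real M" "real r" 0] M by (simp add: norm_mult)
    have fr: "l2Z ?f" using f M unfolding l2Z_def by (intro summable_on_int_residue[of "\<lambda>n. (cmod (f n))\<^sup>2"])
    have "((\<lambda>j. ?f j * ?a (j - k) * cis (- (2 * pi * real l * real r / real M))) has_sum
        (corr_Z ?a ?f k * cis (- (2 * pi * real l * real r / real M)))) UNIV"
      unfolding corr_Z_def
      by (rule has_sum_cmult_left[OF has_sum_infsum[OF abs_summable_summable[OF corr_Z_upper(1)[OF a fr]]]])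
    moreover have "f (int r + j * int M) * cnj (?e (int r + j * int M)) =
        ?f j * ?a (j - k) * cis (- (2 * pi * real l * real r / real M))" for j
    proof -
      have "cis (2 * pi * (real l / real M) * of_int (int r + j * int M)) =
          cis (2 * pi * real l * real r / real M) * cis (2 * pi * of_int (int l * j))"
        unfolding cis_mult using M by (intro arg_cong[where f = cis]) (simp add: field_simps)
      also have "cis (2 * pi * of_int (int l * j)) = 1"
        unfolding cis_2pi_eq_1_iff by (rule Ints_of_int)
      finally have c: "cis (2 * pi * (real l / real M) * of_int (int r + j * int M)) = cis (2 * pi * real l * real r / real M)"
        by simp
      have eq: "real_of_int (int r + j * int M) + of_int (- k) * real M = real r + of_int (j - k) * real M"
        by (simp add: algebra_simps)
      show ?thesis unfolding e c eq by (simp add: cis_cnj)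
    qed
    ultimately show "((\<lambda>j. f (int r + j * int M) * cnj (?e (int r + j * int M))) has_sum
        (corr_Z ?a ?f k * cis (- (2 * pi * real l * real r / real M)))) UNIV"
      by (simp only:)
  qed
qed

text \<open>Translations now form the full group of integers, so every \<open>\<theta>\<close>
  occurs as a frequency, while \<open>x\<close> is sampled only at the residues
  \<open>r\<close>.\<close>

lemma l2Z_frame_gabor:
  assumes h: "exp_decay h" and M: "M > 0" and nz: "\<And>r \<theta>. r < M \<Longrightarrow> zak h (real M) \<theta> (real r) \<noteq> 0"
  shows "l2Z_frame (UNIV \<times> {0..<M}) (gabor_Sg (\<lambda>x. of_real (h x)) M)"
proof -
  let ?e = "gabor_Sg (\<lambda>x. complex_of_real (h x)) M"
  define a where "a = (\<lambda>r (i::int). complex_of_real (h (real r + of_int i * real M)))"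
  have M': "real M > 0" using M by simp
  have as: "(\<lambda>i. cmod (a r i)) summable_on UNIV" for r
    using zak_abs_summable[OF h M', of "real r" 0] by (simp add: norm_mult a_def)
  have "\<exists>c. \<forall>r<M. c r > 0 \<and> (\<forall>\<theta>. c r \<le> (cmod (fourier_series (a r) \<theta>))\<^sup>2)"
  proof -
    have "\<exists>c>0. \<forall>\<theta>. c \<le> (cmod (fourier_series (a r) \<theta>))\<^sup>2" if r: "r < M" for r
    proof -
      obtain c where "c > 0" "\<And>\<theta>. c \<le> (cmod (zak h (real M) \<theta> (real r)))\<^sup>2"
        by (rule zak_lower_bound[OF h M' nz[OF r]]) blast
      thus ?thesis unfolding a_def zak_eq_fourier_series by blast
    qed
    thus ?thesis by metis
  qed
  then obtain c where c: "\<And>r. r < M \<Longrightarrow> c r > 0" "\<And>r \<theta>. r < M \<Longrightarrow> c r \<le> (cmod (fourier_series (a r) \<theta>))\<^sup>2" by blast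
  define c0 where "c0 = Min (c ` {..<M})"
  have ne: "c ` {..<M} \<noteq> {}" using M by auto
  have c0: "c0 > 0" unfolding c0_def using c(1) ne by (subst Min_gr_iff) auto
  have c0r: "c0 \<le> (cmod (fourier_series (a r) \<theta>))\<^sup>2" if "r < M" for r \<theta>
  proof -
    have "c0 \<le> c r" unfolding c0_def using that by auto
    thus ?thesis using c(2)[OF that, of \<theta>] by linarith
  qed
  define A where "A = (\<lambda>r. (\<Sum>\<^sub>\<infinity>i. cmod (a r i)))"
  \<comment> \<open>The sum dominates every square of \<open>A r\<close> at once, and the
    \<open>1\<close> makes the bound positive.\<close>
  define D where "D = 1 + (\<Sum>r<M. (A r)\<^sup>2)"
  have D: "D > 0" unfolding D_def by (intro add_pos_nonneg sum_nonneg) auto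
  have DA: "(A r)\<^sup>2 \<le> D" if "r < M" for r
    using member_le_sum[of r "{..<M}" "\<lambda>r. (A r)\<^sup>2"] that by (simp add: D_def)
  show ?thesis
    unfolding l2Z_frame_def
  proof (intro conjI exI allI impI ballI)
    show "l2Z (?e i)" for i
      using exp_decay_samples_l2Z[OF h] by (cases i) (simp add: gabor_Sg_def samp_def diff_conv_add_uminus del: add_uminus_conv_diff)
    show "0 < real M * (c0 / 2)" "0 < real M * D" using M c0 D by auto
    fix f assume f: "l2Z f"
    define fr where "fr = (\<lambda>r j. f (int r + j * int M))"
    have f2: "(\<lambda>n. (cmod (f n))\<^sup>2) summable_on UNIV" using f by (simp add: l2Z_def)
    have frl: "l2Z (fr r)" for r
      using summable_on_int_residue[OF f2 M] unfolding l2Z_def fr_def .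
    define n where "n = (\<lambda>r. (\<Sum>\<^sub>\<infinity>j. (cmod (fr r j))\<^sup>2))"
    define T where "T = (\<lambda>r. (\<Sum>\<^sub>\<infinity>k. (cmod (corr_Z (a r) (fr r) k))\<^sup>2))"
    have norm: "(\<Sum>\<^sub>\<infinity>n. (cmod (f n))\<^sup>2) = (\<Sum>r<M. n r)"
    proof (rule has_sum_int_residues[OF M has_sum_infsum[OF f2]])
      show "((\<lambda>j. (cmod (f (int r + j * int M)))\<^sup>2) has_sum n r) UNIV" for r
        using frl[of r] unfolding n_def l2Z_def fr_def by (rule has_sum_infsum)
    qed
    have tot: "((\<lambda>i. (cmod (l2Z_inner f (?e i)))\<^sup>2) has_sum (real M * (\<Sum>r<M. T r))) (UNIV \<times> {0..<M})"
    proof -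
      have row: "((\<lambda>l. (cmod (l2Z_inner f (?e (k, l))))\<^sup>2) has_sum (real M * (\<Sum>r<M. (cmod (corr_Z (a r) (fr r) k))\<^sup>2))) {0..<M}" for k
      proof -
        have "(\<Sum>l\<in>{0..<M}. (cmod (l2Z_inner f (?e (k, l))))\<^sup>2) = real M * (\<Sum>r<M. (cmod (corr_Z (a r) (fr r) k))\<^sup>2)"
          unfolding l2Z_inner_gabor[OF h M f] a_def fr_def atLeast0LessThan by (rule dft_parseval_neg[OF M])
        from has_sum_finiteI[OF finite_atLeastLessThan this[symmetric]] show ?thesis .
      qed
      have g: "((\<lambda>k. real M * (\<Sum>r<M. (cmod (corr_Z (a r) (fr r) k))\<^sup>2)) has_sum (real M * (\<Sum>r<M. T r))) UNIV"
        unfolding T_def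
        by (intro has_sum_cmult_right has_sum_finite_sum finite_lessThan has_sum_infsum corr_Z_upper(2)[OF as frl])
      show ?thesis
      proof (rule has_sum_SigmaI[OF row g])
        show "(\<lambda>i. (cmod (l2Z_inner f (?e i)))\<^sup>2) summable_on UNIV \<times> {0..<M}"
          by (rule summable_on_SigmaI[OF row has_sum_imp_summable[OF g]]) simp
      qed
    qed
    show "(\<lambda>i. (cmod (l2Z_inner f (?e i)))\<^sup>2) summable_on UNIV \<times> {0..<M}"
      using tot by (rule has_sum_imp_summable)
    have lo: "c0 / 2 * n r \<le> T r" and up: "T r \<le> D * n r" if "r < M" for r
    proof -
      show "c0 / 2 * n r \<le> T r" unfolding n_def T_def by (rule corr_Z_lower[OF as frl c0r[OF that]])
      have "T r \<le> (A r)\<^sup>2 * n r" unfolding n_def T_def A_def by (rule corr_Z_upper(3)[OF as frl])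
      also have "\<dots> \<le> D * n r" unfolding n_def by (intro mult_right_mono DA[OF that] infsum_nonneg) simp
      finally show "T r \<le> D * n r" .
    qed
    have "real M * (c0 / 2) * (\<Sum>\<^sub>\<infinity>n. (cmod (f n))\<^sup>2) = real M * (\<Sum>r<M. c0 / 2 * n r)"
      unfolding norm by (simp only: sum_distrib_left mult.assoc)
    also have "\<dots> \<le> real M * (\<Sum>r<M. T r)" by (intro mult_left_mono sum_mono lo) auto
    finally show "real M * (c0 / 2) * (\<Sum>\<^sub>\<infinity>n. (cmod (f n))\<^sup>2) \<le> (\<Sum>\<^sub>\<infinity>i\<in>UNIV \<times> {0..<M}. (cmod (l2Z_inner f (?e i)))\<^sup>2)"
      unfolding infsumI[OF tot] .
    have "real M * (\<Sum>r<M. T r) \<le> real M * (\<Sum>r<M. D * n r)" by (intro mult_left_mono sum_mono up) auto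
    also have "\<dots> = real M * D * (\<Sum>\<^sub>\<infinity>n. (cmod (f n))\<^sup>2)"
      unfolding norm by (simp only: sum_distrib_left mult.assoc)
    finally show "(\<Sum>\<^sub>\<infinity>i\<in>UNIV \<times> {0..<M}. (cmod (l2Z_inner f (?e i)))\<^sup>2) \<le> real M * D * (\<Sum>\<^sub>\<infinity>n. (cmod (f n))\<^sup>2)"
      unfolding infsumI[OF tot] .
  qed
qed

section \<open>Frames of L2(T_K)\<close>

lemma lebesgue_measurable_translate: "(\<lambda>x::real. x + a) \<in> lebesgue \<rightarrow>\<^sub>M lebesgue"
  using lebesgue_affine_measurable[where c = "\<lambda>_::real. 1" and t = a] by (simp add: add.commute)

lemma integrable_lebesgue_translate:
  fixes \<phi> :: "real \<Rightarrow> 'a::{banach, second_countable_topology}"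
  assumes \<phi>: "integrable lebesgue \<phi>"
  shows "integrable lebesgue (\<lambda>x. \<phi> (x + a))"
  unfolding integrable_iff_bounded
proof
  have m: "\<phi> \<in> borel_measurable lebesgue" using \<phi> by simp
  show "(\<lambda>x. \<phi> (x + a)) \<in> borel_measurable lebesgue"
    by (rule measurable_compose[OF lebesgue_measurable_translate m])
  have "(\<lambda>x. ennreal (norm (\<phi> x))) \<in> borel_measurable lebesgue" using m by measurable
  from nn_integral_real_affine_lebesgue[OF this, of 1 a]
  have "(\<integral>\<^sup>+x. ennreal (norm (\<phi> (x + a))) \<partial>lebesgue) = (\<integral>\<^sup>+x. ennreal (norm (\<phi> x)) \<partial>lebesgue)"
    by (simp add: add.commute)
  also have "\<dots> < \<infinity>" using \<phi> unfolding integrable_iff_bounded by blast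
  finally show "(\<integral>\<^sup>+x. ennreal (norm (\<phi> (x + a))) \<partial>lebesgue) < \<infinity>" .
qed

text \<open>Functions on \<open>{0..K}\<close> are extended by zero in order to translate them on
  the whole line. As the window \<open>{a..a + P}\<close> stays inside \<open>{0..K}\<close>, the
  extension is invisible after restriction to \<open>{0..P}\<close>.\<close>

lemma indicator_translate_Icc:
  fixes \<phi> :: "real \<Rightarrow> 'a::real_vector"
  assumes "0 \<le> a" "a + P \<le> K"
  shows "indicator {0..P} t *\<^sub>R (indicator {0..K} (t + a) *\<^sub>R \<phi> (t + a)) = indicator {0..P} t *\<^sub>R \<phi> (t + a)"
  using assms by (auto simp: indicator_def)

lemma integrable_lebesgue_on_translate:
  fixes \<phi> :: "real \<Rightarrow> 'a::{banach, second_countable_topology}"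
  assumes \<phi>: "integrable (lebesgue_on {0..K}) \<phi>" and a: "0 \<le> a" "a + P \<le> K"
  shows "integrable (lebesgue_on {0..P}) (\<lambda>t. \<phi> (t + a))"
proof -
  have "integrable lebesgue (\<lambda>t. indicator {0..K} t *\<^sub>R \<phi> t)"
    using \<phi> by (subst (asm) integrable_restrict_space) auto
  hence "integrable lebesgue (\<lambda>t. indicator {0..K} (t + a) *\<^sub>R \<phi> (t + a))"
    by (rule integrable_lebesgue_translate)
  hence "integrable lebesgue (\<lambda>t. indicator {0..P} t *\<^sub>R (indicator {0..K} (t + a) *\<^sub>R \<phi> (t + a)))"
    by (intro integrable_mult_indicator) auto
  thus ?thesis
    unfolding indicator_translate_Icc[OF a] by (subst integrable_restrict_space) auto
qed

lemma measurable_lebesgue_on_translate: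
  fixes \<phi> :: "real \<Rightarrow> 'a::{real_normed_vector, second_countable_topology}"
  assumes \<phi>: "\<phi> \<in> borel_measurable (lebesgue_on {0..K})" and a: "0 \<le> a" "a + P \<le> K"
  shows "(\<lambda>t. \<phi> (t + a)) \<in> borel_measurable (lebesgue_on {0..P})"
proof -
  have "(\<lambda>t. indicator {0..K} t *\<^sub>R \<phi> t) \<in> borel_measurable lebesgue"
    using \<phi> by (subst (asm) borel_measurable_restrict_space_iff) auto
  from measurable_compose[OF lebesgue_measurable_translate this]
  have F: "(\<lambda>t. indicator {0..K} (t + a) *\<^sub>R \<phi> (t + a)) \<in> borel_measurable lebesgue" .
  have "indicat_real {0..P} \<in> borel_measurable lebesgue"
    by (intro borel_measurable_indicator) simp
  from borel_measurable_scaleR[OF this F]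
  have "(\<lambda>t. indicator {0..P} t *\<^sub>R (indicator {0..K} (t + a) *\<^sub>R \<phi> (t + a))) \<in> borel_measurable lebesgue" .
  thus ?thesis
    unfolding indicator_translate_Icc[OF a] by (subst borel_measurable_restrict_space_iff) auto
qed

lemma L2_on_translate:
  assumes "L2_on K f" "0 \<le> a" "a + P \<le> K"
  shows "L2_on P (\<lambda>t. f (t + a))"
  using assms measurable_lebesgue_on_translate[of f K a P] integrable_lebesgue_on_translate[of K "\<lambda>t. (cmod (f t))\<^sup>2" a P]
  by (auto simp: L2_on_def)

text \<open>Additivity over adjacent intervals and translation are carried out for gauge integrals,
  with which the Lebesgue integrals agree here.\<close>

lemma integral_split_translates:
  fixes \<phi> :: "real \<Rightarrow> 'a::euclidean_space"
  assumes \<phi>: "integrable (lebesgue_on {0..real N * P}) \<phi>" and P: "P > 0"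
  shows "(LINT t|lebesgue_on {0..real N * P}. \<phi> t) = (\<Sum>j<N. LINT t|lebesgue_on {0..P}. \<phi> (t + real j * P))"
proof -
  have HK: "\<phi> integrable_on {0..real N * P}"
    using has_integral_integral_lebesgue_on[OF \<phi>] by auto
  have "integral {0..real n * P} \<phi> = (\<Sum>j<n. integral {0..P} (\<lambda>t. \<phi> (t + real j * P)))" if "n \<le> N" for n
    using that
  proof (induction n)
    case (Suc n)
    have le: "real n * P \<le> real (Suc n) * P" "real (Suc n) * P \<le> real N * P" "0 \<le> real n * P"
      using Suc.prems P by (auto intro!: mult_right_mono)
    have sub: "\<phi> integrable_on {0..real (Suc n) * P}"
      by (rule integrable_subinterval_real[OF HK]) (use le in auto)
    have sub': "\<phi> integrable_on cbox (real n * P) (real (Suc n) * P)"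
      unfolding cbox_interval by (rule integrable_subinterval_real[OF HK]) (use le in auto)
    have "((\<lambda>t. \<phi> (t + real n * P)) has_integral integral (cbox (real n * P) (real (Suc n) * P)) \<phi>) {0..P}"
      using has_integral_affinity'[OF integrable_integral[OF sub'], of 1 "real n * P"] by (simp add: algebra_simps)
    hence "integral {0..P} (\<lambda>t. \<phi> (t + real n * P)) = integral {real n * P..real (Suc n) * P} \<phi>"
      by (simp add: integral_unique)
    moreover have "integral {0..real n * P} \<phi> + integral {real n * P..real (Suc n) * P} \<phi> = integral {0..real (Suc n) * P} \<phi>"
      by (rule Henstock_Kurzweil_Integration.integral_combine[OF le(3) le(1) sub])
    ultimately show ?case using Suc by simp
  qed simp
  from this[of N] have "integral {0..real N * P} \<phi> = (\<Sum>j<N. integral {0..P} (\<lambda>t. \<phi> (t + real j * P)))" by simp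
  moreover have "integral {0..P} (\<lambda>t. \<phi> (t + real j * P)) = (LINT t|lebesgue_on {0..P}. \<phi> (t + real j * P))" if "j < N" for j
  proof -
    have "(1 + real j) * P \<le> real N * P" using that P by (intro mult_right_mono) auto
    hence "integrable (lebesgue_on {0..P}) (\<lambda>t. \<phi> (t + real j * P))"
      using P by (intro integrable_lebesgue_on_translate[OF \<phi>]) (auto simp: algebra_simps)
    thus ?thesis by (simp add: lebesgue_integral_eq_integral)
  qed
  ultimately show ?thesis using \<phi> by (simp add: lebesgue_integral_eq_integral)
qed

text \<open>The series converges uniformly only on bounded sets, so continuity is shown on a bounded
  neighbourhood of each point.\<close>

lemma zak_continuous:
  assumes h: "exp_decay h" "continuous_on UNIV h" and M: "M > 0"
  shows "continuous_on UNIV (zak h M \<theta>)"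
proof -
  have "isCont (zak h M \<theta>) x" for x
  proof -
    define R where "R = \<bar>x\<bar> + 1"
    obtain B where B: "B summable_on UNIV" "\<And>x k. \<bar>x\<bar> \<le> R \<Longrightarrow> \<bar>h (x + of_int k * M)\<bar> \<le> B k"
      using exp_decay_translates[OF h(1) M] by metis
    have "uniform_limit {-R..R} (\<lambda>S x. \<Sum>k\<in>S. of_real (h (x + of_int k * M)) * cis (of_int k * \<theta>)) (zak h M \<theta>) (finite_subsets_at_top UNIV)"
      unfolding zak_def by (rule Weierstrass_m_test_general[OF _ B(1)]) (use B(2) in \<open>auto simp: norm_mult\<close>)
    hence "continuous_on {-R..R} (zak h M \<theta>)"
      by (rule uniform_limit_theorem[rotated])
         (auto intro!: always_eventually continuous_intros continuous_on_compose2[OF h(2)])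
    thus ?thesis by (rule continuous_on_interior) (auto simp: R_def)
  qed
  thus ?thesis by (simp add: continuous_at_imp_continuous_on)
qed

lemma periodize_eq_zak:
  "periodize (\<lambda>x. of_real (h x)) K x = zak h K 0 x"
  unfolding periodize_def zak_def
  by (rule infsum_reindex_bij_witness[of _ uminus uminus]) auto

lemma L2_on_mult_continuous:
  assumes f: "L2_on P f" and q: "continuous_on {0..P} q"
  shows "L2_on P (\<lambda>t. f t * q t)"
proof -
  have "bounded (q ` {0..P})" using q by (intro compact_imp_bounded compact_continuous_image) auto
  then obtain B where B: "\<And>t. t \<in> {0..P} \<Longrightarrow> cmod (q t) \<le> B"
    unfolding bounded_iff by blast
  have qm: "q \<in> borel_measurable (lebesgue_on {0..P})"
    using q by (intro continuous_imp_measurable_on_sets_lebesgue) auto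
  have m: "(\<lambda>t. f t * q t) \<in> borel_measurable (lebesgue_on {0..P})"
    using f qm by (auto simp: L2_on_def)
  show ?thesis
    unfolding L2_on_def
  proof
    show "integrable (lebesgue_on {0..P}) (\<lambda>t. (cmod (f t * q t))\<^sup>2)"
    proof (rule Bochner_Integration.integrable_bound)
      show "integrable (lebesgue_on {0..P}) (\<lambda>t. B\<^sup>2 * (cmod (f t))\<^sup>2)" using f by (auto simp: L2_on_def)
      show "AE t in lebesgue_on {0..P}. norm ((cmod (f t * q t))\<^sup>2) \<le> norm (B\<^sup>2 * (cmod (f t))\<^sup>2)"
      proof (rule AE_I2)
        fix t assume "t \<in> space (lebesgue_on {0..P})"
        hence "(cmod (q t))\<^sup>2 \<le> B\<^sup>2" using B by (intro power_mono) auto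
        hence "(cmod (q t))\<^sup>2 * (cmod (f t))\<^sup>2 \<le> B\<^sup>2 * (cmod (f t))\<^sup>2" by (rule mult_right_mono) simp
        thus "norm ((cmod (f t * q t))\<^sup>2) \<le> norm (B\<^sup>2 * (cmod (f t))\<^sup>2)"
          by (simp add: norm_mult power_mult_distrib mult.commute)
      qed
      show "(\<lambda>t. (cmod (f t * q t))\<^sup>2) \<in> borel_measurable (lebesgue_on {0..P})" using m by measurable
    qed
  qed (rule m)
qed

lemma gabor_PKg_eq:
  assumes "K > 0"
  shows "gabor_PKg g K M (k, l) t = periodize g (real K) (t - real (k * M)) * cis (2 * pi * (of_int l / real M) * t)"
  using assms by (simp add: gabor_PKg_def periodize_realmod)

text \<open>Folding \<open>{0..K}\<close> onto \<open>{0..M}\<close> leaves the modulation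
  unchanged, since it has period \<open>M\<close>. Thus \<open>l\<close> becomes a Fourier frequency
  on \<open>{0..M}\<close>, and \<open>j\<close> and \<open>k\<close> form a cyclic correlation at
  each point \<open>t\<close>.\<close>

lemma L2TK_inner_gabor:
  assumes h: "exp_decay h" "continuous_on UNIV h" and N: "N > 0" and M: "M > 0" and f: "L2TK (N * M) f"
  shows "L2TK_inner (N * M) f (gabor_PKg (\<lambda>x. of_real (h x)) (N * M) M (k, l)) =
    fourier_coeff (real M) (\<lambda>t. \<Sum>j<N. f (t + real j * real M) *
      periodize (\<lambda>x. of_real (h x)) (real N * real M) (t + of_int (int j - int k) * real M)) l"
proof -
  let ?g = "\<lambda>x. complex_of_real (h x)"
  let ?e = "gabor_PKg ?g (N * M) M (k, l)"
  let ?p = "periodize ?g (real N * real M)"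
  have K: "real N * real M > 0" "N * M > 0" using N M by auto
  have M': "real M > 0" using M by simp
  have pc: "continuous_on UNIV ?p"
    unfolding periodize_eq_zak[abs_def] by (rule zak_continuous[OF h K(1)])
  have f': "L2_on (real N * real M) f" using f by (simp add: L2TK_def L2_on_def)
  have e: "?e t = ?p (t - real (k * M)) * cis (2 * pi * (of_int l / real M) * t)" for t
    using gabor_PKg_eq[OF K(2), of ?g M k l t] by simp
  have ec: "continuous_on A ?e" for A
    unfolding e[abs_def] by (intro continuous_intros continuous_on_compose2[OF pc]) auto
  have "integrable (lebesgue_on {0..real N * real M}) (\<lambda>t. f t * cnj (?e t))"
    by (rule L2_on_mult[OF f' L2_on_cnj[OF L2_on_continuous[OF ec]]])
  note int = this
  have "L2TK_inner (N * M) f ?e = (LINT t|lebesgue_on {0..real N * real M}. f t * cnj (?e t))"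
    by (simp add: L2TK_inner_def)
  also have "\<dots> = (\<Sum>j<N. LINT t|lebesgue_on {0..real M}. f (t + real j * real M) * cnj (?e (t + real j * real M)))"
    by (rule integral_split_translates[OF int M'])
  also have "\<dots> = (LINT t|lebesgue_on {0..real M}. (\<Sum>j<N. f (t + real j * real M) * cnj (?e (t + real j * real M))))"
  proof (rule Bochner_Integration.integral_sum[symmetric])
    fix j assume "j \<in> {..<N}"
    hence "(1 + real j) * real M \<le> real N * real M" by (intro mult_right_mono) auto
    thus "integrable (lebesgue_on {0..real M}) (\<lambda>t. f (t + real j * real M) * cnj (?e (t + real j * real M)))"
      by (intro integrable_lebesgue_on_translate[OF int]) (auto simp: algebra_simps)
  qed
  also have "(\<lambda>t. \<Sum>j<N. f (t + real j * real M) * cnj (?e (t + real j * real M))) =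
      (\<lambda>t. (\<Sum>j<N. f (t + real j * real M) * ?p (t + of_int (int j - int k) * real M)) * cis (- (2 * pi * of_int l * t / real M)))"
  proof
    fix t
    have "cnj (?e (t + real j * real M)) = ?p (t + of_int (int j - int k) * real M) * cis (- (2 * pi * of_int l * t / real M))" for j
    proof -
      have "cis (2 * pi * (of_int l / real M) * (t + real j * real M)) =
          cis (2 * pi * of_int l * t / real M) * cis (2 * pi * of_int (l * int j))"
        unfolding cis_mult using M by (intro arg_cong[where f = cis]) (simp add: field_simps)
      also have "cis (2 * pi * of_int (l * int j)) = 1"
        unfolding cis_2pi_eq_1_iff by (rule Ints_of_int)
      finally have c: "cis (2 * pi * (of_int l / real M) * (t + real j * real M)) = cis (2 * pi * of_int l * t / real M)" by simp
      have eq: "t + real j * real M - real (k * M) = t + of_int (int j - int k) * real M" by (simp add: algebra_simps)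
      show ?thesis unfolding e c eq complex_cnj_mult periodize_real[OF h(1) K(1)] by (simp add: cis_cnj)
    qed
    thus "(\<Sum>j<N. f (t + real j * real M) * cnj (?e (t + real j * real M))) =
      (\<Sum>j<N. f (t + real j * real M) * ?p (t + of_int (int j - int k) * real M)) * cis (- (2 * pi * of_int l * t / real M))"
      unfolding sum_distrib_right by (simp only: mult.assoc)
  qed
  finally show ?thesis by (simp only: fourier_coeff_def)
qed

lemma zak_uniform_bounds:
  fixes N :: nat and \<theta> :: "nat \<Rightarrow> real"
  assumes h: "exp_decay h" "continuous_on UNIV h" and M: "M > 0" and N: "N > 0"
    and nz: "\<And>s t. s < N \<Longrightarrow> zak h M (\<theta> s) t \<noteq> 0"
  obtains c D where "c > 0" "D > 0" "\<And>s t. s < N \<Longrightarrow> t \<in> {0..M} \<Longrightarrow> c \<le> (cmod (zak h M (\<theta> s) t))\<^sup>2"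
    "\<And>s t. s < N \<Longrightarrow> t \<in> {0..M} \<Longrightarrow> (cmod (zak h M (\<theta> s) t))\<^sup>2 \<le> (D::real)"
proof -
  have "\<exists>c d. c > 0 \<and> (\<forall>t\<in>{0..M}. c \<le> (cmod (zak h M (\<theta> s) t))\<^sup>2 \<and> (cmod (zak h M (\<theta> s) t))\<^sup>2 \<le> d)" if s: "s < N" for s
  proof -
    have cont: "continuous_on {0..M} (\<lambda>t. (cmod (zak h M (\<theta> s) t))\<^sup>2)"
      by (intro continuous_intros continuous_on_subset[OF zak_continuous[OF h M]]) auto
    have ne: "{0..M} \<noteq> {}" using M by simp
    obtain t0 where t0: "\<forall>t\<in>{0..M}. (cmod (zak h M (\<theta> s) t0))\<^sup>2 \<le> (cmod (zak h M (\<theta> s) t))\<^sup>2"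
      using continuous_attains_inf[OF compact_Icc ne cont] by blast
    obtain t1 where t1: "\<forall>t\<in>{0..M}. (cmod (zak h M (\<theta> s) t))\<^sup>2 \<le> (cmod (zak h M (\<theta> s) t1))\<^sup>2"
      using continuous_attains_sup[OF compact_Icc ne cont] by blast
    have "(cmod (zak h M (\<theta> s) t0))\<^sup>2 > 0" using nz[OF s] by simp
    thus ?thesis using t0 t1 by blast
  qed
  then obtain c d where cd: "\<And>s. s < N \<Longrightarrow> c s > 0"
      "\<And>s t. s < N \<Longrightarrow> t \<in> {0..M} \<Longrightarrow> c s \<le> (cmod (zak h M (\<theta> s) t))\<^sup>2"
      "\<And>s t. s < N \<Longrightarrow> t \<in> {0..M} \<Longrightarrow> (cmod (zak h M (\<theta> s) t))\<^sup>2 \<le> d s"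
    by metis
  have ne: "c ` {..<N} \<noteq> {}" "d ` {..<N} \<noteq> {}" using N by auto
  have lo: "Min (c ` {..<N}) \<le> c s" and up: "d s \<le> Max (d ` {..<N})" if "s < N" for s using that by auto
  show ?thesis
  proof (rule that[of "Min (c ` {..<N})" "Max (d ` {..<N})"])
    show "Min (c ` {..<N}) > 0" using cd(1) ne by (subst Min_gr_iff) auto
    have "0 < d 0" using cd(1)[OF N] cd(2)[OF N, of 0] cd(3)[OF N, of 0] M by auto
    thus "Max (d ` {..<N}) > 0" using up[OF N] by linarith
  qed (use lo up cd in \<open>meson order_trans\<close>)+
qed

text \<open>Parseval in \<open>l\<close> for each \<open>k\<close> removes the modulations. For
  fixed \<open>t\<close> the sum over \<open>k\<close> is a cyclic correlation, bounded uniformly in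
  \<open>t\<close> through the Zak transform on \<open>{0..M}\<close>; integrating these pointwise
  inequalities gives the frame bounds.\<close>

lemma L2TK_frame_gabor:
  assumes h: "exp_decay h" "continuous_on UNIV h" and N: "N > 0" and M: "M > 0"
    and nz: "\<And>s t. s < N \<Longrightarrow> zak h (real M) (- 2 * pi * real s / real N) t \<noteq> 0"
  shows "L2TK_frame (N * M) ({0..<N} \<times> UNIV) (gabor_PKg (\<lambda>x. of_real (h x)) (N * M) M)"
proof -
  let ?g = "\<lambda>x. complex_of_real (h x)"
  let ?e = "gabor_PKg ?g (N * M) M"
  let ?p = "periodize ?g (real N * real M)"
  let ?L = "lebesgue_on {0..real M}"
  have K: "real N * real M > 0" "N * M > 0" using N M by auto
  have M': "real M > 0" using M by simp
  have pc: "continuous_on UNIV ?p"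
    unfolding periodize_eq_zak[abs_def] by (rule zak_continuous[OF h K(1)])
  obtain c D where c: "c > 0" and D: "D > 0"
    and cb: "\<And>s t. s < N \<Longrightarrow> t \<in> {0..real M} \<Longrightarrow> c \<le> (cmod (zak h (real M) (- 2 * pi * real s / real N) t))\<^sup>2"
    and Db: "\<And>s t. s < N \<Longrightarrow> t \<in> {0..real M} \<Longrightarrow> (cmod (zak h (real M) (- 2 * pi * real s / real N) t))\<^sup>2 \<le> D"
    using zak_uniform_bounds[where \<theta> = "\<lambda>s. - 2 * pi * real s / real N", OF h M' N nz] by blast
  show ?thesis
    unfolding L2TK_frame_def
  proof (intro conjI exI allI impI ballI)
    show "L2TK (N * M) (?e i)" for i
    proof (cases i)
      case (Pair k l)
      have e: "?e (k, l) t = ?p (t - real (k * M)) * cis (2 * pi * (of_int l / real M) * t)" for t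
        using gabor_PKg_eq[OF K(2), of ?g M k l t] by simp
      have "continuous_on {0..real (N * M)} (?e (k, l))"
        unfolding e[abs_def] by (intro continuous_intros continuous_on_compose2[OF pc]) auto
      from L2_on_continuous[OF this] show ?thesis unfolding Pair L2TK_def L2_on_def .
    qed
    show "0 < real M * c" "0 < real M * D" using M c D by auto
    fix f assume f: "L2TK (N * M) f"
    hence f': "L2_on (real N * real M) f" by (simp add: L2TK_def L2_on_def)
    define G where "G = (\<lambda>k t. \<Sum>j<N. f (t + real j * real M) * ?p (t + of_int (int j - int k) * real M))"
    have tr: "L2_on (real M) (\<lambda>t. f (t + real j * real M))" if "j < N" for j
    proof -
      have "(1 + real j) * real M \<le> real N * real M" using that by (intro mult_right_mono) auto
      thus ?thesis by (intro L2_on_translate[OF f']) (auto simp: algebra_simps)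
    qed
    have GL: "L2_on (real M) (G k)" for k
      unfolding G_def
      by (intro L2_on_sum finite_lessThan L2_on_mult_continuous tr continuous_on_compose2[OF pc] continuous_intros) auto
    have norm: "L2TK_norm2 (N * M) f = (LINT t|?L. (\<Sum>j<N. (cmod (f (t + real j * real M)))\<^sup>2))"
    proof -
      have "L2TK_norm2 (N * M) f = (LINT t|lebesgue_on {0..real N * real M}. (cmod (f t))\<^sup>2)"
        by (simp add: L2TK_norm2_def)
      also have "\<dots> = (\<Sum>j<N. LINT t|?L. (cmod (f (t + real j * real M)))\<^sup>2)"
        using f' M' by (intro integral_split_translates) (auto simp: L2_on_def)
      also have "\<dots> = (LINT t|?L. (\<Sum>j<N. (cmod (f (t + real j * real M)))\<^sup>2))"
        using tr by (intro Bochner_Integration.integral_sum[symmetric]) (auto simp: L2_on_def)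
      finally show ?thesis .
    qed
    have fi: "integrable ?L (\<lambda>t. \<Sum>j<N. (cmod (f (t + real j * real M)))\<^sup>2)"
      using tr by (intro Bochner_Integration.integrable_sum) (auto simp: L2_on_def)
    have Gi: "integrable ?L (\<lambda>t. \<Sum>k<N. (cmod (G k t))\<^sup>2)"
      using GL by (intro Bochner_Integration.integrable_sum) (auto simp: L2_on_def)
    have tot: "((\<lambda>i. (cmod (L2TK_inner (N * M) f (?e i)))\<^sup>2) has_sum (real M * (LINT t|?L. (\<Sum>k<N. (cmod (G k t))\<^sup>2)))) ({0..<N} \<times> UNIV)"
    proof -
      have row: "((\<lambda>l. (cmod (L2TK_inner (N * M) f (?e (k, l))))\<^sup>2) has_sum (real M * (LINT t|?L. (cmod (G k t))\<^sup>2))) UNIV" for k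
        unfolding L2TK_inner_gabor[OF h N M f] G_def[symmetric] using parseval[OF M' GL] unfolding G_def .
      have "(\<Sum>k\<in>{0..<N}. real M * (LINT t|?L. (cmod (G k t))\<^sup>2)) = real M * (LINT t|?L. (\<Sum>k<N. (cmod (G k t))\<^sup>2))"
        using GL by (subst Bochner_Integration.integral_sum) (auto simp: L2_on_def sum_distrib_left atLeast0LessThan)
      hence g: "((\<lambda>k. real M * (LINT t|?L. (cmod (G k t))\<^sup>2)) has_sum (real M * (LINT t|?L. (\<Sum>k<N. (cmod (G k t))\<^sup>2)))) {0..<N}"
        using has_sum_finiteI[OF finite_atLeastLessThan] by metis
      show ?thesis
      proof (rule has_sum_SigmaI[OF row g])
        show "(\<lambda>i. (cmod (L2TK_inner (N * M) f (?e i)))\<^sup>2) summable_on {0..<N} \<times> UNIV"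
          by (rule summable_on_SigmaI[OF row has_sum_imp_summable[OF g]]) simp
      qed
    qed
    show "(\<lambda>i. (cmod (L2TK_inner (N * M) f (?e i)))\<^sup>2) summable_on {0..<N} \<times> UNIV"
      using tot by (rule has_sum_imp_summable)
    have sp: "t \<in> {0..real M}" if "t \<in> space ?L" for t using that by simp
    have "c * L2TK_norm2 (N * M) f = (LINT t|?L. c * (\<Sum>j<N. (cmod (f (t + real j * real M)))\<^sup>2))"
      unfolding norm by simp
    also have "\<dots> \<le> (LINT t|?L. (\<Sum>k<N. (cmod (G k t))\<^sup>2))"
      unfolding G_def
      by (intro integral_mono integrable_mult_right fi Gi[unfolded G_def] periodize_cyclic_bounds(1)[OF h(1) N M' cb Db] sp)
    finally show "real M * c * L2TK_norm2 (N * M) f \<le> (\<Sum>\<^sub>\<infinity>i\<in>{0..<N} \<times> UNIV. (cmod (L2TK_inner (N * M) f (?e i)))\<^sup>2)"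
      unfolding infsumI[OF tot] mult.assoc by (rule mult_left_mono) simp
    have "(LINT t|?L. (\<Sum>k<N. (cmod (G k t))\<^sup>2)) \<le> (LINT t|?L. D * (\<Sum>j<N. (cmod (f (t + real j * real M)))\<^sup>2))"
      unfolding G_def
      by (intro integral_mono integrable_mult_right fi Gi[unfolded G_def] periodize_cyclic_bounds(2)[OF h(1) N M' cb Db] sp)
    also have "\<dots> = D * L2TK_norm2 (N * M) f"
      unfolding norm by simp
    finally show "(\<Sum>\<^sub>\<infinity>i\<in>{0..<N} \<times> UNIV. (cmod (L2TK_inner (N * M) f (?e i)))\<^sup>2) \<le> real M * D * L2TK_norm2 (N * M) f"
      unfolding infsumI[OF tot] mult.assoc by (rule mult_left_mono) simp
  qed
qed

section \<open>Parity of the sampled points and the four frame statements\<close>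

lemma zak_cmult: "zak (\<lambda>x. C * h x) M \<theta> x = of_real C * zak h M \<theta> x"
  unfolding zak_def of_real_mult mult.assoc by (rule infsum_cmult_right')

text \<open>The \<open>N\<close>-th power of the left side is \<open>1\<close>, while that of
  \<open>-1\<close> is \<open>-1\<close>.\<close>

lemma cis_odd_root_of_unity:
  assumes N: "odd N"
  shows "cis (- 2 * pi * real s / real N) \<noteq> -1"
proof
  assume eq: "cis (- 2 * pi * real s / real N) = -1"
  have "N \<noteq> 0" using N by (cases N) auto
  hence "cis (- 2 * pi * real s / real N) ^ N = cis (2 * pi * of_int (- int s))"
    unfolding Complex.DeMoivre by simp
  also have "\<dots> = 1" unfolding cis_2pi_eq_1_iff by (rule Ints_of_int)
  finally show False using N unfolding eq by simp
qed

text \<open>Doubling would make an even number equal to a product of two odd ones.\<close>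

lemma nat_not_odd_half:
  assumes M: "odd M"
  shows "real r \<noteq> real M / 2 + of_int n * real M"
proof
  assume "real r = real M / 2 + of_int n * real M"
  hence "real_of_int (2 * int r) = of_int (int M * (1 + 2 * n))" by (simp add: field_simps)
  hence "2 * int r = int M * (1 + 2 * n)" by (simp only: of_int_eq_iff)
  moreover have "odd (int M * (1 + 2 * n))" using M by simp
  ultimately show False by (metis dvd_triv_left)
qed

theorem theorem8:
  fixes g :: "real \<Rightarrow> complex" and m M K :: nat
  assumes TP: "TP_finite_type g m" and m2: "m \<ge> 2"
    and cont: "continuous_on UNIV g"
    and M: "M \<ge> 1" and K: "K \<ge> 1" and MK: "M dvd K"
  shows "(odd (K div M) \<longrightarrow> L2TK_frame K ({0..<K div M} \<times> UNIV) (gabor_PKg g K M))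
       \<and> (odd (K div M) \<longrightarrow> CK_frame K ({0..<K div M} \<times> {0..<M}) (gabor_PKSg g K M))
       \<and> (even_fun g \<longrightarrow> odd M \<longrightarrow> l2Z_frame (UNIV \<times> {0..<M}) (gabor_Sg g M))
       \<and> (even_fun g \<longrightarrow> odd M \<longrightarrow> CK_frame K ({0..<K div M} \<times> {0..<M}) (gabor_PKSg g K M))"
proof -
  obtain C d where C: "C > 0" and d: "\<And>k. k < m \<Longrightarrow> d k \<noteq> 0"
    and g: "g = (\<lambda>x. of_real (C * exp_conv d (m - 1) x))"
    using TP_finite_type_exp_conv[OF TP m2 cont] by blast
  define u where "u = exp_conv d (m - 1)"
  define h where "h = (\<lambda>x. C * u x)"
  have gh: "g = (\<lambda>x. of_real (h x))" by (simp add: g h_def u_def)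
  have d': "\<And>k. k \<le> m - 1 \<Longrightarrow> d k \<noteq> 0" and j: "m - 1 > 0" using d m2 by auto
  have hd: "exp_decay h"
  proof -
    obtain B a where Ba: "0 < a" "\<And>x. \<bar>u x\<bar> \<le> B * exp (- a * \<bar>x\<bar>)"
      using exp_conv_decay[of "m - 1" d, OF d'] unfolding exp_decay_def u_def by blast
    have "\<bar>h x\<bar> \<le> (C * B) * exp (- a * \<bar>x\<bar>)" for x
      using mult_left_mono[OF Ba(2)[of x], of C] C by (simp add: h_def abs_mult mult.assoc)
    thus ?thesis unfolding exp_decay_def using Ba(1) by blast
  qed
  have hc: "continuous_on UNIV h"
    unfolding h_def u_def by (intro continuous_intros exp_conv_continuous d' j)
  define N where "N = K div M"
  have KN: "K = N * M" using MK by (simp add: N_def)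
  have N: "N > 0" and M0: "M > 0" and M': "real M > 0" using K M KN by auto
  have nz: "zak h (real M) (- 2 * pi * real s / real N) x \<noteq> 0" if "odd N" for s x
    using zak_exp_conv_nonzero[of "m - 1" d, OF d' j M' cis_odd_root_of_unity[OF that], of s x] C
    by (simp add: h_def u_def zak_cmult)
  have nz_even: "zak h (real M) \<theta> (real r) \<noteq> 0" if "even_fun g" "odd M" for \<theta> r
  proof -
    have ev: "exp_conv d (m - 1) (- x) = exp_conv d (m - 1) x" for x
    proof -
      have "complex_of_real (C * u (- x)) = of_real (C * u x)"
        using that(1) unfolding even_fun_def gh h_def by blast
      thus ?thesis using C by (simp only: of_real_eq_iff u_def) simp
    qed
    show ?thesis
      using zak_exp_conv_even_nonzero[of "m - 1" d, OF d' j M' ev nat_not_odd_half[OF that(2)]] C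
      by (simp add: h_def u_def zak_cmult)
  qed
  show ?thesis
    unfolding N_def[symmetric] unfolding KN
    using L2TK_frame_gabor[OF hd hc N M0 nz] CK_frame_gabor[OF hd N M0 nz]
      l2Z_frame_gabor[OF hd M0 nz_even] CK_frame_gabor[OF hd N M0 nz_even]
    unfolding gh[symmetric] by simp
qed

end
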